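(* In the setting described in the context (problem (P) satisfying assumptions (A1)–(A7), core function $K$ satisfying (K), $\rho=\gamma/(2N-1)$), let $\{(u^k,p^k)\}$ be generated by the algorithm SPDCL, let $(u^*,p^* )$ be a saddle point of $L$ over $\mathbf{U}\times\mathbf{C}^*$, let $\underline{\epsilon}>0$ be such that $\epsilon^k\ge\underline{\epsilon}$ for all $k$ with probability 1, and for $t>0$ let $\bar u_t=\sum_{k=0}^t\epsilon^ku^{k+1}\big/\sum_{k=0}^t\epsilon^k$. Let $d_3=\sup_{\|p\|<\mu}h_3(u^*,p)$ with $$h_3(u,p)=D(u,u^0)+\tfrac{N-1}{N}D(u^*,u^0)+\tfrac{\epsilon^0}{\gamma}\|p-p^0\|^2+\tfrac{(2N-1)(N-1)\epsilon^0}{N^2}\Big[\tfrac{\|p^*-p^0\|^2}{2\gamma}+L_\gamma(u^0,p^0)-L(u^*,p^* )\Big].$$ Then $$\mathbb{E}_{\mathcal{F}_t}\Big\{|F(\bar u_t)-F(u^* )|+\|\Pi(\Theta(\bar u_t))\|\Big\}\le\frac{(\mu+1)Nd_3}{(\mu-\|p^*\|)\underline{\epsilon}(t+1)}.$$ Moreover, let $0<\varepsilon<|F(u^0)-F(u^* )|+\|\Pi(\Theta(u^0))\|$ and $\eta\in(0,1)$ be arbitrary, and set $$\hat T:=\frac{(\mu+1)Nd_3}{\varepsilon\eta\underline{\epsilon}(\mu-\|p^*\|)}-1.$$ Then for all $t\ge\hat T$, $$\mathbb{P}\big\{|F(\bar u_t)-F(u^* )|+\|\Pi(\Theta(\bar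 u_t))\|\le\varepsilon\big\}\ge1-\eta.$$
   Context: Problem (P): minimize $G(u)+J(u)$ subject to $\Theta(u)=\Omega(u)+\Phi(u)\in-\mathbf{C}$, $u\in\mathbf{U}$. Here $\mathbf{U}\subset\mathbb{R}^n$ is closed convex, $\mathbf{U}=\mathbf{U}_1\times\cdots\times\mathbf{U}_N$ with $\mathbf{U}_i\subset\mathbb{R}^{n_i}$, $\sum_i n_i=n$; $\mathbf{C}\subset\mathbb{R}^m$ is a nonempty closed convex cone with vertex at the origin; $\mathbf{C}^*=\{y:\langle y,x\rangle\ge0\ \forall x\in\mathbf{C}\}$; $J(u)=\sum_{i=1}^N J_i(u_i)$ and $\Phi(u)=\sum_{i=1}^N\Phi_i(u_i)$; $\Omega,\Phi:\mathbb{R}^n\to\mathbb{R}^m$. A mapping $\Omega$ is $\mathbf{C}$-convex if $\Omega(\alpha u+(1-\alpha)v)-\alpha\Omega(u)-(1-\alpha)\Omega(v)\in-\mathbf{C}$ for all $u,v\in\mathbf{U}$, $\alpha\in[0,1]$. $\|\cdot\|$ is the Euclidean norm; the subscript $i$ on a vector or gradient denotes its $i$-th block. $F=G+J$. Assumptions. (A1) $J$ is convex, l.s.c., $\mathrm{dom}J\cap\mathbf{U}\ne\emptyset$, not necessarily differentiable, subdifferentiable on $\mathbf{U}$ with linearly bounded subgradients: there are $c_1,c_2>0$ with $\|r\|\le c_1\|u\|+c_2$ for all $u\in\mathbf{U}$, $r\in\partial J(u)$. (A2) $G$ is convex and differentiable with $B_G$-Lipschitz derivative. (A3) $\Omega$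 is $\mathbf{C}$-convex and differentiable, and there is $T\in\mathbf{C}$ such that $(\nabla\Omega(u)-\nabla\Omega(v))(u-v)-\|u-v\|^2T\in-\mathbf{C}$ for all $u,v\in\mathbf{U}$. (A4) $\Phi$ is $\mathbf{C}$-convex. (A5) $\Theta$ is $\tau$-Lipschitz on an open set $\mathcal{O}\supset\mathbf{U}$. (A6) If $\mathrm{int}\,\mathbf{C}\ne\emptyset$, then $\Theta(\mathbf{U})\cap(-\mathrm{int}\,\mathbf{C})\ne\emptyset$; if $\mathbf{C}=\{0\}$, then $0\in\mathrm{int}\,\Theta(\mathbf{U})$. (A7) The Lagrangian $L(u,p)=(G+J)(u)+\langle p,\Theta(u)\rangle$ has at least one saddle point $(u^*,p^* )\in\mathbf{U}\times\mathbf{C}^*$, i.e. $L(u^*,p)\le L(u^*,p^* )\le L(u,p^* )$ for all $u\in\mathbf{U}$, $p\in\mathbf{C}^*$. (K) $K$ is strongly convex with parameter $\beta$ and differentiable with $B$-Lipschitz gradient on $\mathbf{U}$; $D(u,v)=K(u)-K(v)-\langle\nabla K(v),u-v\rangle$. $\gamma>0$ is a parameter and $\rho=\gamma/(2N-1)$. $\Pi$ is the projection onto $\mathbf{C}^*$. $\mu_0$ is a bound on the norms of the dual optimal solutions of (P) (maximizers over $p\in\mathbf{C}^*$ of $\min_{u\in\mathbf{U}}L(u,p)$), $\mu=\mu_0+1$, $\mathfrak{B}_\mu=\{p\in\mathbb{R}^m:\|p\|\le\mu\}$, and $\mathcal{P}_\mu$ is the projection onto $\mathfrak{B}_\mu$.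 Augmented Lagrangian: $L_\gamma(u,p)=(G+J)(u)+\varphi(\Theta(u),p)$ with $\varphi(\theta,p)=[\|\Pi(p+\gamma\theta)\|^2-\|p\|^2]/(2\gamma)$. Algorithm SPDCL. Initialize $u^0\in\mathbf{U}$, $p^0\in\mathbb{R}^m$, and a number $\epsilon^{-1}>0$ (the stepsize with index $-1$). For $k=0,1,\dots$: put $q^k=\Pi(p^k+\gamma\Theta(u^k))$ and $\epsilon^k=\min\{\epsilon^{k-1},\frac{\beta}{2(B_G+\|q^k\|\,\|T\|+\gamma\tau^2)}\}$; choose $i(k)$ from $\{1,\dots,N\}$ with equal probability; let $u^{k+1}$ be the minimizer over $u\in\mathbf{U}$ of $\langle\nabla_{i(k)}G(u^k),u_{i(k)}\rangle+J_{i(k)}(u_{i(k)})+\langle q^k,\nabla_{i(k)}\Omega(u^k)u_{i(k)}+\Phi_{i(k)}(u_{i(k)})\rangle+\frac1{\epsilon^k}D(u,u^k)$; and let $p^{k+1}=\mathcal{P}_\mu\big(p^k+\frac{\rho}{\gamma}(\Pi(p^k+\gamma\Theta(u^{k+1}))-p^k)\big)$. $\mathcal{F}_t=\{i(0),\dots,i(t)\}$, and $\mathbb{E}_{\mathcal{F}_t}$ is the expectation with respect to $i(0),\dots,i(t)$.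
   Formalization: Formal version also assumes that in each primal step only block i(k) of u changes (automatic when K is additive over the blocks). Without this the claim fails, e.g. N=2, G=Θ=0, J=|u_1|+|u_2|, K=(u_1²-2c·u_1u_2+u_2²)/2 with c near 1. *)

theory Defs
  imports "HOL-Probability.Probability"
begin

text \<open>
  A decomposition of \<open>real^'n\<close> into blocks is a map \<open>b\<close> from coordinates to block labels; the factor
  space of block \<open>j\<close> is the coordinate subspace \<open>range (block b j)\<close>, i.e. the \<open>j\<close>-th block of a vector
  is kept inside \<open>real^'n\<close>, padded with zeros. This allows blocks of different dimensions.
\<close>

definition block :: "('n::finite \<Rightarrow> 'b) \<Rightarrow> 'b \<Rightarrow> real^'n \<Rightarrow> real^'n" where
  "block b j u = (\<chi> l. if b l = j then u $ l else 0)"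

definition block_product :: "('n::finite \<Rightarrow> 'b) \<Rightarrow> ('b \<Rightarrow> (real^'n) set) \<Rightarrow> (real^'n) set" where
  "block_product b Us = {u. \<forall>j. block b j u \<in> Us j}"

definition dual_cone :: "'a::real_inner set \<Rightarrow> 'a set" where
  "dual_cone C = {y. \<forall>x\<in>C. 0 \<le> y \<bullet> x}"

definition cone_convex_on ::
  "'a::real_vector set \<Rightarrow> 'c::real_vector set \<Rightarrow> ('a \<Rightarrow> 'c) \<Rightarrow> bool" where
  "cone_convex_on U C f \<longleftrightarrow> (\<forall>u\<in>U. \<forall>v\<in>U. \<forall>\<alpha>\<in>{0..1}.
     f (\<alpha> *\<^sub>R u + (1 - \<alpha>) *\<^sub>R v) - \<alpha> *\<^sub>R f u - (1 - \<alpha>) *\<^sub>R f v \<in> uminus ` C)"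

definition strongly_convex_on :: "real \<Rightarrow> 'a::real_normed_vector set \<Rightarrow> ('a \<Rightarrow> real) \<Rightarrow> bool" where
  "strongly_convex_on \<beta> U f \<longleftrightarrow> (\<forall>u\<in>U. \<forall>v\<in>U. \<forall>\<alpha>\<in>{0..1}.
     f (\<alpha> *\<^sub>R u + (1 - \<alpha>) *\<^sub>R v) \<le>
       \<alpha> * f u + (1 - \<alpha>) * f v - \<beta> / 2 * \<alpha> * (1 - \<alpha>) * (norm (u - v))\<^sup>2)"

definition ext_convex :: "('a::real_vector \<Rightarrow> ereal) \<Rightarrow> bool" where
  "ext_convex f \<longleftrightarrow> convex {(x, r::real). f x \<le> ereal r}"

definition lower_semicontinuous :: "('a::topological_space \<Rightarrow> ereal) \<Rightarrow> bool" where
  "lower_semicontinuous f \<longleftrightarrow> (\<forall>x. f x \<le> Liminf (at x) f)"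

definition subdifferential :: "('a::real_inner \<Rightarrow> ereal) \<Rightarrow> 'a \<Rightarrow> 'a set" where
  "subdifferential f u =
     {r. \<bar>f u\<bar> \<noteq> \<infinity> \<and> (\<forall>v. f u + ereal (r \<bullet> (v - u)) \<le> f v)}"

definition bregman :: "('a::real_inner \<Rightarrow> real) \<Rightarrow> ('a \<Rightarrow> 'a) \<Rightarrow> 'a \<Rightarrow> 'a \<Rightarrow> real" where
  "bregman K gradK u v = K u - K v - gradK v \<bullet> (u - v)"

definition lagrangian ::
  "('a \<Rightarrow> ereal) \<Rightarrow> ('a \<Rightarrow> 'c::real_inner) \<Rightarrow> 'a \<Rightarrow> 'c \<Rightarrow> ereal" where
  "lagrangian F \<Theta> u p = F u + ereal (p \<bullet> \<Theta> u)"

definition aug_lagrangian ::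
  "('a \<Rightarrow> ereal) \<Rightarrow> ('a \<Rightarrow> 'c::euclidean_space) \<Rightarrow> 'c set \<Rightarrow> real \<Rightarrow> 'a \<Rightarrow> 'c \<Rightarrow> ereal" where
  "aug_lagrangian F \<Theta> C \<gamma> u p = F u +
     ereal (((norm (closest_point (dual_cone C) (p + \<gamma> *\<^sub>R \<Theta> u)))\<^sup>2 - (norm p)\<^sup>2) / (2 * \<gamma>))"

definition saddle_point ::
  "('a \<Rightarrow> 'c \<Rightarrow> ereal) \<Rightarrow> 'a set \<Rightarrow> 'c set \<Rightarrow> 'a \<Rightarrow> 'c \<Rightarrow> bool" where
  "saddle_point L U P us ps \<longleftrightarrow> us \<in> U \<and> ps \<in> P \<and>
     (\<forall>u\<in>U. \<forall>p\<in>P. L us p \<le> L us ps \<and> L us ps \<le> L u ps)"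

definition dual_solutions :: "('a \<Rightarrow> 'c \<Rightarrow> ereal) \<Rightarrow> 'a set \<Rightarrow> 'c set \<Rightarrow> 'c set" where
  "dual_solutions L U P = {p \<in> P. \<forall>p'\<in>P. (INF u\<in>U. L u p') \<le> (INF u\<in>U. L u p)}"

text \<open>Upper bound on the stepsize for the multiplier estimate \<open>q\<close>.\<close>

definition spdcl_bound :: "real \<Rightarrow> real \<Rightarrow> real \<Rightarrow> real \<Rightarrow> 'c::real_normed_vector \<Rightarrow> 'c \<Rightarrow> real" where
  "spdcl_bound \<beta> B\<^sub>G \<gamma> \<tau> T q = \<beta> / (2 * (B\<^sub>G + norm q * norm T + \<gamma> * \<tau>\<^sup>2))"

text \<open>
  Objective of the primal subproblem for block \<open>j\<close> at \<open>v\<close>, multiplier estimate \<open>q\<close>, stepsize \<open>e\<close>.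
  \<open>dOm v\<close> is the derivative of \<open>\<Omega>\<close> at \<open>v\<close>; on a zero-padded block it is the partial derivative.
\<close>

definition spdcl_objective ::
  "('n::finite \<Rightarrow> 'b) \<Rightarrow> (real^'n \<Rightarrow> real^'n) \<Rightarrow> ('b \<Rightarrow> real^'n \<Rightarrow> ereal) \<Rightarrow>
   (real^'n \<Rightarrow> real^'n \<Rightarrow> 'c::real_inner) \<Rightarrow> ('b \<Rightarrow> real^'n \<Rightarrow> 'c) \<Rightarrow>
   (real^'n \<Rightarrow> real) \<Rightarrow> (real^'n \<Rightarrow> real^'n) \<Rightarrow>
   'b \<Rightarrow> real^'n \<Rightarrow> 'c \<Rightarrow> real \<Rightarrow> real^'n \<Rightarrow> ereal" where
  "spdcl_objective b gradG Js dOm Phs K gradK j v q e u =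
     ereal (block b j (gradG v) \<bullet> block b j u) + Js j (block b j u)
     + ereal (q \<bullet> (dOm v (block b j u) + Phs j (block b j u)))
     + ereal (1 / e * bregman K gradK u v)"

text \<open>
  One primal coordinate step: \<open>w\<close> minimizes \<open>obj\<close> over all of \<open>U\<close> and only block \<open>j\<close> moves. The second
  clause is automatic when the core function \<open>K\<close> is a sum of functions of the individual blocks. For
  a \<open>K\<close> that couples blocks the minimizer may move every block and the method is then not a
  coordinate method; e.g. for \<open>G = 0\<close>, \<open>\<Theta> = 0\<close>, \<open>J x = \<bar>x\<^sub>1\<bar> + \<bar>x\<^sub>2\<bar>\<close> and
  \<open>K x = (x\<^sub>1\<^sup>2 - 2 c x\<^sub>1 x\<^sub>2 + x\<^sub>2\<^sup>2) / 2\<close>, started at \<open>(1, 0)\<close> with stepsize 1, the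
  expected objective after \<open>k\<close> steps is \<open>((1 + c) / 2) ^ k\<close>, so there is no rate that is uniform
  in \<open>c < 1\<close>.
\<close>

definition spdcl_primal_step ::
  "('n::finite \<Rightarrow> 'b) \<Rightarrow> (real^'n) set \<Rightarrow> (real^'n \<Rightarrow> ereal) \<Rightarrow> 'b \<Rightarrow> real^'n \<Rightarrow> real^'n \<Rightarrow> bool" where
  "spdcl_primal_step b U obj j v w \<longleftrightarrow>
     is_arg_min obj (\<lambda>u. u \<in> U) w \<and> (\<forall>l. l \<noteq> j \<longrightarrow> block b l w = block b l v)"

end

theory Submission
  imports Defs
begin

text \<open>
  The idea. Write \<open>x = \<gamma> \<Theta>(u)\<close> and let \<open>\<Pi>\<close> be the projection onto the dual cone. The augmentation term
  \<open>\<parallel>\<Pi>(p + x)\<parallel>\<^sup>2 - \<parallel>p\<parallel>\<^sup>2\<close> is smooth and convex in \<open>x\<close>, concave in \<open>p\<close>, and is the maximum over the dual cone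
  of \<open>2 \<langle>y, x\<rangle> - \<parallel>y - p\<parallel>\<^sup>2\<close>. Hence the augmented Lagrangian \<open>aug\<close> can be decreased in \<open>u\<close> by proximal
  steps and dominates the Lagrangian up to distances in the dual variable.

  A primal step is a Bregman proximal step on one block. Because the other blocks stay put, averaging
  the three-point inequality over the chosen block turns its right-hand side into \<open>1/N\<close> times a full
  first-order gap: with \<open>A = aug(u, p) - F(u\<^sup>*)\<close> before and \<open>B = aug(u', p) - F(u\<^sup>*)\<close> after the step,
  \<open>E [D(u\<^sup>*, u') + \<epsilon> B] \<le> D(u\<^sup>*, u) + (1 - 1/N) \<epsilon> A\<close> (\<open>primal_descent\<close>). The excess of the left over the right
  is called \<open>surplus\<close>; its mean is not positive. The dual step moves \<open>p\<close> the fraction \<open>1/(2N-1)\<close> of the way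
  to \<open>\<Pi>(p + x')\<close>. For every \<open>y\<close> in the dual cone it bounds the Lagrangian at \<open>(u', y)\<close> by \<open>B\<close> and a
  telescoping difference of \<open>\<parallel>y - p\<parallel>\<^sup>2\<close> (\<open>upd_gain\<close>), and by concavity it changes \<open>aug\<close> by little
  (\<open>aug_term_upd\<close>). So \<open>D\<close>, \<open>\<epsilon> A\<close> and \<open>\<epsilon> \<parallel>y - p\<parallel>\<^sup>2\<close> together form a Lyapunov function (\<open>potential\<close>).

  The stepsizes decrease while \<open>A\<close> may be negative, so a nonnegative offset must be added to \<open>A\<close>. One choice is
  \<open>\<parallel>p\<^sup>* - p\<parallel>\<^sup>2 / (2\<gamma>)\<close>, which moves with \<open>p\<close> and is controlled by the dual inequality for \<open>y = p\<^sup>*\<close> at the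
  price of a factor \<open>2N - 1\<close> on the primal part of the potential. The other is the constant \<open>4\<mu>\<^sup>2 / (2\<gamma>)\<close>, available
  once \<open>p\<close> lies in the ball of radius \<open>\<mu>\<close>; then the factor is only \<open>N\<close>. If \<open>p\<^sub>0\<close> lies in the ball, the moving
  offset alone gives the constant \<open>N d\<^sub>3\<close>. But \<open>p\<^sub>0\<close> is arbitrary, and the first truncation can then
  increase \<open>2\<gamma> aug\<close> by \<open>2 \<langle>\<Pi>(p\<^sub>0 + x') - p\<^sub>0, e\<rangle>\<close>, \<open>e\<close> being the displacement by the truncation. This is paid for
  by the supremum \<open>(\<parallel>p\<^sub>0\<parallel> + \<mu>)\<^sup>2\<close> of \<open>\<parallel>y - p\<^sub>0\<parallel>\<^sup>2\<close> in \<open>d\<^sub>3\<close> and the curvature left over in the first primal step, after a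
  case distinction: if \<open>\<Pi>(p\<^sub>0 + x')\<close> is not far from \<open>p\<^sup>*\<close>, the moving offset still works
  (\<open>first_step_moving_offset\<close>); otherwise \<open>B\<close> is large, the inequality \<open>N \<le> 2N - 1\<close> leaves a
  multiple \<open>N - 1\<close> of \<open>B\<close> unused, and that pays for the fixed offset (\<open>first_step_fixed_offset\<close>).

  The resulting pathwise estimate (\<open>path_bound\<close>) holds for all \<open>y\<close> at once, so \<open>y\<close> may depend on the outcome:
  \<open>y\<close> in the direction of \<open>\<Pi>(\<Theta>(u))\<close> at the average \<open>u\<close> turns it into a bound on the gap (\<open>gap_bound\<close>).
  On the probabilistic side, the primal minimizer is unique, so the state at time \<open>k\<close> is a function of the first
  \<open>k\<close> block choices. Each prefix of choices has positive probability, hence expectations are finite sums, the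
  conditional mean of a step is the mean over the \<open>N\<close> possible continuations (\<open>expectation_branch\<close>), and
  almost sure statements about the state hold everywhere (\<open>determined_AE\<close>). The tail estimate is Markov's
  inequality.
\<close>

section \<open>The augmentation term of a closed convex cone\<close>

locale closed_cone =
  fixes S :: "'a::euclidean_space set"
  assumes closed: "closed S" and cone: "convex_cone S"
begin

definition proj :: "'a \<Rightarrow> 'a" where
  "proj = closest_point S"

text \<open>
  With \<open>x = \<gamma> \<Theta>(u)\<close> this is \<open>2\<gamma>\<close> times the term that the augmented Lagrangian adds to the objective.
\<close>

definition aug_term :: "'a \<Rightarrow> 'a \<Rightarrow> real" where
  "aug_term x p = (norm (proj (p + x)))\<^sup>2 - (norm p)\<^sup>2"

lemma set_nonempty: "S \<noteq> {}" and set_convex: "convex S" and set_conic: "conic S"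
  using cone by (auto simp: convex_cone_def)

lemma zero_in: "0 \<in> S"
  using cone convex_cone_contains_0 by blast

lemma proj_in: "proj x \<in> S"
  unfolding proj_def by (rule closest_point_in_set[OF closed set_nonempty])

lemma proj_orth: "(x - proj x) \<bullet> proj x = 0"
proof -
  have "2 *\<^sub>R proj x \<in> S"
    using set_conic proj_in[of x] unfolding conic_def by (meson zero_le_numeral)
  then have "(x - proj x) \<bullet> (2 *\<^sub>R proj x - proj x) \<le> 0"
    unfolding proj_def by (rule closest_point_dot[OF set_convex closed])
  moreover have "(x - proj x) \<bullet> (0 - proj x) \<le> 0"
    unfolding proj_def by (rule closest_point_dot[OF set_convex closed zero_in])
  ultimately show ?thesis
    by (simp add: inner_simps)
qed

text \<open>
  Moreau's decomposition: what the projection onto a cone removes lies in the polar cone.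
\<close>

lemma proj_polar:
  assumes "y \<in> S"
  shows "(x - proj x) \<bullet> y \<le> 0"
proof -
  have "(x - proj x) \<bullet> (y - proj x) \<le> 0"
    unfolding proj_def by (rule closest_point_dot[OF set_convex closed assms])
  then show ?thesis
    using proj_orth[of x] by (simp add: inner_diff_right)
qed

text \<open>
  The augmentation term is the supremum over the cone of the proximally regularized linear form
  \<open>2 \<langle>y, x\<rangle> - \<parallel>y - p\<parallel>\<^sup>2\<close>; strong concavity in \<open>y\<close> yields the last term.
\<close>

lemma aug_term_dual:
  assumes "y \<in> S"
  shows "2 * (y \<bullet> x) \<le> aug_term x p + (norm (y - p))\<^sup>2 - (norm (y - proj (p + x)))\<^sup>2"
  using proj_polar[OF assms, of "p + x"] unfolding aug_term_def
  by (simp add: power2_norm_eq_inner inner_simps inner_commute)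

lemma aug_term_attained: "2 * (proj (p + x) \<bullet> x) = aug_term x p + (norm (proj (p + x) - p))\<^sup>2"
  using proj_orth[of "p + x"] unfolding aug_term_def
  by (simp add: power2_norm_eq_inner inner_simps inner_commute)

text \<open>
  The gradient in \<open>x\<close> is \<open>2 \<Pi>(p + x)\<close>, which is \<open>2\<close>-Lipschitz because projections are nonexpansive.
\<close>

lemma aug_term_descent:
  "aug_term x' p \<le> aug_term x p + 2 * (proj (p + x) \<bullet> (x' - x)) + (norm (x' - x))\<^sup>2"
proof -
  let ?q = "proj (p + x)" and ?q' = "proj (p + x')"
  have "0 \<le> (norm (?q' - ?q - (x' - x)))\<^sup>2" by simp
  then show ?thesis
    using aug_term_dual[OF proj_in, of "p + x'" x p] aug_term_attained[of p x']
    by (simp add: power2_norm_eq_inner inner_simps inner_commute)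
qed

text \<open>
  As the maximum over \<open>y\<close> of a function that is jointly concave in \<open>(y, p)\<close>, the term is concave in \<open>p\<close>;
  its gradient there is \<open>2 (\<Pi>(p + x) - p)\<close>.
\<close>

lemma aug_term_concave:
  "aug_term x p' \<le> aug_term x p + 2 * ((proj (p + x) - p) \<bullet> (p' - p))"
proof -
  let ?q = "proj (p + x)" and ?q' = "proj (p' + x)"
  have "0 \<le> (norm ((?q' - p) - (?q - p) - (p' - p)))\<^sup>2" by simp
  then show ?thesis
    using aug_term_dual[OF proj_in, of "p' + x" x p] aug_term_attained[of p' x]
    by (simp add: power2_norm_eq_inner inner_simps inner_commute)
qed

end

section \<open>One truncated dual step\<close>

locale dual_update = closed_cone S for S :: "'a::euclidean_space set" +
  fixes N \<mu> :: real and ps :: 'a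
  assumes N: "1 \<le> N" and ps: "ps \<in> S" "norm ps \<le> \<mu>" and mu_pos: "0 < \<mu>"
begin

definition upd :: "'a \<Rightarrow> 'a \<Rightarrow> 'a" where
  "upd x p = closest_point (cball 0 \<mu>) (p + (1 / (2 * N - 1)) *\<^sub>R (proj (p + x) - p))"

text \<open>
  The displacement that the projection onto the ball adds to the relaxed dual step.
\<close>

definition trunc :: "'a \<Rightarrow> 'a \<Rightarrow> 'a" where
  "trunc x p = upd x p - p - (1 / (2 * N - 1)) *\<^sub>R (proj (p + x) - p)"

lemma upd_ball: "norm (upd x p) \<le> \<mu>"
  using closest_point_in_set[of "cball 0 \<mu>"] mu_pos
  by (auto simp: upd_def dist_norm)

lemma trunc_obtuse:
  assumes "norm y \<le> \<mu>"
  shows "0 \<le> (y - upd x p) \<bullet> trunc x p"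
proof -
  let ?z = "p + (1 / (2 * N - 1)) *\<^sub>R (proj (p + x) - p)"
  have "(?z - closest_point (cball 0 \<mu>) ?z) \<bullet> (y - closest_point (cball 0 \<mu>) ?z) \<le> 0"
    by (rule closest_point_dot) (use assms in auto)
  moreover have "trunc x p = closest_point (cball 0 \<mu>) ?z - ?z"
    by (simp add: trunc_def upd_def algebra_simps)
  ultimately show ?thesis
    unfolding upd_def by (simp add: inner_simps inner_commute)
qed

text \<open>
  The factor \<open>2N - 1\<close> is the inverse of the relaxation parameter, so that the cross terms
  \<open>\<langle>y - p, \<Pi>(p + x) - p\<rangle>\<close> of the two squared distances cancel. The truncation is kept exactly: the first
  step, where it is not harmless, needs its contribution.
\<close>

lemma upd_gain:
  fixes x y p
  assumes "y \<in> S"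
  defines "d \<equiv> proj (p + x) - p"
  shows "2 * (y \<bullet> x) + (2 * N - 1) * (norm (y - upd x p))\<^sup>2
    \<le> aug_term x p + (2 * N - 1) * (norm (y - p))\<^sup>2 - (1 - 1 / (2 * N - 1)) * (norm d)\<^sup>2
      - 2 * (2 * N - 1) * ((y - upd x p) \<bullet> trunc x p) - (2 * N - 1) * (norm (trunc x p))\<^sup>2"
proof -
  define m where "m = 2 * N - 1"
  have m: "0 < m" using N by (simp add: m_def)
  define e where "e = trunc x p"
  have u: "y - upd x p = (y - p) - (1 / m) *\<^sub>R d - e"
    by (simp add: e_def trunc_def d_def m_def)
  have "(norm (y - upd x p))\<^sup>2 + 2 * ((y - upd x p) \<bullet> e) + (norm e)\<^sup>2 = (norm ((y - p) - (1 / m) *\<^sub>R d))\<^sup>2"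
    unfolding u power2_norm_eq_inner by (simp add: inner_simps inner_commute)
  also have "\<dots> = (norm (y - p))\<^sup>2 - (2 / m) * ((y - p) \<bullet> d) + (1 / m)\<^sup>2 * (norm d)\<^sup>2"
    unfolding power2_norm_eq_inner
    by (simp add: inner_simps inner_commute power2_eq_square diff_divide_distrib)
  finally have "m * ((norm (y - upd x p))\<^sup>2 + 2 * ((y - upd x p) \<bullet> e) + (norm e)\<^sup>2)
      = m * ((norm (y - p))\<^sup>2 - (2 / m) * ((y - p) \<bullet> d) + (1 / m)\<^sup>2 * (norm d)\<^sup>2)" by simp
  also have "\<dots> = m * (norm (y - p))\<^sup>2 - 2 * ((y - p) \<bullet> d) + (1 / m) * (norm d)\<^sup>2"
    using m by (simp add: field_simps power2_eq_square)
  finally have 1: "m * (norm (y - upd x p))\<^sup>2 + 2 * m * ((y - upd x p) \<bullet> e) + m * (norm e)\<^sup>2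
      = m * (norm (y - p))\<^sup>2 - 2 * ((y - p) \<bullet> d) + (1 / m) * (norm d)\<^sup>2"
    by (simp add: algebra_simps)
  have "2 * (y \<bullet> x) \<le> aug_term x p + (norm (y - p))\<^sup>2 - (norm (y - proj (p + x)))\<^sup>2"
    by (rule aug_term_dual[OF assms(1)])
  also have "(norm (y - proj (p + x)))\<^sup>2 = (norm (y - p))\<^sup>2 - 2 * ((y - p) \<bullet> d) + (norm d)\<^sup>2"
    unfolding d_def power2_norm_eq_inner by (simp add: inner_simps inner_commute)
  finally show ?thesis
    using 1 unfolding m_def[symmetric] e_def[symmetric] by (simp add: algebra_simps)
qed

lemma aug_term_upd:
  "aug_term x (upd x p) \<le> aug_term x p + 2 / (2 * N - 1) * (norm (proj (p + x) - p))\<^sup>2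
     + 2 * ((proj (p + x) - p) \<bullet> trunc x p)"
proof -
  define d where "d = proj (p + x) - p"
  have "upd x p - p = (1 / (2 * N - 1)) *\<^sub>R d + trunc x p"
    by (simp add: trunc_def d_def)
  then show ?thesis
    using aug_term_concave[of x "upd x p" p] unfolding d_def[symmetric]
    by (simp add: inner_simps power2_norm_eq_inner)
qed

text \<open>
  Inside the ball the truncation works against the dual step, so it does not raise the bound of \<open>aug_term_upd\<close>.
\<close>

lemma trunc_inward:
  assumes "norm p \<le> \<mu>"
  shows "(proj (p + x) - p) \<bullet> trunc x p \<le> 0"
proof -
  let ?d = "proj (p + x) - p"
  have "p - upd x p = - (1 / (2 * N - 1)) *\<^sub>R ?d - trunc x p"
    by (simp add: trunc_def)
  then have "(1 / (2 * N - 1)) * (?d \<bullet> trunc x p) + trunc x p \<bullet> trunc x p \<le> 0"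
    using trunc_obtuse[OF assms, of x p] by (simp add: inner_diff_left)
  then have "(1 / (2 * N - 1)) * (?d \<bullet> trunc x p) \<le> 0"
    using inner_ge_zero[of "trunc x p"] by linarith
  then show ?thesis
    using N by (simp add: divide_le_0_iff)
qed

lemma upd_gain_ball:
  assumes "y \<in> S" "norm y \<le> \<mu>"
  shows "2 * (y \<bullet> x) + (2 * N - 1) * (norm (y - upd x p))\<^sup>2
    \<le> aug_term x p + (2 * N - 1) * (norm (y - p))\<^sup>2 - (1 - 1 / (2 * N - 1)) * (norm (proj (p + x) - p))\<^sup>2"
proof -
  have "0 \<le> (2 * N - 1) * ((y - upd x p) \<bullet> trunc x p)" "0 \<le> (2 * N - 1) * (norm (trunc x p))\<^sup>2"
    using trunc_obtuse[OF assms(2)] N by auto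
  then show ?thesis
    using upd_gain[OF assms(1), of x p] by linarith
qed

text \<open>
  Add \<open>upd_gain_ball\<close> for \<open>y\<close>, its \<open>n\<close>-fold multiple for \<open>p\<^sup>*\<close> and the \<open>m n\<close>-fold multiple of \<open>aug_term_upd\<close>. With
  the inverse relaxation \<open>m = 2N - 1\<close> and \<open>n = 1 - 1/N\<close>, the objective terms balance because \<open>m n + n + 1 = m\<close>, and the
  squared dual steps cancel because \<open>m n (2 / m) = (1 - 1/m) (1 + n)\<close>.
\<close>

lemma step_moving_offset:
  assumes y: "y \<in> S" "norm y \<le> \<mu>" and p: "norm p \<le> \<mu>" and f: "0 \<le> f + 2 * (ps \<bullet> x)"
  shows "f + 2 * (y \<bullet> x) + (2 * N - 1) * (norm (y - upd x p))\<^sup>2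
      + (2 * N - 1) * (N - 1) / N * (f + aug_term x (upd x p) + (norm (ps - upd x p))\<^sup>2)
    \<le> (2 * N - 1) * (f + aug_term x p) + (2 * N - 1) * (N - 1) / N * (norm (ps - p))\<^sup>2
      + (2 * N - 1) * (norm (y - p))\<^sup>2"
proof -
  define m where "m = 2 * N - 1"
  define a where "a = 1 / m"
  define n where "n = (N - 1) / N"
  have m: "0 < m" and n: "0 \<le> n" using N by (auto simp: m_def n_def)
  let ?d = "(norm (proj (p + x) - p))\<^sup>2"
  have aug_le: "aug_term x (upd x p) \<le> aug_term x p + 2 * a * ?d"
    using aug_term_upd[of x p] trunc_inward[OF p, of x] by (simp add: m_def a_def)
  have g: "2 * (y \<bullet> x) + m * (norm (y - upd x p))\<^sup>2 \<le> aug_term x p + m * (norm (y - p))\<^sup>2 - (1 - a) * ?d"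
    using upd_gain_ball[OF y, of x p] by (simp add: m_def a_def)
  have gs: "2 * (ps \<bullet> x) + m * (norm (ps - upd x p))\<^sup>2 \<le> aug_term x p + m * (norm (ps - p))\<^sup>2 - (1 - a) * ?d"
    using upd_gain_ball[OF ps, of x p] by (simp add: m_def a_def)
  have gs': "n * (m * (norm (ps - upd x p))\<^sup>2) \<le> n * (f + aug_term x p + m * (norm (ps - p))\<^sup>2 - (1 - a) * ?d)"
    by (rule mult_left_mono) (use gs f n in auto)
  have scaled_aug_le: "m * n * aug_term x (upd x p) \<le> m * n * (aug_term x p + 2 * a * ?d)"
    by (rule mult_left_mono[OF aug_le]) (use m n in auto)
  have c1: "m * n + n + 1 = m" and c2: "m * n * (2 * a) = (1 - a) * (1 + n)"
    using N by (auto simp: a_def m_def n_def field_simps)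
  have "m * n * (2 * a) * ?d = (1 - a) * ?d + n * ((1 - a) * ?d)"
    unfolding c2 by (simp add: algebra_simps)
  moreover have "m * (f + aug_term x p) = m * n * (f + aug_term x p) + n * (f + aug_term x p) + (f + aug_term x p)"
    by (metis c1 distrib_right mult_1)
  ultimately have "f + 2 * (y \<bullet> x) + m * (norm (y - upd x p))\<^sup>2
      + m * n * (f + aug_term x (upd x p) + (norm (ps - upd x p))\<^sup>2)
    \<le> m * (f + aug_term x p) + m * n * (norm (ps - p))\<^sup>2 + m * (norm (y - p))\<^sup>2"
    using g gs' scaled_aug_le by (simp add: algebra_simps)
  then show ?thesis by (simp add: m_def n_def)
qed

text \<open>
  A constant offset need not be controlled along the path, so the weight of the primal part drops from
  \<open>2N - 1\<close> to \<open>N\<close>.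
\<close>

lemma step_fixed_offset:
  assumes y: "y \<in> S" "norm y \<le> \<mu>" and p: "norm p \<le> \<mu>"
  shows "f + 2 * (y \<bullet> x) + (2 * N - 1) * (norm (y - upd x p))\<^sup>2 + (N - 1) * (f + aug_term x (upd x p))
    \<le> N * (f + aug_term x p) + (2 * N - 1) * (norm (y - p))\<^sup>2"
proof -
  define m where "m = 2 * N - 1"
  have m: "0 < m" using N by (auto simp: m_def)
  let ?d = "(norm (proj (p + x) - p))\<^sup>2"
  have a: "aug_term x (upd x p) \<le> aug_term x p + 2 / m * ?d"
    using aug_term_upd[of x p] trunc_inward[OF p, of x] unfolding m_def[symmetric] by simp
  have g: "2 * (y \<bullet> x) + m * (norm (y - upd x p))\<^sup>2 \<le> aug_term x p + m * (norm (y - p))\<^sup>2 - (1 - 1 / m) * ?d"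
    using upd_gain_ball[OF y, of x p] unfolding m_def by simp
  have a': "(N - 1) * aug_term x (upd x p) \<le> (N - 1) * (aug_term x p + 2 / m * ?d)"
    by (rule mult_left_mono[OF a]) (use N in auto)
  have c2: "(N - 1) * (2 / m) = 1 - 1 / m"
    using N by (auto simp: m_def field_simps)
  have "(N - 1) * (2 / m) * ?d = (1 - 1 / m) * ?d" unfolding c2 ..
  then show ?thesis
    using g a' unfolding m_def[symmetric] by (simp add: algebra_simps)
qed

text \<open>
  The truncation acts radially: if it acts at all, the new point lies on the sphere, opposite to the displacement.
\<close>

lemma upd_inner_trunc: "upd x p \<bullet> trunc x p = - \<mu> * norm (trunc x p)"
proof (cases "trunc x p = 0")
  case False
  let ?e = "trunc x p"
  have "0 \<le> (- (\<mu> / norm ?e) *\<^sub>R ?e - upd x p) \<bullet> ?e"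
    by (rule trunc_obtuse) (use mu_pos False in simp)
  then have "upd x p \<bullet> ?e \<le> - \<mu> * norm ?e"
    using False by (simp add: inner_diff_left dot_square_norm power2_eq_square)
  moreover have "- (upd x p \<bullet> ?e) \<le> norm (upd x p) * norm ?e"
    using Cauchy_Schwarz_ineq2[of "upd x p" ?e] by linarith
  moreover have "norm (upd x p) * norm ?e \<le> \<mu> * norm ?e"
    by (rule mult_right_mono[OF upd_ball]) simp
  ultimately show ?thesis by linarith
qed simp

text \<open>
  Up to the factor \<open>2\<close>, the amount by which the bound \<open>(\<parallel>p\<parallel> + \<mu>)\<^sup>2\<close> on \<open>\<parallel>y - p\<parallel>\<^sup>2\<close> exceeds what the dual
  step actually needs when it starts outside the ball.
\<close>

definition radial :: "'a \<Rightarrow> 'a \<Rightarrow> real" where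
  "radial x p = \<mu> * (norm (trunc x p) + norm p - norm (p + trunc x p))"

lemma radial_nonneg: "0 \<le> radial x p"
  using norm_triangle_ineq[of p "trunc x p"] mu_pos
  by (simp add: radial_def)

lemma inner_start_trunc:
  "p \<bullet> trunc x p = - (\<mu> * norm (trunc x p) + (norm (trunc x p))\<^sup>2
     + (1 / (2 * N - 1)) * ((proj (p + x) - p) \<bullet> trunc x p))"
proof -
  let ?d = "(1 / (2 * N - 1)) *\<^sub>R (proj (p + x) - p)"
  have "p = upd x p - ?d - trunc x p" by (simp add: trunc_def)
  then have "p \<bullet> trunc x p = upd x p \<bullet> trunc x p - ?d \<bullet> trunc x p - trunc x p \<bullet> trunc x p"
    by (metis inner_diff_left)
  then show ?thesis
    using upd_inner_trunc[of x p] by (simp add: power2_norm_eq_inner)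
qed

lemma radial_gain:
  assumes "norm y \<le> \<mu>"
  shows "(norm (y - p))\<^sup>2 - 2 * ((y - upd x p) \<bullet> trunc x p) \<le> (norm p + \<mu>)\<^sup>2 - 2 * radial x p"
proof -
  let ?e = "trunc x p"
  have "- (y \<bullet> (p + ?e)) \<le> norm y * norm (p + ?e)"
    using Cauchy_Schwarz_ineq2[of y "p + ?e"] by linarith
  also have "\<dots> \<le> \<mu> * norm (p + ?e)"
    by (rule mult_right_mono[OF assms]) simp
  finally have 1: "- (y \<bullet> (p + ?e)) \<le> \<mu> * norm (p + ?e)" .
  have 2: "(norm y)\<^sup>2 \<le> \<mu>\<^sup>2"
    using assms by (simp add: power_mono)
  have "(norm (y - p))\<^sup>2 - 2 * ((y - upd x p) \<bullet> ?e)
      = (norm y)\<^sup>2 - 2 * (y \<bullet> (p + ?e)) + (norm p)\<^sup>2 + 2 * (upd x p \<bullet> ?e)"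
    by (simp add: power2_norm_eq_inner inner_simps inner_commute)
  also have "\<dots> \<le> \<mu>\<^sup>2 + 2 * (\<mu> * norm (p + ?e)) + (norm p)\<^sup>2 - 2 * (\<mu> * norm ?e)"
    using 1 2 upd_inner_trunc[of x p] by simp
  also have "\<dots> = (norm p + \<mu>)\<^sup>2 - 2 * radial x p"
    by (simp add: radial_def power2_eq_square algebra_simps)
  finally show ?thesis .
qed

text \<open>
  In the truncation direction \<open>v\<close> the starting point has a component \<open>\<alpha> \<ge> \<mu> + E\<close>, and its other component
  stems from the dual step alone, hence is at most \<open>w = a \<parallel>d\<parallel>\<close>. Moving by \<open>E\<close> along \<open>-v\<close> thus shortens the
  vector by almost \<open>E\<close>, with a loss quadratic in \<open>w\<close>; without that loss the value would be \<open>2 \<mu> E\<close>.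
\<close>

lemma radial_lower:
  fixes x p
  defines "d \<equiv> proj (p + x) - p" and "E \<equiv> norm (trunc x p)" and "a \<equiv> 1 / (2 * N - 1)"
  assumes pos: "0 < d \<bullet> trunc x p"
  shows "\<mu> * E \<le> radial x p"
    and "E * (2 * \<mu> - (a * norm d)\<^sup>2 / (2 * \<mu>)) \<le> radial x p"
proof -
  let ?e = "trunc x p"
  define P where "P = norm p"
  define Q where "Q = norm (p + ?e)"
  define w where "w = a * norm d"
  have a: "0 < a" using N by (simp add: a_def)
  have E: "0 < E" using pos by (auto simp: E_def)
  have PQ0: "0 \<le> P" "0 \<le> Q" by (auto simp: P_def Q_def)
  define v where "v = (- 1 / E) *\<^sub>R ?e"
  have v: "norm v = 1" using E by (simp add: v_def E_def)
  have ev: "?e = - E *\<^sub>R v" using E by (simp add: v_def)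
  define \<alpha> where "\<alpha> = p \<bullet> v"
  have "\<alpha> = - (p \<bullet> ?e) / E" by (simp add: \<alpha>_def v_def)
  also have "\<dots> = \<mu> + E + a * (d \<bullet> ?e) / E"
    unfolding inner_start_trunc E_def[symmetric] a_def[symmetric] d_def[symmetric]
    using E by (simp add: field_simps power2_eq_square)
  finally have al: "\<alpha> = \<mu> + E + a * (d \<bullet> ?e) / E" .
  have al1: "\<mu> + E \<le> \<alpha>" unfolding al using a E pos by simp
  have "upd x p \<bullet> v = \<mu>"
    using upd_inner_trunc[of x p] E by (simp add: v_def E_def)
  then have "(norm (upd x p - \<mu> *\<^sub>R v))\<^sup>2 = (norm (upd x p))\<^sup>2 - \<mu>\<^sup>2"
    using v unfolding power2_norm_eq_inner norm_eq_1
    by (simp add: inner_simps inner_commute power2_eq_square[of \<mu>])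
  also have "\<dots> \<le> 0" using upd_ball[of x p] by (simp add: power_mono)
  finally have u: "upd x p = \<mu> *\<^sub>R v" by simp
  have pv: "p - (\<mu> + E) *\<^sub>R v = - a *\<^sub>R d"
  proof -
    have "p = upd x p - ?e - a *\<^sub>R d" by (simp add: trunc_def a_def d_def)
    then show ?thesis using u ev by (simp add: algebra_simps)
  qed
  \<comment> \<open>the distance from \<open>p\<close> to the line through \<open>v\<close> is at most its distance to this point of the line\<close>
  have "(norm (p - (\<mu> + E) *\<^sub>R v))\<^sup>2 = P\<^sup>2 - \<alpha>\<^sup>2 + (\<alpha> - (\<mu> + E))\<^sup>2"
  proof -
    have "v \<bullet> v = 1" using v by (simp add: norm_eq_1)
    then show ?thesis unfolding P_def \<alpha>_def power2_norm_eq_inner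
      by (simp add: inner_simps inner_commute power2_eq_square algebra_simps)
  qed
  then have P2: "P\<^sup>2 \<le> \<alpha>\<^sup>2 + w\<^sup>2"
    unfolding pv using zero_le_power2[of "\<alpha> - (\<mu> + E)"] by (simp add: w_def power_mult_distrib)
  have Q2: "Q\<^sup>2 = P\<^sup>2 - 2 * \<alpha> * E + E\<^sup>2"
  proof -
    have "v \<bullet> v = 1" using v by (simp add: norm_eq_1)
    then show ?thesis unfolding P_def Q_def \<alpha>_def ev power2_norm_eq_inner
      by (simp add: inner_simps inner_commute power2_eq_square algebra_simps)
  qed
  have root: "t \<le> s + w\<^sup>2 / (2 * \<mu>)" if "\<mu> \<le> s" "t\<^sup>2 \<le> s\<^sup>2 + w\<^sup>2" for s t :: real
  proof (rule power2_le_imp_le)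
    have "w\<^sup>2 * \<mu> \<le> w\<^sup>2 * s" using that(1) by (simp add: mult_left_mono)
    then have "w\<^sup>2 \<le> s * w\<^sup>2 / \<mu>" using mu_pos by (simp add: field_simps)
    moreover have "(s + w\<^sup>2 / (2 * \<mu>))\<^sup>2 = s\<^sup>2 + s * w\<^sup>2 / \<mu> + (w\<^sup>2 / (2 * \<mu>))\<^sup>2"
      using mu_pos by (simp add: power2_eq_square field_simps)
    ultimately show "t\<^sup>2 \<le> (s + w\<^sup>2 / (2 * \<mu>))\<^sup>2"
      using that(2) zero_le_power2[of "w\<^sup>2 / (2 * \<mu>)"] by linarith
    show "0 \<le> s + w\<^sup>2 / (2 * \<mu>)" using that(1) mu_pos by simp
  qed
  have "P \<le> \<alpha> + w\<^sup>2 / (2 * \<mu>)" by (rule root) (use al1 E P2 in auto)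
  moreover have "Q \<le> (\<alpha> - E) + w\<^sup>2 / (2 * \<mu>)"
    by (rule root) (use al1 P2 Q2 in \<open>auto simp: power2_eq_square algebra_simps\<close>)
  ultimately have PQ: "P + Q \<le> (2 * \<alpha> - E) + w\<^sup>2 / \<mu>" by (simp add: field_simps)
  define s where "s = 2 * \<alpha> - E"
  have s: "2 * \<mu> \<le> s" using al1 E by (simp add: s_def)
  have hs: "(P - Q) * (P + Q) = E * s"
    using Q2 by (simp add: s_def power2_eq_square algebra_simps)
  have h0: "0 \<le> P - Q"
  proof (rule ccontr)
    assume "\<not> 0 \<le> P - Q"
    then have "(P - Q) * (P + Q) \<le> 0" using PQ0 by (simp add: mult_le_0_iff)
    moreover have "0 < E * s" using E s mu_pos by simp
    ultimately show False using hs by simp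
  qed
  have rad: "radial x p = \<mu> * (E + (P - Q))" by (simp add: radial_def E_def P_def Q_def)
  show "\<mu> * E \<le> radial x p" unfolding rad using h0 mu_pos by simp
  define r where "r = w\<^sup>2 / (2 * \<mu>\<^sup>2)"
  have r: "0 \<le> r" "w\<^sup>2 / \<mu> = 2 * \<mu> * r" "w\<^sup>2 / (2 * \<mu>) = \<mu> * r"
    using mu_pos by (auto simp: r_def power2_eq_square field_simps)
  have "E * (1 - r) \<le> P - Q"
  proof (rule ccontr)
    assume n: "\<not> E * (1 - r) \<le> P - Q"
    then have "0 < E * (1 - r)" using h0 by linarith
    have sr: "0 < s + 2 * \<mu> * r" using s mu_pos r(1) by (smt (verit) mult_nonneg_nonneg)
    have "E * s \<le> (P - Q) * (s + 2 * \<mu> * r)"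
      unfolding hs[symmetric] by (rule mult_left_mono[OF _ h0]) (use PQ r(2) in \<open>simp add: s_def\<close>)
    also have "\<dots> < E * (1 - r) * (s + 2 * \<mu> * r)"
      using n sr by (simp add: mult_strict_right_mono)
    also have "\<dots> = E * (s - r * (s - 2 * \<mu>) - 2 * \<mu> * r\<^sup>2)"
      by (simp add: power2_eq_square algebra_simps)
    also have "\<dots> \<le> E * s"
    proof (rule mult_left_mono)
      have "0 \<le> r * (s - 2 * \<mu>)" "0 \<le> 2 * \<mu> * r\<^sup>2" using s r(1) mu_pos by auto
      then show "s - r * (s - 2 * \<mu>) - 2 * \<mu> * r\<^sup>2 \<le> s" by linarith
    qed (use E in simp)
    finally show False by simp
  qed
  then have "\<mu> * (E * (1 - r)) \<le> \<mu> * (P - Q)" using mu_pos by simp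
  then show "E * (2 * \<mu> - (a * norm d)\<^sup>2 / (2 * \<mu>)) \<le> radial x p"
    unfolding rad w_def[symmetric] r(3) by (simp add: algebra_simps)
qed

text \<open>
  The first step from an arbitrary point. The increase \<open>2\<delta>\<close> of the augmentation term by the truncation splits
  along \<open>p \<rightarrow> p\<^sup>* \<rightarrow> \<Pi>(p + x)\<close>: the first leg is cancelled by the truncation term in the dual inequality
  for \<open>p\<^sup>*\<close>, up to \<open>E\<^sup>2 + a \<delta>\<close>, which \<open>\<parallel>e\<parallel>\<^sup>2\<close> and \<open>sl\<close> absorb; the second is at most \<open>t E\<close>, which the radial excess
  covers by assumption.
\<close>

lemma first_step_moving_offset:
  fixes x p
  defines "d \<equiv> proj (p + x) - p"
  assumes sl: "(norm d)\<^sup>2 \<le> (N + 1) * sl" and f: "0 \<le> f + 2 * (ps \<bullet> x)"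
    and c: "d \<bullet> trunc x p \<le> 0 \<or> norm (ps - proj (p + x)) * norm (trunc x p) \<le> radial x p"
    and y: "y \<in> S" "norm y \<le> \<mu>"
  shows "f + 2 * (y \<bullet> x) + (2 * N - 1) * (norm (y - upd x p))\<^sup>2
      + (2 * N - 1) * (N - 1) / N * (f + aug_term x (upd x p) + (norm (ps - upd x p))\<^sup>2)
    \<le> (2 * N - 1) * (f + aug_term x p + sl) + (2 * N - 1) * (N - 1) / N * (norm (ps - p))\<^sup>2
      + 2 * N * (norm p + \<mu>)\<^sup>2"
proof -
  define m where "m = 2 * N - 1"
  define a where "a = 1 / m"
  define n where "n = (N - 1) / N"
  have m: "0 < m" and n: "0 \<le> n" "n \<le> 1" using N by (auto simp: m_def n_def)
  have a0: "0 < a" using m by (simp add: a_def)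
  define e where "e = trunc x p"
  define E where "E = norm e"
  define t where "t = norm (ps - proj (p + x))"
  define \<delta> where "\<delta> = d \<bullet> e"
  define g where "g = radial x p"
  have g0: "0 \<le> g" by (simp add: g_def radial_nonneg)
  have sl0: "0 \<le> sl"
  proof -
    have "0 \<le> (N + 1) * sl" using sl zero_le_power2[of "norm d"] by linarith
    then show ?thesis using N by (simp add: zero_le_mult_iff)
  qed
  have aug_le: "aug_term x (upd x p) \<le> aug_term x p + 2 * a * (norm d)\<^sup>2 + 2 * \<delta>"
    using aug_term_upd[of x p] by (simp add: m_def a_def d_def e_def \<delta>_def)
  have gy: "2 * (y \<bullet> x) + m * (norm (y - upd x p))\<^sup>2
    \<le> aug_term x p + m * ((norm p + \<mu>)\<^sup>2 - 2 * g) - (1 - a) * (norm d)\<^sup>2 - m * E\<^sup>2"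
  proof -
    have "m * ((norm (y - p))\<^sup>2 - 2 * ((y - upd x p) \<bullet> e)) \<le> m * ((norm p + \<mu>)\<^sup>2 - 2 * g)"
      using radial_gain[OF y(2), of p x] m by (simp add: e_def g_def)
    then show ?thesis
      using upd_gain[OF y(1), of x p] by (simp add: m_def a_def d_def e_def E_def algebra_simps)
  qed
  have pse: "0 \<le> ps \<bullet> e + \<mu> * E"
    using trunc_obtuse[OF ps(2), of x p] upd_inner_trunc[of x p] by (simp add: e_def E_def inner_diff_left)
  have gs: "2 * (ps \<bullet> x) + m * (norm (ps - upd x p))\<^sup>2
    \<le> aug_term x p + m * (norm (ps - p))\<^sup>2 - (1 - a) * (norm d)\<^sup>2 - 2 * m * (ps \<bullet> e + \<mu> * E) - m * E\<^sup>2"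
    using upd_gain[OF ps(1), of x p] upd_inner_trunc[of x p]
    by (simp add: m_def a_def d_def e_def E_def inner_diff_left)
  have gs': "n * (m * (norm (ps - upd x p))\<^sup>2) \<le> n * (f + aug_term x p + m * (norm (ps - p))\<^sup>2
       - (1 - a) * (norm d)\<^sup>2 - 2 * m * (ps \<bullet> e + \<mu> * E) - m * E\<^sup>2)"
    by (rule mult_left_mono) (use gs f n in auto)
  have scaled_aug_le: "m * n * aug_term x (upd x p) \<le> m * n * (aug_term x p + 2 * a * (norm d)\<^sup>2 + 2 * \<delta>)"
    by (rule mult_left_mono[OF aug_le]) (use m n in auto)
  have key: "2 * n * \<delta> - 2 * n * (ps \<bullet> e + \<mu> * E) \<le> 2 * g + (1 + n) * E\<^sup>2 + sl"
  proof (cases "\<delta> \<le> 0")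
    case True
    then have "n * \<delta> \<le> 0" "0 \<le> n * (ps \<bullet> e + \<mu> * E)" "0 \<le> (1 + n) * E\<^sup>2"
      using n pse by (auto simp: mult_nonneg_nonpos)
    then show ?thesis using g0 sl0 by linarith
  next
    case False
    then have tE: "t * E \<le> g" using c by (auto simp: \<delta>_def t_def E_def e_def g_def)
    have "(proj (p + x) - ps) \<bullet> e \<le> t * E"
      using norm_cauchy_schwarz[of "proj (p + x) - ps" e] by (simp add: t_def E_def norm_minus_commute)
    then have "\<delta> \<le> ps \<bullet> e - p \<bullet> e + t * E"
      by (simp add: \<delta>_def d_def inner_diff_left)
    also have "p \<bullet> e = - (\<mu> * E + E\<^sup>2 + a * \<delta>)"
      unfolding e_def E_def a_def m_def \<delta>_def d_def by (rule inner_start_trunc)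
    finally have "\<delta> \<le> (ps \<bullet> e + \<mu> * E) + E\<^sup>2 + a * \<delta> + t * E" by simp
    then have 1: "n * \<delta> \<le> n * ((ps \<bullet> e + \<mu> * E) + E\<^sup>2 + a * \<delta> + t * E)"
      by (rule mult_left_mono[OF _ n(1)])
    have "n * (t * E) \<le> 1 * (t * E)"
      by (rule mult_right_mono[OF n(2)]) (simp add: t_def E_def)
    then have 2: "n * (t * E) \<le> g" using tE by simp
    have dE: "\<delta> \<le> norm d * E"
      using norm_cauchy_schwarz[of d e] by (simp add: \<delta>_def E_def)
    have "n * a * \<delta> \<le> n * a * (norm d * E)"
      by (rule mult_left_mono[OF dE]) (use n a0 in simp)
    \<comment> \<open>Young's inequality, weighted so that \<open>E\<^sup>2 / N\<close> is exactly what \<open>E\<^sup>2 - n E\<^sup>2\<close> leaves\<close>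
    moreover have "0 \<le> (E - N * (n * a) * norm d)\<^sup>2 / N" using N by simp
    then have "2 * (n * a * (norm d * E)) \<le> E\<^sup>2 / N + N * (n * a)\<^sup>2 * (norm d)\<^sup>2"
      using N by (simp add: power2_eq_square field_simps)
    moreover have "N * (n * a)\<^sup>2 * (norm d)\<^sup>2 \<le> sl"
    proof -
      have "N * (n * a)\<^sup>2 * (norm d)\<^sup>2 \<le> N * (n * a)\<^sup>2 * ((N + 1) * sl)"
        by (rule mult_left_mono[OF sl]) (use N in simp)
      also have "\<dots> = (N * (n * a)\<^sup>2 * (N + 1)) * sl" by simp
      also have "\<dots> \<le> 1 * sl"
      proof (rule mult_right_mono[OF _ sl0])
        have "N * (n * a)\<^sup>2 * (N + 1) = (N - 1)\<^sup>2 * (N + 1) / (N * m\<^sup>2)"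
          using N m by (simp add: n_def a_def power2_eq_square field_simps)
        also have "\<dots> \<le> 1"
        proof -
          have "(N - 1)\<^sup>2 * (N + 1) = (N - 1) * (N\<^sup>2 - 1)" by (simp add: power2_eq_square algebra_simps)
          also have "\<dots> \<le> N * N\<^sup>2" using N by (intro mult_mono) auto
          also have "\<dots> \<le> N * m\<^sup>2"
            using N by (intro mult_left_mono power_mono) (auto simp: m_def)
          finally show ?thesis using N m by simp
        qed
        finally show "N * (n * a)\<^sup>2 * (N + 1) \<le> 1" .
      qed
      finally show ?thesis by simp
    qed
    ultimately have 3: "2 * (n * a * \<delta>) \<le> E\<^sup>2 / N + sl" by linarith
    have 4: "E\<^sup>2 / N + n * E\<^sup>2 = E\<^sup>2" using N by (simp add: n_def field_simps)
    show ?thesis using 1 2 3 4 by (simp add: algebra_simps)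
  qed
  have key': "m * (2 * n * \<delta> - 2 * n * (ps \<bullet> e + \<mu> * E)) \<le> m * (2 * g + (1 + n) * E\<^sup>2 + sl)"
    by (rule mult_left_mono[OF key]) (use m in simp)
  have c1: "m * n + n + 1 = m" and c2: "m * n * (2 * a) = (1 - a) * (1 + n)"
    using N by (auto simp: a_def m_def n_def field_simps)
  have q1: "m * n * (2 * a) * (norm d)\<^sup>2 = (1 - a) * (norm d)\<^sup>2 + n * ((1 - a) * (norm d)\<^sup>2)"
    unfolding c2 by (simp add: algebra_simps)
  have q2: "m * (f + aug_term x p) = m * n * (f + aug_term x p) + n * (f + aug_term x p) + (f + aug_term x p)"
    by (metis c1 distrib_right mult_1)
  have "m * (norm p + \<mu>)\<^sup>2 \<le> 2 * N * (norm p + \<mu>)\<^sup>2"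
    by (rule mult_right_mono) (auto simp: m_def)
  then have "f + 2 * (y \<bullet> x) + m * (norm (y - upd x p))\<^sup>2
      + m * n * (f + aug_term x (upd x p) + (norm (ps - upd x p))\<^sup>2)
    \<le> m * (f + aug_term x p + sl) + m * n * (norm (ps - p))\<^sup>2 + 2 * N * (norm p + \<mu>)\<^sup>2"
    using gy gs' scaled_aug_le key' q1 q2 by (simp add: algebra_simps)
  then show ?thesis by (simp add: m_def n_def)
qed

text \<open>
  The complementary case. Here \<open>t = \<parallel>p\<^sup>* - \<Pi>(p + x)\<parallel>\<close> exceeds the radial excess per unit of truncation, and the
  augmented Lagrangian after the primal step is at least of order \<open>t\<^sup>2 - \<parallel>p\<^sup>* - p\<parallel>\<^sup>2\<close>. The fixed offset carries the
  weight \<open>N\<close> instead of \<open>2N - 1\<close>, so \<open>N - 1\<close> copies of this are available to pay for \<open>4\<mu>\<^sup>2\<close>.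
\<close>

lemma first_step_fixed_offset:
  fixes x p
  defines "d \<equiv> proj (p + x) - p"
  assumes sl: "(norm d)\<^sup>2 \<le> (N + 1) * sl" and f: "0 \<le> f + 2 * (ps \<bullet> x)"
    and c: "0 < d \<bullet> trunc x p" "radial x p < norm (ps - proj (p + x)) * norm (trunc x p)"
    and y: "y \<in> S" "norm y \<le> \<mu>"
  shows "f + 2 * (y \<bullet> x) + (2 * N - 1) * (norm (y - upd x p))\<^sup>2
      + (N - 1) * (f + aug_term x (upd x p) + 4 * \<mu>\<^sup>2)
    \<le> (2 * N - 1) * (f + aug_term x p + sl) + (2 * N - 1) * (N - 1) / N * (norm (ps - p))\<^sup>2
      + 2 * N * (norm p + \<mu>)\<^sup>2"
proof -
  define m where "m = 2 * N - 1"
  define a where "a = 1 / m"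
  define n where "n = (N - 1) / N"
  have m: "0 < m" using N by (simp add: m_def)
  define e where "e = trunc x p"
  define E where "E = norm e"
  define t where "t = norm (ps - proj (p + x))"
  define r where "r = norm (ps - p)"
  define \<delta> where "\<delta> = d \<bullet> e"
  define g where "g = radial x p"
  define w where "w = a * norm d"
  have E: "0 < E" using c(1) by (auto simp: E_def e_def)
  have aug_le: "aug_term x (upd x p) \<le> aug_term x p + 2 * a * (norm d)\<^sup>2 + 2 * \<delta>"
    using aug_term_upd[of x p] by (simp add: m_def a_def d_def e_def \<delta>_def)
  have gy: "2 * (y \<bullet> x) + m * (norm (y - upd x p))\<^sup>2
    \<le> aug_term x p + m * ((norm p + \<mu>)\<^sup>2 - 2 * g) - (1 - a) * (norm d)\<^sup>2 - m * E\<^sup>2"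
  proof -
    have "m * ((norm (y - p))\<^sup>2 - 2 * ((y - upd x p) \<bullet> e)) \<le> m * ((norm p + \<mu>)\<^sup>2 - 2 * g)"
      using radial_gain[OF y(2), of p x] m by (simp add: e_def g_def)
    then show ?thesis
      using upd_gain[OF y(1), of x p] by (simp add: m_def a_def d_def e_def E_def algebra_simps)
  qed
  have scaled_aug_le: "(N - 1) * aug_term x (upd x p) \<le> (N - 1) * (aug_term x p + 2 * a * (norm d)\<^sup>2 + 2 * \<delta>)"
    by (rule mult_left_mono[OF aug_le]) (use N in auto)
  have B: "t\<^sup>2 - r\<^sup>2 \<le> f + aug_term x p"
    using aug_term_dual[OF ps(1), of x p] f by (simp add: t_def r_def)
  have dE: "\<delta> \<le> E * (r + t)"
  proof -
    have "norm d \<le> r + t"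
      using norm_triangle_ineq4[of "ps - p" "ps - proj (p + x)"] by (simp add: d_def r_def t_def)
    then have "norm d * E \<le> (r + t) * E" using E by (intro mult_right_mono) auto
    then show ?thesis
      using norm_cauchy_schwarz[of d e] by (simp add: \<delta>_def E_def mult.commute)
  qed
  have rH: "r \<le> norm p + \<mu>"
    using norm_triangle_ineq4[of ps p] ps(2) by (simp add: r_def)
  \<comment> \<open>\<open>b\<close> is the radial excess per unit of truncation: \<open>b < t\<close> and, up to an error in \<open>w\<close>, \<open>2\<mu> \<le> b\<close>\<close>
  have offset: "4 * \<mu>\<^sup>2 \<le> (E - r)\<^sup>2 + (E - t)\<^sup>2 + 4 * g + 2 * w\<^sup>2"
  proof -
    define b where "b = g / E"
    have g: "g = E * b" using E by (simp add: b_def)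
    have "\<mu> * E \<le> g" "E * (2 * \<mu> - w\<^sup>2 / (2 * \<mu>)) \<le> g"
      using radial_lower[of p x] c(1)
      by (auto simp: d_def g_def E_def e_def w_def a_def m_def)
    then have b: "\<mu> \<le> b" "2 * \<mu> - w\<^sup>2 / (2 * \<mu>) \<le> b"
      unfolding g using E by (auto simp: mult.commute)
    have bt: "b < t" using c(2) E by (simp add: b_def t_def g_def E_def e_def field_simps)
    have b2: "b\<^sup>2 \<le> (E - t)\<^sup>2 + 4 * g"
    proof (cases "E \<le> b")
      case True
      then have "(b - E)\<^sup>2 \<le> (t - E)\<^sup>2" using bt by (intro power_mono) auto
      moreover have "b\<^sup>2 \<le> (b + E)\<^sup>2" using b(1) mu_pos E by (intro power_mono) auto
      ultimately show ?thesis unfolding g by (simp add: power2_eq_square algebra_simps)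
    next
      case False
      then have "b * b \<le> E * b" using b(1) mu_pos by (intro mult_right_mono) auto
      moreover have "0 \<le> E * b" using b(1) mu_pos E by simp
      ultimately show ?thesis unfolding g power2_eq_square[of b]
        using zero_le_power2[of "E - t"] by linarith
    qed
    have "4 * \<mu>\<^sup>2 \<le> b\<^sup>2 + 2 * w\<^sup>2"
    proof (cases "0 \<le> 2 * \<mu> - w\<^sup>2 / (2 * \<mu>)")
      case True
      then have "(2 * \<mu> - w\<^sup>2 / (2 * \<mu>))\<^sup>2 \<le> b\<^sup>2" using b(2) by (intro power_mono) auto
      moreover have "(2 * \<mu> - w\<^sup>2 / (2 * \<mu>))\<^sup>2 = 4 * \<mu>\<^sup>2 - 2 * w\<^sup>2 + (w\<^sup>2 / (2 * \<mu>))\<^sup>2"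
        using mu_pos by (simp add: power2_eq_square field_simps)
      ultimately show ?thesis using zero_le_power2[of "w\<^sup>2 / (2 * \<mu>)"] by linarith
    next
      case False
      then have "4 * \<mu>\<^sup>2 < w\<^sup>2" using mu_pos by (simp add: power2_eq_square field_simps)
      then show ?thesis using zero_le_power2[of b] zero_le_power2[of w] by linarith
    qed
    then show ?thesis using b2 zero_le_power2[of "E - r"] by linarith
  qed
  have slw: "(N - 1) * (2 * w\<^sup>2) \<le> m * sl"
  proof -
    have "w\<^sup>2 * m\<^sup>2 = (norm d)\<^sup>2" using m by (simp add: w_def a_def power2_eq_square)
    then have "w\<^sup>2 * m\<^sup>2 \<le> (N + 1) * sl" using sl by simp
    then have "m * (w\<^sup>2 * m\<^sup>2) \<le> m * ((N + 1) * sl)" using m by (intro mult_left_mono) auto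
    moreover have "((N - 1) * 2 * (N + 1)) * w\<^sup>2 \<le> (m * m\<^sup>2) * w\<^sup>2"
    proof (rule mult_right_mono)
      have "(N - 1) * 2 * (N + 1) \<le> 2 * N\<^sup>2 - 1" by (simp add: power2_eq_square algebra_simps)
      also have "\<dots> \<le> m\<^sup>2"
      proof -
        have "m\<^sup>2 - (2 * N\<^sup>2 - 1) = 2 * (N - 1)\<^sup>2" by (simp add: m_def power2_eq_square algebra_simps)
        then show ?thesis using zero_le_power2[of "N - 1"] by linarith
      qed
      also have "\<dots> = 1 * m\<^sup>2" by simp
      also have "\<dots> \<le> m * m\<^sup>2" using N by (intro mult_right_mono) (auto simp: m_def)
      finally show "(N - 1) * 2 * (N + 1) \<le> m * m\<^sup>2" .
    qed simp
    ultimately have "(N + 1) * ((N - 1) * (2 * w\<^sup>2)) \<le> (N + 1) * (m * sl)"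
      by (simp add: algebra_simps)
    then show ?thesis using N by simp
  qed
  have offset': "(N - 1) * (4 * \<mu>\<^sup>2) \<le> (N - 1) * ((E - r)\<^sup>2 + (E - t)\<^sup>2 + 4 * g + 2 * w\<^sup>2)"
    by (rule mult_left_mono[OF offset]) (use N in simp)
  have dE': "(N - 1) * (2 * \<delta>) \<le> (N - 1) * (2 * (E * (r + t)))"
    using dE N by (intro mult_left_mono) auto
  have B': "(N - 1) * (t\<^sup>2 - r\<^sup>2) \<le> (N - 1) * (f + aug_term x p)"
    by (rule mult_left_mono[OF B]) (use N in simp)
  have half: "(N - 1) * (2 * z) \<le> m * z" if "0 \<le> z" for z
    using mult_right_mono[of "(N - 1) * 2" m z] that unfolding mult.assoc by (simp add: m_def)
  have mE: "(N - 1) * (2 * E\<^sup>2) \<le> m * E\<^sup>2" by (rule half) simp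
  have mg: "(N - 1) * (4 * g) \<le> m * (2 * g)"
    using half[of "2 * g"] radial_nonneg[of x p] by (simp add: g_def)
  have rr: "(N - 1) * (2 * r\<^sup>2) \<le> m * n * r\<^sup>2 + (norm p + \<mu>)\<^sup>2"
  proof -
    have "r\<^sup>2 \<le> (norm p + \<mu>)\<^sup>2" using rH by (intro power_mono) (auto simp: r_def)
    moreover have "(2 * (N - 1)) * r\<^sup>2 \<le> (m * n + 1) * r\<^sup>2"
    proof (rule mult_right_mono)
      have "m * n + 1 - 2 * (N - 1) = 1 / N" using N by (simp add: m_def n_def field_simps)
      moreover have "0 \<le> 1 / N" using N by simp
      ultimately show "2 * (N - 1) \<le> m * n + 1" by linarith
    qed simp
    ultimately show ?thesis by (simp add: algebra_simps)
  qed
  have c2: "(N - 1) * (2 * a) = 1 - a"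
    using N by (auto simp: a_def m_def field_simps)
  have q1: "(N - 1) * (2 * a) * (norm d)\<^sup>2 = (1 - a) * (norm d)\<^sup>2"
    unfolding c2 ..
  have q2: "m * (f + aug_term x p) = N * (f + aug_term x p) + (N - 1) * (f + aug_term x p)"
    by (simp add: m_def algebra_simps)
  have q3: "m * (norm p + \<mu>)\<^sup>2 + (norm p + \<mu>)\<^sup>2 = 2 * N * (norm p + \<mu>)\<^sup>2"
    by (simp add: m_def algebra_simps)
  have q4: "(E - r)\<^sup>2 + (E - t)\<^sup>2 = 2 * E\<^sup>2 - 2 * (E * (r + t)) + r\<^sup>2 + t\<^sup>2"
    by (simp add: power2_eq_square algebra_simps)
  have "(N - 1) * (2 * \<delta> + 4 * \<mu>\<^sup>2)
     \<le> m * (2 * g) + m * E\<^sup>2 + m * sl + (N - 1) * (t\<^sup>2 - r\<^sup>2) + m * n * r\<^sup>2 + (norm p + \<mu>)\<^sup>2"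
    using offset' dE' mE mg rr slw unfolding q4 by (simp add: algebra_simps)
  then have "f + 2 * (y \<bullet> x) + m * (norm (y - upd x p))\<^sup>2 + (N - 1) * (f + aug_term x (upd x p) + 4 * \<mu>\<^sup>2)
    \<le> m * (f + aug_term x p + sl) + m * n * r\<^sup>2 + 2 * N * (norm p + \<mu>)\<^sup>2"
    using gy scaled_aug_le B' q1 q2 q3 by (simp add: algebra_simps)
  then show ?thesis by (simp add: m_def n_def r_def)
qed

end

section \<open>First-order inequalities\<close>

lemma right_min_deriv:
  fixes \<psi> :: "real \<Rightarrow> real"
  assumes "(\<psi> has_real_derivative d) (at 0)" "\<And>s. 0 < s \<Longrightarrow> s \<le> 1 \<Longrightarrow> \<psi> 0 \<le> \<psi> s"
  shows "0 \<le> d"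
proof (rule ccontr)
  assume "\<not> 0 \<le> d"
  then obtain \<delta> where \<delta>: "0 < \<delta>" "\<And>h. 0 < h \<Longrightarrow> h < \<delta> \<Longrightarrow> \<psi> (0 + h) < \<psi> 0"
    using DERIV_neg_dec_right[OF assms(1)] by auto
  have "\<psi> (min (\<delta> / 2) 1) < \<psi> 0"
    using \<delta>(2)[of "min (\<delta> / 2) 1"] \<delta>(1) by auto
  moreover have "\<psi> 0 \<le> \<psi> (min (\<delta> / 2) 1)"
    by (rule assms(2)) (use \<delta>(1) in auto)
  ultimately show False by simp
qed

lemma deriv_along_line:
  fixes g :: "'a::real_normed_vector \<Rightarrow> real"
  assumes "(g has_derivative g') (at (v + s *\<^sub>R w))"
  shows "((\<lambda>s. g (v + s *\<^sub>R w)) has_real_derivative g' w) (at s)"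
proof -
  have "((\<lambda>s. v + s *\<^sub>R w) has_derivative (\<lambda>h. h *\<^sub>R w)) (at s)"
    by (auto intro!: derivative_eq_intros)
  then have "((\<lambda>s. g (v + s *\<^sub>R w)) has_derivative (\<lambda>h. g' (h *\<^sub>R w))) (at s)"
    by (rule has_derivative_compose) (rule assms)
  moreover have "(\<lambda>h. g' (h *\<^sub>R w)) = (*) (g' w)"
    using has_derivative_linear[OF assms] by (auto simp: linear_cmul mult.commute)
  ultimately show ?thesis by (simp add: has_field_derivative_def)
qed

lemma strong_gradient_ineq:
  fixes g :: "'a::real_normed_vector \<Rightarrow> real"
  assumes g: "strongly_convex_on \<beta> U g" and d: "(g has_derivative g') (at v)" and uv: "u \<in> U" "v \<in> U"
  shows "g v + g' (u - v) + \<beta> / 2 * (norm (u - v))\<^sup>2 \<le> g u"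
proof -
  define c where "c = \<beta> / 2 * (norm (u - v))\<^sup>2"
  define \<psi> where "\<psi> s = s * (g u - g v) - c * (s * (1 - s)) - g (v + s *\<^sub>R (u - v))" for s
  have "((\<lambda>s. g (v + s *\<^sub>R (u - v))) has_real_derivative g' (u - v)) (at 0)"
    by (rule deriv_along_line) (use d in simp)
  then have "(\<psi> has_real_derivative (g u - g v - c - g' (u - v))) (at 0)"
    unfolding \<psi>_def by (auto intro!: derivative_eq_intros)
  then have "0 \<le> g u - g v - c - g' (u - v)"
  proof (rule right_min_deriv)
    fix s :: real assume s: "0 < s" "s \<le> 1"
    have "g (s *\<^sub>R u + (1 - s) *\<^sub>R v) \<le> s * g u + (1 - s) * g v - \<beta> / 2 * s * (1 - s) * (norm (u - v))\<^sup>2"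
      using g uv s unfolding strongly_convex_on_def by auto
    moreover have "s *\<^sub>R u + (1 - s) *\<^sub>R v = v + s *\<^sub>R (u - v)" by (simp add: algebra_simps)
    ultimately show "\<psi> 0 \<le> \<psi> s" by (simp add: \<psi>_def c_def algebra_simps)
  qed
  then show ?thesis by (simp add: c_def)
qed

lemma convex_gradient_ineq:
  fixes g :: "'a::real_normed_vector \<Rightarrow> real"
  assumes g: "convex_on U g" and d: "(g has_derivative g') (at v)" and uv: "u \<in> U" "v \<in> U"
  shows "g v + g' (u - v) \<le> g u"
proof -
  have "strongly_convex_on 0 U g"
    using g by (auto simp: strongly_convex_on_def convex_on_def)
  from strong_gradient_ineq[OF this d uv] show ?thesis by simp
qed

lemma gradient_descent_ineq:
  fixes g :: "'a::real_normed_vector \<Rightarrow> real"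
  assumes U: "convex U" and d: "\<And>x. x \<in> U \<Longrightarrow> (g has_derivative g' x) (at x)"
    and l: "\<And>x y. x \<in> U \<Longrightarrow> y \<in> U \<Longrightarrow> g' x (x - y) - g' y (x - y) \<le> c * (norm (x - y))\<^sup>2"
    and vw: "v \<in> U" "w \<in> U"
  shows "g w \<le> g v + g' v (w - v) + c / 2 * (norm (w - v))\<^sup>2"
proof -
  define h where "h = w - v"
  define n where "n = (norm h)\<^sup>2"
  \<comment> \<open>the bound on the derivative makes this nonincreasing on the unit interval\<close>
  define \<psi> where "\<psi> s = g (v + s *\<^sub>R h) - s * g' v h - c / 2 * s\<^sup>2 * n" for s
  have inU: "v + s *\<^sub>R h \<in> U" if "0 \<le> s" "s \<le> 1" for s
  proof -
    have "(1 - s) *\<^sub>R v + s *\<^sub>R w \<in> U"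
      using convexD[OF U vw, of "1 - s" s] that by simp
    then show ?thesis by (simp add: h_def algebra_simps)
  qed
  have "\<psi> 1 \<le> \<psi> 0"
  proof (rule DERIV_nonpos_imp_nonincreasing[where f = \<psi>])
    fix s :: real assume s: "0 \<le> s" "s \<le> 1"
    let ?x = "v + s *\<^sub>R h"
    have D: "((\<lambda>s. g (v + s *\<^sub>R h)) has_real_derivative g' ?x h) (at s)"
      by (rule deriv_along_line) (rule d[OF inU[OF s]])
    have "(\<psi> has_real_derivative (g' ?x h - g' v h - c * s * n)) (at s)"
      unfolding \<psi>_def using D by (auto intro!: derivative_eq_intros)
    moreover have "g' ?x h - g' v h - c * s * n \<le> 0"
    proof (cases "s = 0")
      case False
      then have s0: "0 < s" using s by simp
      have lin: "linear (g' ?x)" "linear (g' v)"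
        using d[OF inU[OF s]] d[OF vw(1)] has_derivative_linear by auto
      have "s * (g' ?x h - g' v h) \<le> s * (c * s * n)"
        using l[OF inU[OF s] vw(1)] lin
        by (simp add: linear_cmul n_def power_mult_distrib right_diff_distrib power2_eq_square mult_ac)
      then show ?thesis using s0 by simp
    qed simp
    ultimately show "\<exists>y. (\<psi> has_real_derivative y) (at s) \<and> y \<le> 0" by blast
  qed simp
  then show ?thesis by (simp add: \<psi>_def h_def n_def)
qed

text \<open>
  Optimality of \<open>w\<close> is only used along the segment to \<open>u\<close>; the convex part needs no derivative there.
\<close>

lemma bregman_three_point:
  assumes f: "convex_on U f" and K: "GDERIV K w :> gradK w" and e: "0 < e"
    and m: "\<And>x. x \<in> U \<Longrightarrow> f w + 1 / e * bregman K gradK w v \<le> f x + 1 / e * bregman K gradK x v"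
    and uw: "u \<in> U" "w \<in> U"
  shows "e * (f w - f u) + bregman K gradK w v + bregman K gradK u w \<le> bregman K gradK u v"
proof -
  define h where "h = u - w"
  define \<psi> where "\<psi> s = s * (e * (f u - f w) - gradK v \<bullet> h) + K (w + s *\<^sub>R h)" for s
  have "((\<lambda>s. K (w + s *\<^sub>R h)) has_real_derivative h \<bullet> gradK w) (at 0)"
    by (rule deriv_along_line[where g' = "\<lambda>h. h \<bullet> gradK w"]) (use K in \<open>simp add: gderiv_def\<close>)
  then have "(\<psi> has_real_derivative (e * (f u - f w) - gradK v \<bullet> h + h \<bullet> gradK w)) (at 0)"
    unfolding \<psi>_def by (auto intro!: derivative_eq_intros)
  then have "0 \<le> e * (f u - f w) - gradK v \<bullet> h + h \<bullet> gradK w"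
  proof (rule right_min_deriv)
    fix s :: real assume s: "0 < s" "s \<le> 1"
    let ?x = "w + s *\<^sub>R h"
    have x: "?x = (1 - s) *\<^sub>R w + s *\<^sub>R u" by (simp add: h_def algebra_simps)
    have xU: "?x \<in> U" unfolding x
      using f uw s by (intro convexD) (auto simp: convex_on_def)
    have fx: "f ?x \<le> (1 - s) * f w + s * f u" unfolding x
      using f uw s unfolding convex_on_def by auto
    have "f w + 1 / e * bregman K gradK w v \<le> f ?x + 1 / e * bregman K gradK ?x v" by (rule m[OF xU])
    then have "e * (f w + 1 / e * bregman K gradK w v) \<le> e * (f ?x + 1 / e * bregman K gradK ?x v)"
      using e by simp
    then have "e * f w + bregman K gradK w v \<le> e * f ?x + bregman K gradK ?x v"
      using e by (simp add: distrib_left)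
    moreover have "e * f ?x \<le> e * ((1 - s) * f w + s * f u)" using fx e by simp
    ultimately have "e * f w + bregman K gradK w v \<le> e * ((1 - s) * f w + s * f u) + bregman K gradK ?x v"
      by linarith
    then show "\<psi> 0 \<le> \<psi> s"
      unfolding \<psi>_def bregman_def by (simp add: inner_simps algebra_simps)
  qed
  then show ?thesis
    by (simp add: bregman_def h_def inner_simps inner_commute algebra_simps)
qed

lemma block_linear [simp]:
  "block b j (x - y) = block b j x - block b j y"
  "block b j (x + y) = block b j x + block b j y"
  "block b j (a *\<^sub>R x) = a *\<^sub>R block b j x"
  by (auto simp: block_def vec_eq_iff)

lemma block_block: "block b l (block b j x) = (if l = j then block b j x else 0)"
  by (auto simp: block_def vec_eq_iff)

lemma sum_block: "(\<Sum>j\<in>UNIV. block b j x) = x" for b :: "'n::finite \<Rightarrow> 'b::finite"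
  by (simp add: block_def vec_eq_iff sum.delta)

lemma block_inner: "block b j x \<bullet> block b j y = x \<bullet> block b j y"
  by (auto simp: block_def inner_vec_def intro!: sum.cong)

lemma block_exchange:
  fixes x y :: "real^'n::finite" and b :: "'n \<Rightarrow> 'b" and j :: 'b
  assumes "x \<in> block_product b Us" "y \<in> block_product b Us"
  defines "z \<equiv> x - block b j x + block b j y"
  shows "z \<in> block_product b Us" and "block b l z = (if l = j then block b j y else block b l x)"
proof -
  show *: "block b l z = (if l = j then block b j y else block b l x)" for l
    by (simp add: z_def block_block)
  show "z \<in> block_product b Us"
    unfolding block_product_def using assms(1,2) by (auto simp: * block_product_def)
qed

text \<open>
  Varying one block at a time inside a product set isolates the corresponding summand.
\<close>

lemma convex_on_block:
  fixes b :: "'n::finite \<Rightarrow> 'b::finite" and h :: "'b \<Rightarrow> real^'n \<Rightarrow> real"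
  assumes U: "U = block_product b Us"
    and c: "convex_on U (\<lambda>x. \<Sum>l\<in>UNIV. h l (block b l x))"
  shows "convex_on U (\<lambda>x. h j (block b j x))"
  unfolding convex_on_def
proof (intro conjI ballI allI impI)
  show "convex U" using c by (simp add: convex_on_def)
  fix x y and s t :: real assume xy: "x \<in> U" "y \<in> U" and st: "0 \<le> s" "0 \<le> t" "s + t = 1"
  define z where "z = x - block b j x + block b j y"
  have zU: "z \<in> U" unfolding z_def U by (rule block_exchange(1)) (use xy U in auto)
  have zb: "block b l z = (if l = j then block b j y else block b l x)" for l
    unfolding z_def by (rule block_exchange(2)) (use xy U in auto)
  have "(\<Sum>l\<in>UNIV. h l (block b l (s *\<^sub>R x + t *\<^sub>R z)))
      \<le> s * (\<Sum>l\<in>UNIV. h l (block b l x)) + t * (\<Sum>l\<in>UNIV. h l (block b l z))"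
    using c xy(1) zU st unfolding convex_on_def by blast
  moreover have split: "sum f UNIV = f j + sum f (UNIV - {j})" for f :: "'b \<Rightarrow> real"
    by (rule sum.remove) auto
  moreover have "s *\<^sub>R v + t *\<^sub>R v = v" for v :: "real^'n"
    using st by (simp flip: scaleR_add_left)
  moreover have "s * r + t * r = r" for r :: real using st by (simp flip: distrib_right)
  ultimately show "h j (block b j (s *\<^sub>R x + t *\<^sub>R y)) \<le> s * h j (block b j x) + t * h j (block b j y)"
    unfolding split by (simp add: zb algebra_simps)
qed

lemma dual_cone_closed_cone:
  fixes C :: "'a::euclidean_space set"
  shows "closed_cone (dual_cone C)"
proof
  have "dual_cone C = (\<Inter>x\<in>C. {y. 0 \<le> x \<bullet> y})"
    by (auto simp: dual_cone_def inner_commute)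
  then show "closed (dual_cone C)"
    by (auto intro!: closed_INT closed_Collect_le continuous_intros)
  show "convex_cone (dual_cone C)"
    by (auto simp: convex_cone_def convex_def conic_def dual_cone_def inner_add_left intro!: exI[of _ 0])
qed

lemma cone_convex_on_inner:
  assumes "cone_convex_on U C f" "convex U" "q \<in> dual_cone C"
  shows "convex_on U (\<lambda>x. q \<bullet> f x)"
  unfolding convex_on_def
proof (intro conjI ballI allI impI)
  fix x y and s t :: real assume xy: "x \<in> U" "y \<in> U" and st: "0 \<le> s" "0 \<le> t" "s + t = 1"
  have t: "t = 1 - s" using st by simp
  have "s \<in> {0..1}" using st by auto
  then have "f (s *\<^sub>R x + t *\<^sub>R y) - s *\<^sub>R f x - t *\<^sub>R f y \<in> uminus ` C"
    using assms(1) xy unfolding cone_convex_on_def t by blast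
  then obtain c where "c \<in> C" "f (s *\<^sub>R x + t *\<^sub>R y) - s *\<^sub>R f x - t *\<^sub>R f y = - c" by auto
  moreover from this have "0 \<le> q \<bullet> c" using assms(3) by (auto simp: dual_cone_def)
  ultimately have "q \<bullet> (f (s *\<^sub>R x + t *\<^sub>R y) - s *\<^sub>R f x - t *\<^sub>R f y) \<le> 0" by simp
  then show "q \<bullet> f (s *\<^sub>R x + t *\<^sub>R y) \<le> s * (q \<bullet> f x) + t * (q \<bullet> f y)"
    by (simp add: inner_simps)
qed (use assms in simp)

section \<open>One primal block step\<close>

locale block_problem =
  fixes b :: "'n::finite \<Rightarrow> 'b::finite" and Us :: "'b \<Rightarrow> (real^'n) set" and U :: "(real^'n) set"
    and C :: "(real^'m::finite) set"
    and G K :: "real^'n \<Rightarrow> real" and gradG gradK :: "real^'n \<Rightarrow> real^'n"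
    and Jb :: "'b \<Rightarrow> real^'n \<Rightarrow> real"
    and \<Omega> :: "real^'n \<Rightarrow> real^'m" and dOm :: "real^'n \<Rightarrow> real^'n \<Rightarrow> real^'m"
    and Phs :: "'b \<Rightarrow> real^'n \<Rightarrow> real^'m" and T :: "real^'m"
    and B\<^sub>G \<tau> \<beta> \<gamma> N :: real
    and F :: "real^'n \<Rightarrow> real" and \<Theta> :: "real^'n \<Rightarrow> real^'m"
  assumes U: "U = block_product b Us" "convex U"
    and F_def: "\<And>x. F x = G x + (\<Sum>j\<in>UNIV. Jb j (block b j x))"
    and \<Theta>_def: "\<And>x. \<Theta> x = \<Omega> x + (\<Sum>j\<in>UNIV. Phs j (block b j x))"
    and J: "convex_on U (\<lambda>x. \<Sum>j\<in>UNIV. Jb j (block b j x))"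
    and G: "convex_on UNIV G" "\<And>x. GDERIV G x :> gradG x" "B\<^sub>G-lipschitz_on UNIV gradG"
    and \<Omega>: "cone_convex_on U C \<Omega>" "\<And>x. (\<Omega> has_derivative dOm x) (at x)"
      "\<And>x y. x \<in> U \<Longrightarrow> y \<in> U \<Longrightarrow>
         dOm x (x - y) - dOm y (x - y) - (norm (x - y))\<^sup>2 *\<^sub>R T \<in> uminus ` C"
    and \<Phi>: "cone_convex_on U C (\<lambda>x. \<Sum>j\<in>UNIV. Phs j (block b j x))"
    and \<Theta>: "\<tau>-lipschitz_on U \<Theta>"
    and K: "0 < \<beta>" "strongly_convex_on \<beta> U K" "\<And>x. x \<in> U \<Longrightarrow> GDERIV K x :> gradK x"
    and \<gamma>: "0 < \<gamma>"
    and N_card: "N = real CARD('b)"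
begin

sublocale closed_cone "dual_cone C"
  by (rule dual_cone_closed_cone)

abbreviation D :: "real^'n \<Rightarrow> real^'n \<Rightarrow> real" where
  "D \<equiv> bregman K gradK"

definition aug :: "real^'n \<Rightarrow> real^'m \<Rightarrow> real" where
  "aug x p = F x + aug_term (\<gamma> *\<^sub>R \<Theta> x) p / (2 * \<gamma>)"

text \<open>
  The part of the primal subproblem besides the Bregman term.
\<close>

definition block_cost :: "'b \<Rightarrow> real^'n \<Rightarrow> real^'m \<Rightarrow> real^'n \<Rightarrow> real" where
  "block_cost j v q x = gradG v \<bullet> block b j x + Jb j (block b j x)
     + q \<bullet> (dOm v (block b j x) + Phs j (block b j x))"

definition primal_step :: "'b \<Rightarrow> real^'n \<Rightarrow> real^'m \<Rightarrow> real \<Rightarrow> real^'n \<Rightarrow> bool" where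
  "primal_step j v q e w \<longleftrightarrow> w \<in> U \<and> (\<forall>l. l \<noteq> j \<longrightarrow> block b l w = block b l v) \<and>
     (\<forall>x\<in>U. block_cost j v q w + 1 / e * D w v \<le> block_cost j v q x + 1 / e * D x v)"

lemma dOm_linear: "linear (dOm v)"
  using \<Omega>(2) has_derivative_linear by blast

lemma block_cost_convex:
  assumes q: "q \<in> dual_cone C"
  shows "convex_on U (block_cost j v q)"
proof -
  have 1: "convex_on U (\<lambda>x. Jb j (block b j x))"
    by (rule convex_on_block[OF U(1) J])
  have "convex_on U (\<lambda>x. q \<bullet> (\<Sum>j\<in>UNIV. Phs j (block b j x)))"
    by (rule cone_convex_on_inner[OF \<Phi> U(2) q])
  then have 2: "convex_on U (\<lambda>x. q \<bullet> Phs j (block b j x))"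
    using convex_on_block[OF U(1), of "\<lambda>j x. q \<bullet> Phs j x" j] by (simp add: inner_sum_right)
  have "convex_on U (\<lambda>x. gradG v \<bullet> block b j x + q \<bullet> dOm v (block b j x))"
    using U(2) unfolding convex_on_def
    by (simp add: inner_simps linear_add[OF dOm_linear] linear_cmul[OF dOm_linear] algebra_simps)
  from convex_on_add[OF this convex_on_add[OF 1 2]] show ?thesis
    by (simp add: block_cost_def[abs_def] inner_add_right algebra_simps)
qed

lemma bregman_lower:
  assumes "x \<in> U" "y \<in> U"
  shows "\<beta> / 2 * (norm (x - y))\<^sup>2 \<le> D x y"
  using strong_gradient_ineq[OF K(2), of "\<lambda>h. h \<bullet> gradK y" y x] K(3)[OF assms(2)] assms
  by (simp add: gderiv_def bregman_def inner_commute)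

lemma bregman_nonneg:
  assumes "x \<in> U" "y \<in> U"
  shows "0 \<le> D x y"
  using bregman_lower[OF assms] K(1) by (smt (verit) mult_nonneg_nonneg zero_le_power2 half_gt_zero)

lemma primal_step_three_point:
  assumes "primal_step j v q e w" "0 < e" "q \<in> dual_cone C" "x \<in> U"
  shows "e * (block_cost j v q w - block_cost j v q x) + D w v + D x w \<le> D x v"
proof (rule bregman_three_point[OF block_cost_convex[OF assms(3)]])
  show "GDERIV K w :> gradK w" using K(3) assms(1) by (auto simp: primal_step_def)
qed (use assms in \<open>auto simp: primal_step_def\<close>)

lemma primal_step_unique:
  assumes "primal_step j v q e w" "primal_step j v q e w'" "0 < e" "q \<in> dual_cone C"
  shows "w = w'"
proof -
  have U: "w \<in> U" "w' \<in> U" using assms by (auto simp: primal_step_def)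
  have "D w' w + D w w' \<le> 0"
    using primal_step_three_point[OF assms(1,3,4) U(2)] primal_step_three_point[OF assms(2,3,4) U(1)]
    by (simp add: algebra_simps)
  then have "\<beta> / 2 * (norm (w - w'))\<^sup>2 + \<beta> / 2 * (norm (w - w'))\<^sup>2 \<le> 0"
    using bregman_lower[OF U] bregman_lower[OF U(2,1)] by (simp add: norm_minus_commute)
  then have "\<beta> * (norm (w - w'))\<^sup>2 \<le> 0" by simp
  then show ?thesis using K(1) by (simp add: mult_le_0_iff)
qed

lemma sum_block_cost:
  "(\<Sum>j\<in>UNIV. block_cost j v q x) = gradG v \<bullet> x + q \<bullet> dOm v x + (F x - G x) + q \<bullet> (\<Theta> x - \<Omega> x)"
proof -
  have "(\<Sum>j\<in>UNIV. gradG v \<bullet> block b j x) = gradG v \<bullet> x"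
    by (simp add: sum_block flip: inner_sum_right)
  moreover have "(\<Sum>j\<in>UNIV. q \<bullet> dOm v (block b j x)) = q \<bullet> dOm v x"
    by (simp add: sum_block flip: inner_sum_right linear_sum[OF dOm_linear])
  ultimately show ?thesis
    by (simp add: block_cost_def F_def \<Theta>_def sum.distrib inner_add_right inner_sum_right)
qed

text \<open>
  Since only block \<open>j\<close> moves, the change of one block cost is the change of the full linearized objective.
\<close>

lemma block_cost_descent:
  assumes v: "v \<in> U" "w \<in> U" and q: "q \<in> dual_cone C"
    and m: "\<And>l. l \<noteq> j \<Longrightarrow> block b l w = block b l v"
  shows "F w - F v + q \<bullet> (\<Theta> w - \<Theta> v) - 1 / 2 * (B\<^sub>G + norm q * norm T) * (norm (w - v))\<^sup>2
    \<le> block_cost j v q w - block_cost j v q v"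
proof -
  have "(\<Sum>l\<in>UNIV. block_cost l v q w) - (\<Sum>l\<in>UNIV. block_cost l v q v)
      = (\<Sum>l\<in>UNIV. block_cost l v q w - block_cost l v q v)"
    by (simp add: sum_subtractf)
  also have "\<dots> = (\<Sum>l\<in>UNIV. if l = j then block_cost j v q w - block_cost j v q v else 0)"
    by (rule sum.cong) (auto simp: block_cost_def m)
  also have "\<dots> = block_cost j v q w - block_cost j v q v" by simp
  finally have eq: "block_cost j v q w - block_cost j v q v
     = gradG v \<bullet> (w - v) + q \<bullet> dOm v (w - v) + (F w - F v) - (G w - G v)
       + q \<bullet> (\<Theta> w - \<Theta> v) - q \<bullet> (\<Omega> w - \<Omega> v)"
    by (simp add: sum_block_cost inner_simps linear_diff[OF dOm_linear])
  have 1: "G w \<le> G v + (w - v) \<bullet> gradG v + B\<^sub>G / 2 * (norm (w - v))\<^sup>2"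
  proof (rule gradient_descent_ineq[where U = UNIV and g' = "\<lambda>x h. h \<bullet> gradG x"])
    fix x y
    have "(x - y) \<bullet> gradG x - (x - y) \<bullet> gradG y \<le> norm (x - y) * norm (gradG x - gradG y)"
      using norm_cauchy_schwarz[of "x - y" "gradG x - gradG y"] by (simp add: inner_diff_right)
    also have "\<dots> \<le> norm (x - y) * (B\<^sub>G * norm (x - y))"
      using lipschitz_onD[OF G(3), of x y] by (intro mult_left_mono) (auto simp: dist_norm)
    finally show "(x - y) \<bullet> gradG x - (x - y) \<bullet> gradG y \<le> B\<^sub>G * (norm (x - y))\<^sup>2"
      by (simp add: power2_eq_square algebra_simps)
  qed (use G(2) in \<open>auto simp: gderiv_def\<close>)
  have 2: "q \<bullet> \<Omega> w \<le> q \<bullet> \<Omega> v + q \<bullet> dOm v (w - v) + (norm q * norm T) / 2 * (norm (w - v))\<^sup>2"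
  proof (rule gradient_descent_ineq[OF U(2) _ _ v])
    show "((\<lambda>x. q \<bullet> \<Omega> x) has_derivative (\<lambda>h. q \<bullet> dOm x h)) (at x)" for x
      by (rule has_derivative_inner_right[OF \<Omega>(2)])
    fix x y assume xy: "x \<in> U" "y \<in> U"
    obtain c where c: "c \<in> C" "dOm x (x - y) - dOm y (x - y) - (norm (x - y))\<^sup>2 *\<^sub>R T = - c"
      using \<Omega>(3)[OF xy] by auto
    have "0 \<le> q \<bullet> c" using q c(1) by (auto simp: dual_cone_def)
    then have "q \<bullet> (dOm x (x - y) - dOm y (x - y) - (norm (x - y))\<^sup>2 *\<^sub>R T) \<le> 0"
      unfolding c(2) by simp
    then have "q \<bullet> dOm x (x - y) - q \<bullet> dOm y (x - y) \<le> (norm (x - y))\<^sup>2 * (q \<bullet> T)"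
      by (simp add: inner_simps)
    also have "\<dots> \<le> (norm (x - y))\<^sup>2 * (norm q * norm T)"
      by (intro mult_left_mono norm_cauchy_schwarz) simp
    finally show "q \<bullet> dOm x (x - y) - q \<bullet> dOm y (x - y) \<le> (norm q * norm T) * (norm (x - y))\<^sup>2"
      by (simp add: mult.commute)
  qed
  show ?thesis
    unfolding eq using 1 2 by (simp add: inner_simps inner_commute algebra_simps)
qed

text \<open>
  The admissible stepsize makes the Bregman distance twice as large as the smoothness errors require; the rest
  is kept on the left as the last term, together with \<open>\<parallel>q - p\<parallel>\<^sup>2 / N\<close>. Both are needed in the first step, from
  a dual point outside the ball.
\<close>

lemma primal_descent:
  assumes v: "v \<in> U" and us: "us \<in> U" "\<And>y. y \<in> dual_cone C \<Longrightarrow> y \<bullet> \<Theta> us \<le> 0"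
    and q_def: "q = proj (p + \<gamma> *\<^sub>R \<Theta> v)"
    and e: "0 < e" "e * (2 * (B\<^sub>G + norm q * norm T + \<gamma> * \<tau>\<^sup>2)) \<le> \<beta>"
    and w: "\<And>j. primal_step j v q e (w j)"
  shows "(\<Sum>j\<in>UNIV. D us (w j) + e * (aug (w j) p - F us)
      + e / (2 * \<gamma>) * ((norm (q - p))\<^sup>2 / N + (norm (\<gamma> *\<^sub>R \<Theta> (w j) - \<gamma> *\<^sub>R \<Theta> v))\<^sup>2))
    \<le> N * D us v + (N - 1) * (e * (aug v p - F us))"
proof -
  have N: "0 < N" by (simp add: N_card)
  have q: "q \<in> dual_cone C" unfolding q_def by (rule proj_in)
  have BG: "0 \<le> B\<^sub>G" using G(3) by (simp add: lipschitz_on_def)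
  define Y where "Y j = (norm (\<gamma> *\<^sub>R \<Theta> (w j) - \<gamma> *\<^sub>R \<Theta> v))\<^sup>2" for j
  have each: "D us (w j) + e * (aug (w j) p - aug v p) + e / (2 * \<gamma>) * Y j
      \<le> D us v - e * (block_cost j v q v - block_cost j v q us)" for j
  proof -
    have wU: "w j \<in> U" using w[of j] by (simp add: primal_step_def)
    define n where "n = (norm (w j - v))\<^sup>2"
    have n0: "0 \<le> n" by (simp add: n_def)
    have tp: "e * (block_cost j v q (w j) - block_cost j v q us) + D (w j) v + D us (w j) \<le> D us v"
      by (rule primal_step_three_point[OF w e(1) q us(1)])
    have "F (w j) - F v + q \<bullet> (\<Theta> (w j) - \<Theta> v) - 1 / 2 * (B\<^sub>G + norm q * norm T) * n
      \<le> block_cost j v q (w j) - block_cost j v q v"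
      unfolding n_def by (rule block_cost_descent[OF v wU q]) (use w[of j] in \<open>auto simp: primal_step_def\<close>)
    moreover have "aug_term (\<gamma> *\<^sub>R \<Theta> (w j)) p \<le> aug_term (\<gamma> *\<^sub>R \<Theta> v) p + 2 * \<gamma> * (q \<bullet> (\<Theta> (w j) - \<Theta> v)) + Y j"
      using aug_term_descent[of "\<gamma> *\<^sub>R \<Theta> (w j)" p "\<gamma> *\<^sub>R \<Theta> v"]
      by (simp add: Y_def q_def mult.assoc flip: scaleR_diff_right)
    then have "aug_term (\<gamma> *\<^sub>R \<Theta> (w j)) p / (2 * \<gamma>)
        \<le> (aug_term (\<gamma> *\<^sub>R \<Theta> v) p + 2 * \<gamma> * (q \<bullet> (\<Theta> (w j) - \<Theta> v)) + Y j) / (2 * \<gamma>)"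
      using \<gamma> by (simp add: divide_right_mono)
    then have "aug_term (\<gamma> *\<^sub>R \<Theta> (w j)) p / (2 * \<gamma>)
        \<le> aug_term (\<gamma> *\<^sub>R \<Theta> v) p / (2 * \<gamma>) + q \<bullet> (\<Theta> (w j) - \<Theta> v) + Y j / (2 * \<gamma>)"
      using \<gamma> by (simp add: add_divide_distrib)
    ultimately have "aug (w j) p - aug v p \<le> block_cost j v q (w j) - block_cost j v q v
        + (1 / 2 * (B\<^sub>G + norm q * norm T) * n + Y j / (2 * \<gamma>))"
      by (simp add: aug_def)
    then have a: "e * (aug (w j) p - aug v p) \<le> e * (block_cost j v q (w j) - block_cost j v q v
        + (1 / 2 * (B\<^sub>G + norm q * norm T) * n + Y j / (2 * \<gamma>)))"
      using e(1) by simp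
    have Yn: "Y j \<le> \<gamma>\<^sup>2 * \<tau>\<^sup>2 * n"
    proof -
      have "norm (\<Theta> (w j) - \<Theta> v) \<le> \<tau> * norm (w j - v)"
        using lipschitz_onD[OF \<Theta> wU v] by (simp add: dist_norm)
      then have "(norm (\<Theta> (w j) - \<Theta> v))\<^sup>2 \<le> (\<tau> * norm (w j - v))\<^sup>2" by (intro power_mono) auto
      then have "\<gamma>\<^sup>2 * (norm (\<Theta> (w j) - \<Theta> v))\<^sup>2 \<le> \<gamma>\<^sup>2 * (\<tau> * norm (w j - v))\<^sup>2"
        by (intro mult_left_mono) auto
      then show ?thesis
        by (simp add: Y_def n_def power_mult_distrib flip: scaleR_diff_right)
    qed
    have "Y j / \<gamma> \<le> \<gamma> * \<tau>\<^sup>2 * n"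
      using Yn \<gamma> by (simp add: divide_le_eq power2_eq_square mult_ac)
    moreover define z where "z = (B\<^sub>G + norm q * norm T) * n"
    moreover have "0 \<le> z" using BG n0 by (simp add: z_def)
    moreover have "Y j / (2 * \<gamma>) = (Y j / \<gamma>) / 2" by simp
    moreover have "1 / 2 * (B\<^sub>G + norm q * norm T) * n = z / 2"
      and "(B\<^sub>G + norm q * norm T + \<gamma> * \<tau>\<^sup>2) * n = z + \<gamma> * \<tau>\<^sup>2 * n"
      by (simp_all add: z_def distrib_right)
    ultimately have "1 / 2 * (B\<^sub>G + norm q * norm T) * n + Y j / (2 * \<gamma>) + Y j / (2 * \<gamma>)
        \<le> (B\<^sub>G + norm q * norm T + \<gamma> * \<tau>\<^sup>2) * n"
      by linarith
    then have "e * (1 / 2 * (B\<^sub>G + norm q * norm T) * n + Y j / (2 * \<gamma>) + Y j / (2 * \<gamma>))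
        \<le> e * ((B\<^sub>G + norm q * norm T + \<gamma> * \<tau>\<^sup>2) * n)"
      using e(1) by simp
    also have "\<dots> = (e * (2 * (B\<^sub>G + norm q * norm T + \<gamma> * \<tau>\<^sup>2))) * (n / 2)" by simp
    also have "\<dots> \<le> \<beta> * (n / 2)" using e(2) n0 by (intro mult_right_mono) auto
    also have "\<dots> \<le> D (w j) v" using bregman_lower[OF wU v] by (simp add: n_def)
    finally have "e * (1 / 2 * (B\<^sub>G + norm q * norm T) * n + Y j / (2 * \<gamma>)) + e / (2 * \<gamma>) * Y j \<le> D (w j) v"
      by (simp add: distrib_left)
    then show ?thesis using tp a by (simp add: right_diff_distrib distrib_left)
  qed
  have lin: "aug v p - F us + (norm (q - p))\<^sup>2 / (2 * \<gamma>)
      \<le> (\<Sum>j\<in>UNIV. block_cost j v q v - block_cost j v q us)"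
  proof -
    have 1: "G v + (us - v) \<bullet> gradG v \<le> G us"
      by (rule convex_gradient_ineq[OF G(1), where g' = "\<lambda>h. h \<bullet> gradG v"])
        (use G(2) in \<open>auto simp: gderiv_def\<close>)
    have 2: "q \<bullet> \<Omega> v + q \<bullet> dOm v (us - v) \<le> q \<bullet> \<Omega> us"
      by (rule convex_gradient_ineq[OF cone_convex_on_inner[OF \<Omega>(1) U(2) q]
            has_derivative_inner_right[OF \<Omega>(2)] us(1) v])
    have "(\<Sum>j\<in>UNIV. block_cost j v q v - block_cost j v q us)
      = gradG v \<bullet> (v - us) + q \<bullet> dOm v (v - us) + (F v - F us) - (G v - G us)
       + q \<bullet> (\<Theta> v - \<Theta> us) - q \<bullet> (\<Omega> v - \<Omega> us)"
      by (simp add: sum_subtractf sum_block_cost inner_simps linear_diff[OF dOm_linear])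
    moreover have "q \<bullet> \<Theta> us \<le> 0" by (rule us(2)[OF q])
    moreover have "q \<bullet> \<Theta> v = aug_term (\<gamma> *\<^sub>R \<Theta> v) p / (2 * \<gamma>) + (norm (q - p))\<^sup>2 / (2 * \<gamma>)"
      using aug_term_attained[of p "\<gamma> *\<^sub>R \<Theta> v"] \<gamma> by (simp add: q_def field_simps)
    ultimately show ?thesis
      using 1 2 by (simp add: aug_def inner_simps inner_commute linear_diff[OF dOm_linear])
  qed
  have "(\<Sum>j\<in>UNIV. D us (w j) + e * (aug (w j) p - aug v p) + e / (2 * \<gamma>) * Y j)
      \<le> (\<Sum>j\<in>(UNIV::'b set). D us v - e * (block_cost j v q v - block_cost j v q us))"
    by (rule sum_mono) (rule each)
  also have "\<dots> = N * D us v - e * (\<Sum>j\<in>UNIV. block_cost j v q v - block_cost j v q us)"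
    by (simp add: sum_subtractf N_card flip: sum_distrib_left)
  also have "\<dots> \<le> N * D us v - e * (aug v p - F us + (norm (q - p))\<^sup>2 / (2 * \<gamma>))"
    using lin e(1) by simp
  finally have fin: "(\<Sum>j\<in>UNIV. D us (w j) + e * (aug (w j) p - aug v p) + e / (2 * \<gamma>) * Y j)
      \<le> N * D us v - e * (aug v p - F us + (norm (q - p))\<^sup>2 / (2 * \<gamma>))" .
  have "D us (w j) + e * (aug (w j) p - F us) + e / (2 * \<gamma>) * ((norm (q - p))\<^sup>2 / N + Y j)
     = (D us (w j) + e * (aug (w j) p - aug v p) + e / (2 * \<gamma>) * Y j)
       + (e * (aug v p - F us) + e / (2 * \<gamma>) * ((norm (q - p))\<^sup>2 / N))" for j
    by (simp add: algebra_simps)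
  moreover have "(\<Sum>j\<in>(UNIV :: 'b set). f j + c) = sum f UNIV + N * c" for f :: "'b \<Rightarrow> real" and c
    by (simp add: sum.distrib N_card)
  ultimately have "(\<Sum>j\<in>UNIV. D us (w j) + e * (aug (w j) p - F us)
      + e / (2 * \<gamma>) * ((norm (q - p))\<^sup>2 / N + Y j))
     = (\<Sum>j\<in>UNIV. D us (w j) + e * (aug (w j) p - aug v p) + e / (2 * \<gamma>) * Y j)
       + N * (e * (aug v p - F us) + e / (2 * \<gamma>) * ((norm (q - p))\<^sup>2 / N))"
    by (simp only:)
  also have "N * (e * (aug v p - F us) + e / (2 * \<gamma>) * ((norm (q - p))\<^sup>2 / N))
      = N * (e * (aug v p - F us)) + e * ((norm (q - p))\<^sup>2 / (2 * \<gamma>))"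
    using N by (simp add: field_simps)
  finally show ?thesis
    using fin unfolding Y_def[symmetric] by (simp add: algebra_simps)
qed

end

section \<open>The Lyapunov function along a path\<close>

locale spdcl_problem =
  block_problem b Us U C G K gradG gradK Jb \<Omega> dOm Phs T B\<^sub>G \<tau> \<beta> \<gamma> N F \<Theta>
  for b :: "'n::finite \<Rightarrow> 'b::finite" and Us U and C :: "(real^'m::finite) set"
    and G K gradG gradK Jb \<Omega> dOm Phs T B\<^sub>G \<tau> \<beta> \<gamma> N F \<Theta> +
  fixes us ps and \<mu> :: real
  assumes us: "us \<in> U" "\<And>y. y \<in> dual_cone C \<Longrightarrow> y \<bullet> \<Theta> us \<le> 0"
    and saddle: "\<And>x. x \<in> U \<Longrightarrow> F us \<le> F x + ps \<bullet> \<Theta> x"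
    and ps_cone: "ps \<in> dual_cone C" and ps_bound: "norm ps + 1 \<le> \<mu>"
begin

sublocale dual_update "dual_cone C" N \<mu> ps
proof
  show "1 \<le> N" by (simp add: N_card Suc_leI)
  show "norm ps \<le> \<mu>" "0 < \<mu>" using ps_bound norm_ge_zero[of ps] by linarith+
qed (rule ps_cone)

text \<open>
  The case distinction of the first step; it involves the data of that step only.
\<close>

definition use_moving_offset :: "real^'m \<Rightarrow> real^'m \<Rightarrow> bool" where
  "use_moving_offset x p \<longleftrightarrow> (proj (p + x) - p) \<bullet> trunc x p \<le> 0 \<or>
     norm (ps - proj (p + x)) * norm (trunc x p) \<le> radial x p"

definition weight :: "bool \<Rightarrow> real" where
  "weight z = (if z then 2 * N - 1 else N)"

definition dual_offset :: "bool \<Rightarrow> real^'m \<Rightarrow> real" where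
  "dual_offset z p = (if z then (norm (ps - p))\<^sup>2 else 4 * \<mu>\<^sup>2)"

text \<open>
  The part of the potential that is multiplied by the stepsize, scaled by \<open>2\<gamma>\<close>; since it is nonnegative in the
  ball, its contribution shrinks with the stepsize.
\<close>

definition scaled_energy :: "bool \<Rightarrow> real^'m \<Rightarrow> real^'n \<Rightarrow> real^'m \<Rightarrow> real" where
  "scaled_energy z y x p = weight z * (N - 1) / N * (2 * \<gamma> * (aug x p - F us) + dual_offset z p)
     + (2 * N - 1) * (norm (y - p))\<^sup>2"

definition potential :: "bool \<Rightarrow> real^'m \<Rightarrow> real \<Rightarrow> real^'n \<Rightarrow> real^'m \<Rightarrow> real" where
  "potential z y e x p = weight z * D us x + e / (2 * \<gamma>) * scaled_energy z y x p"

text \<open>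
  The pathwise excess in the averaged primal inequality.
\<close>

definition surplus :: "real \<Rightarrow> real^'n \<Rightarrow> real^'m \<Rightarrow> real^'n \<Rightarrow> real" where
  "surplus e v p w = D us w + e * (aug w p - F us) - D us v - (N - 1) / N * (e * (aug v p - F us))"

text \<open>
  The nonnegative rest in \<open>primal_descent\<close>, up to the factor \<open>e / (2\<gamma>)\<close>.
\<close>

definition slack :: "real^'n \<Rightarrow> real^'m \<Rightarrow> real^'n \<Rightarrow> real" where
  "slack v p w = (norm (proj (p + \<gamma> *\<^sub>R \<Theta> v) - p))\<^sup>2 / N + (norm (\<gamma> *\<^sub>R \<Theta> w - \<gamma> *\<^sub>R \<Theta> v))\<^sup>2"

lemma weight_pos: "0 < weight z"
  using N by (simp add: weight_def)

lemma scaled_saddle: "x \<in> U \<Longrightarrow> 0 \<le> 2 * \<gamma> * (F x - F us) + 2 * (ps \<bullet> (\<gamma> *\<^sub>R \<Theta> x))"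
proof -
  assume "x \<in> U"
  then have "0 \<le> 2 * \<gamma> * (F x - F us + ps \<bullet> \<Theta> x)" using saddle[of x] \<gamma> by simp
  then show ?thesis by (simp add: algebra_simps)
qed

lemma scaled_aug: "2 * \<gamma> * (aug x p - F us) = 2 * \<gamma> * (F x - F us) + aug_term (\<gamma> *\<^sub>R \<Theta> x) p"
  using \<gamma> by (simp add: aug_def field_simps)

lemma aug_lower:
  assumes "x \<in> U"
  shows "0 \<le> 2 * \<gamma> * (aug x p - F us) + (norm (ps - p))\<^sup>2"
  using aug_term_dual[OF ps(1), of "\<gamma> *\<^sub>R \<Theta> x" p] scaled_saddle[OF assms]
  unfolding scaled_aug by (smt (verit) zero_le_power2)

lemma scaled_energy_nonneg:
  assumes "x \<in> U" "norm p \<le> \<mu>"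
  shows "0 \<le> scaled_energy z y x p"
proof -
  have "norm (ps - p) \<le> 2 * \<mu>"
    using norm_triangle_ineq4[of ps p] assms(2) ps(2) by simp
  then have "(norm (ps - p))\<^sup>2 \<le> (2 * \<mu>)\<^sup>2" by (intro power_mono) auto
  then have "(norm (ps - p))\<^sup>2 \<le> dual_offset z p" by (simp add: dual_offset_def power_mult_distrib)
  then have "0 \<le> 2 * \<gamma> * (aug x p - F us) + dual_offset z p"
    using aug_lower[OF assms(1), of p] by linarith
  moreover have "0 \<le> weight z * (N - 1) / N" using N weight_pos[of z] by simp
  ultimately have "0 \<le> weight z * (N - 1) / N * (2 * \<gamma> * (aug x p - F us) + dual_offset z p)"
    by (intro mult_nonneg_nonneg)
  then show ?thesis
    unfolding scaled_energy_def using N by simp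
qed

lemma potential_nonneg:
  assumes "x \<in> U" "norm p \<le> \<mu>" "0 \<le> e"
  shows "0 \<le> potential z y e x p"
  unfolding potential_def
  using bregman_nonneg[OF us(1) assms(1)] weight_pos[of z] scaled_energy_nonneg[OF assms(1,2)] assms(3) \<gamma>
  by (intro add_nonneg_nonneg mult_nonneg_nonneg) auto

lemma scaled_energy_step:
  assumes w: "w \<in> U" and e: "0 \<le> e'" "e' \<le> e"
    and step: "2 * \<gamma> * (F w - F us) + 2 * (y \<bullet> (\<gamma> *\<^sub>R \<Theta> w)) + scaled_energy z y w p' \<le> R"
    and p': "norm p' \<le> \<mu>"
  shows "e * (F w + y \<bullet> \<Theta> w - F us) + potential z y e' w p' \<le> weight z * D us w + e / (2 * \<gamma>) * R"
proof -
  have "e' / (2 * \<gamma>) * scaled_energy z y w p' \<le> e / (2 * \<gamma>) * scaled_energy z y w p'"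
    using e \<gamma> scaled_energy_nonneg[OF w p'] by (intro mult_right_mono divide_right_mono) auto
  moreover have "e / (2 * \<gamma>) * (2 * \<gamma> * (F w - F us) + 2 * (y \<bullet> (\<gamma> *\<^sub>R \<Theta> w)) + scaled_energy z y w p') \<le> e / (2 * \<gamma>) * R"
    using step e \<gamma> by (intro mult_left_mono) auto
  moreover have "e / (2 * \<gamma>) * (2 * \<gamma> * (F w - F us) + 2 * (y \<bullet> (\<gamma> *\<^sub>R \<Theta> w)) + scaled_energy z y w p')
      = e * (F w + y \<bullet> \<Theta> w - F us) + e / (2 * \<gamma>) * scaled_energy z y w p'"
    using \<gamma> by (simp add: field_simps)
  ultimately show ?thesis by (simp add: potential_def)
qed

lemma regular_step:
  assumes w: "w \<in> U" and p: "norm p \<le> \<mu>" and y: "y \<in> dual_cone C" "norm y \<le> \<mu>"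
    and e: "0 \<le> e'" "e' \<le> e"
  shows "e * (F w + y \<bullet> \<Theta> w - F us) + potential z y e' w (upd (\<gamma> *\<^sub>R \<Theta> w) p)
    \<le> potential z y e v p + weight z * surplus e v p w"
proof -
  define R where "R = weight z * (2 * \<gamma> * (aug w p - F us)) + weight z * (N - 1) / N * dual_offset z p
     + (2 * N - 1) * (norm (y - p))\<^sup>2"
  have "2 * \<gamma> * (F w - F us) + 2 * (y \<bullet> (\<gamma> *\<^sub>R \<Theta> w)) + scaled_energy z y w (upd (\<gamma> *\<^sub>R \<Theta> w) p) \<le> R"
  proof (cases z)
    case True
    then show ?thesis
      using step_moving_offset[OF y p scaled_saddle[OF w]]
      unfolding R_def scaled_energy_def scaled_aug by (simp add: weight_def dual_offset_def)
  next
    case False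
    define f where "f = 2 * \<gamma> * (F w - F us)"
    have c: "weight z * (N - 1) / N = N - 1" and wN: "weight z = N"
      using False N by (auto simp: weight_def)
    show ?thesis
      using step_fixed_offset[OF y p, of f "\<gamma> *\<^sub>R \<Theta> w"] False
      unfolding R_def scaled_energy_def scaled_aug c wN f_def[symmetric]
      using N by (simp add: dual_offset_def distrib_left)
  qed
  from scaled_energy_step[OF w e this upd_ball]
  have "e * (F w + y \<bullet> \<Theta> w - F us) + potential z y e' w (upd (\<gamma> *\<^sub>R \<Theta> w) p)
    \<le> weight z * D us w + e / (2 * \<gamma>) * R" .
  also have "e / (2 * \<gamma>) * R = weight z * (e * (aug w p - F us))
      - weight z * ((N - 1) / N * (e * (aug v p - F us))) + e / (2 * \<gamma>) * scaled_energy z y v p"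
    unfolding R_def scaled_energy_def using \<gamma> N by (simp add: field_simps)
  finally show ?thesis by (simp add: potential_def surplus_def algebra_simps)
qed

text \<open>
  The slack of the primal step controls the whole dual step \<open>d\<close>: by nonexpansiveness and the weighted inequality
  \<open>(a + c)\<^sup>2 \<le> (N + 1) (a\<^sup>2 / N + c\<^sup>2)\<close>.
\<close>

lemma first_step:
  fixes w p
  assumes v: "v \<in> U" and w: "w \<in> U" and y: "y \<in> dual_cone C" "norm y \<le> \<mu>" and e: "0 \<le> e'" "e' \<le> e"
  defines "z \<equiv> use_moving_offset (\<gamma> *\<^sub>R \<Theta> w) p"
  shows "e * (F w + y \<bullet> \<Theta> w - F us) + potential z y e' w (upd (\<gamma> *\<^sub>R \<Theta> w) p)
    \<le> (2 * N - 1) * D us v + e / (2 * \<gamma>) * ((2 * N - 1) * (N - 1) / N *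
          (2 * \<gamma> * (aug v p - F us) + (norm (ps - p))\<^sup>2) + 2 * N * (norm p + \<mu>)\<^sup>2)
      + (2 * N - 1) * (surplus e v p w + e / (2 * \<gamma>) * slack v p w)"
proof -
  define R where "R = (2 * N - 1) * (2 * \<gamma> * (aug w p - F us) + slack v p w)
     + (2 * N - 1) * (N - 1) / N * (norm (ps - p))\<^sup>2 + 2 * N * (norm p + \<mu>)\<^sup>2"
  let ?d = "proj (p + \<gamma> *\<^sub>R \<Theta> w) - p"
  have sl: "(norm ?d)\<^sup>2 \<le> (N + 1) * slack v p w"
  proof -
    define a c where "a = norm (proj (p + \<gamma> *\<^sub>R \<Theta> v) - p)" and "c = norm (\<gamma> *\<^sub>R \<Theta> w - \<gamma> *\<^sub>R \<Theta> v)"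
    have "norm (proj (p + \<gamma> *\<^sub>R \<Theta> w) - proj (p + \<gamma> *\<^sub>R \<Theta> v)) \<le> c"
      using closest_point_lipschitz[OF set_convex closed set_nonempty, of "p + \<gamma> *\<^sub>R \<Theta> w" "p + \<gamma> *\<^sub>R \<Theta> v"]
      by (simp add: proj_def c_def dist_norm)
    then have "norm ?d \<le> a + c"
      using norm_triangle_ineq[of "proj (p + \<gamma> *\<^sub>R \<Theta> w) - proj (p + \<gamma> *\<^sub>R \<Theta> v)" "proj (p + \<gamma> *\<^sub>R \<Theta> v) - p"]
      by (simp add: a_def)
    then have "(norm ?d)\<^sup>2 \<le> (a + c)\<^sup>2" by (intro power_mono) auto
    also have "(a + c)\<^sup>2 = (N + 1) * (a\<^sup>2 / N + c\<^sup>2) - (a - N * c)\<^sup>2 / N"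
      using N by (simp add: power2_eq_square field_simps)
    also have "\<dots> \<le> (N + 1) * (a\<^sup>2 / N + c\<^sup>2)" using N by simp
    finally show ?thesis by (simp add: slack_def a_def c_def)
  qed
  have "2 * \<gamma> * (F w - F us) + 2 * (y \<bullet> (\<gamma> *\<^sub>R \<Theta> w)) + scaled_energy z y w (upd (\<gamma> *\<^sub>R \<Theta> w) p) \<le> R"
  proof (cases z)
    case True
    then show ?thesis
      using first_step_moving_offset[OF sl scaled_saddle[OF w] _ y]
      unfolding R_def scaled_energy_def scaled_aug by (simp add: weight_def dual_offset_def z_def use_moving_offset_def)
  next
    case False
    then have "0 < ?d \<bullet> trunc (\<gamma> *\<^sub>R \<Theta> w) p"
      "radial (\<gamma> *\<^sub>R \<Theta> w) p < norm (ps - proj (p + \<gamma> *\<^sub>R \<Theta> w)) * norm (trunc (\<gamma> *\<^sub>R \<Theta> w) p)"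
      by (auto simp: z_def use_moving_offset_def)
    from first_step_fixed_offset[OF sl scaled_saddle[OF w] this y] False N show ?thesis
      unfolding R_def scaled_energy_def scaled_aug by (simp add: weight_def dual_offset_def)
  qed
  from scaled_energy_step[OF w e this upd_ball]
  have "e * (F w + y \<bullet> \<Theta> w - F us) + potential z y e' w (upd (\<gamma> *\<^sub>R \<Theta> w) p)
    \<le> weight z * D us w + e / (2 * \<gamma>) * R" .
  also have "weight z * D us w \<le> (2 * N - 1) * D us w"
    using bregman_nonneg[OF us(1) w] N by (intro mult_right_mono) (auto simp: weight_def)
  also have "e / (2 * \<gamma>) * R = (2 * N - 1) * (e * (aug w p - F us) + e / (2 * \<gamma>) * slack v p w)
      - (2 * N - 1) * ((N - 1) / N * (e * (aug v p - F us)))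
      + e / (2 * \<gamma>) * ((2 * N - 1) * (N - 1) / N *
          (2 * \<gamma> * (aug v p - F us) + (norm (ps - p))\<^sup>2) + 2 * N * (norm p + \<mu>)\<^sup>2)"
    unfolding R_def using \<gamma> N by (simp add: field_simps)
  finally show ?thesis by (simp add: surplus_def algebra_simps)
qed

text \<open>
  The offset is selected by the first step and kept from then on, so that the potentials telescope.
\<close>

lemma path_bound:
  fixes u :: "nat \<Rightarrow> real^'n" and p :: "nat \<Rightarrow> real^'m" and e :: "nat \<Rightarrow> real"
  assumes u: "\<And>k. u k \<in> U" and p: "\<And>k. p (Suc k) = upd (\<gamma> *\<^sub>R \<Theta> (u (Suc k))) (p k)"
    and e: "\<And>k. 0 \<le> e k" "\<And>k. e (Suc k) \<le> e k"
    and y: "y \<in> dual_cone C" "norm y \<le> \<mu>"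
  defines "z \<equiv> use_moving_offset (\<gamma> *\<^sub>R \<Theta> (u 1)) (p 0)"
  shows "(\<Sum>k\<le>t. e k * (F (u (Suc k)) + y \<bullet> \<Theta> (u (Suc k)) - F us))
    \<le> (2 * N - 1) * D us (u 0) + e 0 / (2 * \<gamma>) * ((2 * N - 1) * (N - 1) / N *
          (2 * \<gamma> * (aug (u 0) (p 0) - F us) + (norm (ps - p 0))\<^sup>2) + 2 * N * (norm (p 0) + \<mu>)\<^sup>2)
      + (2 * N - 1) * (surplus (e 0) (u 0) (p 0) (u 1) + e 0 / (2 * \<gamma>) * slack (u 0) (p 0) (u 1))
      + (\<Sum>k\<in>{1..t}. weight z * surplus (e k) (u k) (p k) (u (Suc k)))"
proof -
  define B where "B = (2 * N - 1) * D us (u 0) + e 0 / (2 * \<gamma>) * ((2 * N - 1) * (N - 1) / N *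
          (2 * \<gamma> * (aug (u 0) (p 0) - F us) + (norm (ps - p 0))\<^sup>2) + 2 * N * (norm (p 0) + \<mu>)\<^sup>2)
      + (2 * N - 1) * (surplus (e 0) (u 0) (p 0) (u 1) + e 0 / (2 * \<gamma>) * slack (u 0) (p 0) (u 1))"
  have pb: "norm (p (Suc k)) \<le> \<mu>" for k unfolding p by (rule upd_ball)
  have "(\<Sum>k\<le>t. e k * (F (u (Suc k)) + y \<bullet> \<Theta> (u (Suc k)) - F us))
      + potential z y (e (Suc t)) (u (Suc t)) (p (Suc t))
    \<le> B + (\<Sum>k\<in>{1..t}. weight z * surplus (e k) (u k) (p k) (u (Suc k)))"
  proof (induction t)
    case 0
    show ?case
      using first_step[OF u[of 0] u[of 1] y e(1)[of 1], of "e 0" "p 0"] e(2)[of 0] p[of 0]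
      by (simp add: B_def z_def)
  next
    case (Suc t)
    show ?case
      using Suc regular_step[OF u[of "Suc (Suc t)"] pb[of t] y e(1)[of "Suc (Suc t)"] e(2)[of "Suc t"],
          of z "u (Suc t)"] p[of "Suc t"]
      by simp
  qed
  moreover have "0 \<le> potential z y (e (Suc t)) (u (Suc t)) (p (Suc t))"
    by (rule potential_nonneg[OF u pb e(1)])
  ultimately show ?thesis by (simp add: B_def)
qed

lemma convex_lagrangian:
  assumes "y \<in> dual_cone C"
  shows "convex_on U (\<lambda>x. F x + y \<bullet> \<Theta> x)"
proof -
  have "convex_on U G" using G(1) U(2) by (auto simp: convex_on_def)
  from convex_on_add[OF convex_on_add[OF this J] convex_on_add[OF cone_convex_on_inner[OF \<Omega>(1) U(2) assms]
        cone_convex_on_inner[OF \<Phi> U(2) assms]]]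
  show ?thesis by (simp add: F_def \<Theta>_def inner_add_right algebra_simps)
qed

lemma average_bound:
  fixes u :: "nat \<Rightarrow> real^'n" and e :: "nat \<Rightarrow> real"
  assumes y: "y \<in> dual_cone C" and u: "\<And>k. u k \<in> U" and e: "\<And>k. 0 \<le> e k" "0 < (\<Sum>k\<le>t. e k)"
  defines "x \<equiv> (1 / (\<Sum>k\<le>t. e k)) *\<^sub>R (\<Sum>k\<le>t. e k *\<^sub>R u (Suc k))"
  shows "x \<in> U"
    and "(\<Sum>k\<le>t. e k) * (F x + y \<bullet> \<Theta> x - F us) \<le> (\<Sum>k\<le>t. e k * (F (u (Suc k)) + y \<bullet> \<Theta> (u (Suc k)) - F us))"
proof -
  define s where "s = (\<Sum>k\<le>t. e k)"
  have s: "0 < s" using e(2) by (simp add: s_def)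
  have x: "x = (\<Sum>k\<le>t. (e k / s) *\<^sub>R u (Suc k))"
    by (simp add: x_def s_def[symmetric] scaleR_sum_right)
  have 1: "(\<Sum>k\<le>t. e k / s) = 1" using s by (simp add: s_def flip: sum_divide_distrib)
  show "x \<in> U" unfolding x by (rule convex_sum[OF _ U(2) 1]) (use e(1) s u in auto)
  have "F x + y \<bullet> \<Theta> x \<le> (\<Sum>k\<le>t. (e k / s) * (F (u (Suc k)) + y \<bullet> \<Theta> (u (Suc k))))"
    unfolding x by (rule convex_on_sum[OF _ _ convex_lagrangian[OF y] 1]) (use e(1) s u in auto)
  then have "s * (F x + y \<bullet> \<Theta> x) \<le> s * (\<Sum>k\<le>t. (e k / s) * (F (u (Suc k)) + y \<bullet> \<Theta> (u (Suc k))))"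
    using s by simp
  also have "\<dots> = (\<Sum>k\<le>t. e k * (F (u (Suc k)) + y \<bullet> \<Theta> (u (Suc k))))"
    unfolding sum_distrib_left using s by (intro sum.cong) auto
  finally show "s * (F x + y \<bullet> \<Theta> x - F us) \<le> (\<Sum>k\<le>t. e k * (F (u (Suc k)) + y \<bullet> \<Theta> (u (Suc k)) - F us))"
    by (simp add: right_diff_distrib sum_subtractf s_def sum_distrib_right)
qed

text \<open>
  The multiplier \<open>\<mu> \<Pi>(\<Theta>(x)) / \<parallel>\<Pi>(\<Theta>(x))\<parallel>\<close> gives \<open>F(x) - F(u\<^sup>*) + \<mu> \<parallel>\<Pi>(\<Theta>(x))\<parallel> \<le> R\<close>, and the saddle point gives
  \<open>F(x) - F(u\<^sup>*) \<ge> - \<parallel>p\<^sup>*\<parallel> \<parallel>\<Pi>(\<Theta>(x))\<parallel>\<close>; the margin \<open>\<mu> - \<parallel>p\<^sup>*\<parallel> > 0\<close> separates the two terms of the gap.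
\<close>

lemma gap_bound:
  assumes x: "x \<in> U" and R: "\<And>y. y \<in> dual_cone C \<Longrightarrow> norm y \<le> \<mu> \<Longrightarrow> F x + y \<bullet> \<Theta> x - F us \<le> R"
  shows "(\<mu> - norm ps) * (\<bar>F x - F us\<bar> + norm (proj (\<Theta> x))) \<le> (\<mu> + 1) * R"
proof -
  define a where "a = norm (proj (\<Theta> x))"
  define \<delta> where "\<delta> = F x - F us"
  \<comment> \<open>the multiplier of norm at most \<open>\<mu>\<close> that penalizes the violation most\<close>
  define y where "y = (if a = 0 then 0 else (\<mu> / a) *\<^sub>R proj (\<Theta> x))"
  have mu1: "1 \<le> \<mu>" using ps_bound norm_ge_zero[of ps] by linarith
  have a0: "0 \<le> a" by (simp add: a_def)
  have "(\<mu> / a) *\<^sub>R proj (\<Theta> x) \<in> dual_cone C"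
    using set_conic proj_in[of "\<Theta> x"] a0 mu_pos unfolding conic_def by simp
  then have yC: "y \<in> dual_cone C" using zero_in by (auto simp: y_def)
  have yn: "norm y \<le> \<mu>" using mu_pos by (auto simp: y_def a_def)
  have "proj (\<Theta> x) \<bullet> \<Theta> x = a\<^sup>2"
    using proj_orth[of "\<Theta> x"] by (simp add: a_def power2_norm_eq_inner inner_simps inner_commute)
  then have "y \<bullet> \<Theta> x = \<mu> * a" by (simp add: y_def power2_eq_square)
  then have X: "\<delta> + \<mu> * a \<le> R" using R[OF yC yn] by (simp add: \<delta>_def)
  have "ps \<bullet> \<Theta> x \<le> ps \<bullet> proj (\<Theta> x)"
    using proj_polar[OF ps(1), of "\<Theta> x"] by (simp add: inner_diff_left inner_diff_right inner_commute)
  also have "\<dots> \<le> norm ps * a" unfolding a_def by (rule norm_cauchy_schwarz)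
  finally have d: "- (norm ps * a) \<le> \<delta>" using saddle[OF x] by (simp add: \<delta>_def)
  have R0: "0 \<le> R"
  proof -
    have "norm ps * a \<le> \<mu> * a" using ps(2) a0 by (intro mult_right_mono) auto
    then show ?thesis using X d by linarith
  qed
  show ?thesis
  proof (cases "0 \<le> \<delta>")
    case True
    have "1 * a \<le> \<mu> * a" using mu1 a0 by (intro mult_right_mono) auto
    then have "\<bar>\<delta>\<bar> + a \<le> R" using X True by simp
    then have "(\<mu> - norm ps) * (\<bar>\<delta>\<bar> + a) \<le> (\<mu> - norm ps) * R"
      using ps(2) by (intro mult_left_mono) auto
    also have "\<dots> \<le> (\<mu> + 1) * R" using R0 norm_ge_zero[of ps] by (intro mult_right_mono) linarith+
    finally show ?thesis by (simp add: a_def \<delta>_def)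
  next
    case False
    then have "\<bar>\<delta>\<bar> + a \<le> (1 + norm ps) * a" using d by (simp add: algebra_simps)
    then have "(\<mu> - norm ps) * (\<bar>\<delta>\<bar> + a) \<le> (\<mu> - norm ps) * ((1 + norm ps) * a)"
      using ps(2) by (intro mult_left_mono) auto
    also have "\<dots> = (1 + norm ps) * ((\<mu> - norm ps) * a)" by simp
    also have "\<dots> \<le> (1 + norm ps) * R"
      using X d by (intro mult_left_mono) (auto simp: left_diff_distrib)
    also have "\<dots> \<le> (\<mu> + 1) * R" using R0 ps(2) by (intro mult_right_mono) auto
    finally show ?thesis by (simp add: a_def \<delta>_def)
  qed
qed

lemma surplus_average:
  assumes v: "v \<in> U" and q: "q = proj (p + \<gamma> *\<^sub>R \<Theta> v)"
    and e: "0 < e" "e * (2 * (B\<^sub>G + norm q * norm T + \<gamma> * \<tau>\<^sup>2)) \<le> \<beta>"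
    and w: "\<And>j. primal_step j v q e (w j)"
  shows "(\<Sum>j\<in>UNIV. surplus e v p (w j) + e / (2 * \<gamma>) * slack v p (w j)) \<le> 0"
    and "(\<Sum>j\<in>UNIV. surplus e v p (w j)) \<le> 0"
proof -
  have "(\<Sum>j\<in>UNIV. surplus e v p (w j) + e / (2 * \<gamma>) * slack v p (w j))
      = (\<Sum>j\<in>UNIV. D us (w j) + e * (aug (w j) p - F us)
      + e / (2 * \<gamma>) * ((norm (q - p))\<^sup>2 / N + (norm (\<gamma> *\<^sub>R \<Theta> (w j) - \<gamma> *\<^sub>R \<Theta> v))\<^sup>2))
      - (\<Sum>j\<in>(UNIV :: 'b set). D us v + (N - 1) / N * (e * (aug v p - F us)))"
    unfolding sum_subtractf[symmetric] by (rule sum.cong) (auto simp: surplus_def slack_def q)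
  also have "(\<Sum>j\<in>(UNIV :: 'b set). D us v + (N - 1) / N * (e * (aug v p - F us)))
      = N * D us v + (N - 1) * (e * (aug v p - F us))"
    using N by (simp add: N_card[symmetric] distrib_left)
  finally show le: "(\<Sum>j\<in>UNIV. surplus e v p (w j) + e / (2 * \<gamma>) * slack v p (w j)) \<le> 0"
    using primal_descent[OF v us q e w] by simp
  have "0 \<le> e / (2 * \<gamma>) * slack v p (w j)" for j
    using e(1) \<gamma> N by (auto simp: slack_def intro!: mult_nonneg_nonneg add_nonneg_nonneg)
  then have "(\<Sum>j\<in>UNIV. surplus e v p (w j)) \<le> (\<Sum>j\<in>UNIV. surplus e v p (w j) + e / (2 * \<gamma>) * slack v p (w j))"
    by (intro sum_mono) simp
  then show "(\<Sum>j\<in>UNIV. surplus e v p (w j)) \<le> 0" using le by linarith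
qed

end

section \<open>Uniform random choices\<close>

locale uniform_choices = prob_space M for M :: "'w measure" +
  fixes i :: "nat \<Rightarrow> 'w \<Rightarrow> 'b::finite"
  assumes i_indep: "indep_vars (\<lambda>_. count_space UNIV) i UNIV"
    and i_uniform: "\<And>k j. measure M {\<omega> \<in> space M. i k \<omega> = j} = 1 / real CARD('b)"
begin

definition determined :: "nat \<Rightarrow> ('w \<Rightarrow> 'x) \<Rightarrow> bool" where
  "determined k X \<longleftrightarrow> (\<forall>\<omega>\<in>space M. \<forall>\<omega>'\<in>space M. (\<forall>n<k. i n \<omega> = i n \<omega>') \<longrightarrow> X \<omega> = X \<omega>')"

definition cylinder :: "nat \<Rightarrow> (nat \<Rightarrow> 'b) \<Rightarrow> 'w set" where
  "cylinder k h = {\<omega> \<in> space M. \<forall>n<k. i n \<omega> = h n}"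

lemma determinedI:
  assumes "\<And>\<omega> \<omega>'. \<omega> \<in> space M \<Longrightarrow> \<omega>' \<in> space M \<Longrightarrow> (\<And>n. n < k \<Longrightarrow> i n \<omega> = i n \<omega>') \<Longrightarrow> X \<omega> = X \<omega>'"
  shows "determined k X"
  using assms unfolding determined_def by blast

lemma determinedD:
  assumes "determined k X" "\<omega> \<in> space M" "\<omega>' \<in> space M" "\<And>n. n < k \<Longrightarrow> i n \<omega> = i n \<omega>'"
  shows "X \<omega> = X \<omega>'"
  using assms unfolding determined_def by blast

lemma determined_mono: "determined k X \<Longrightarrow> k \<le> l \<Longrightarrow> determined l X"
  unfolding determined_def by (meson less_le_trans)

lemma choice_event: "{\<omega> \<in> space M. i k \<omega> = j} \<in> events"
proof -
  have "i k \<in> measurable M (count_space UNIV)" using i_indep by (auto simp: indep_vars_def)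
  from measurable_sets[OF this, of "{j}"] show ?thesis by (simp add: vimage_def Int_def conj_commute)
qed

lemma cylinder_event [measurable]: "cylinder k h \<in> events"
proof -
  have "cylinder k h = space M \<inter> (\<Inter>n\<in>{..<k}. {\<omega> \<in> space M. i n \<omega> = h n}) \<or> k = 0"
    by (auto simp: cylinder_def)
  then show ?thesis
  proof
    assume eq: "cylinder k h = space M \<inter> (\<Inter>n\<in>{..<k}. {\<omega> \<in> space M. i n \<omega> = h n})"
    show ?thesis
    proof (cases "k = 0")
      case False
      then have "(\<Inter>n\<in>{..<k}. {\<omega> \<in> space M. i n \<omega> = h n}) \<in> events"
        by (intro sets.finite_INT choice_event) auto
      then show ?thesis unfolding eq by auto
    qed (simp add: cylinder_def)
  qed (simp add: cylinder_def)
qed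

lemma prob_cylinder: "prob (cylinder k h) = (1 / real CARD('b)) ^ k"
proof (cases "k = 0")
  case False
  have ev: "i n -` {h n} \<inter> space M = {\<omega> \<in> space M. i n \<omega> = h n}" for n by auto
  have "prob (\<Inter>n\<in>{..<k}. i n -` {h n} \<inter> space M) = (\<Prod>n\<in>{..<k}. prob (i n -` {h n} \<inter> space M))"
    by (rule indep_varsD[OF i_indep]) (use False in auto)
  also have "(\<Inter>n\<in>{..<k}. i n -` {h n} \<inter> space M) = cylinder k h"
    using False by (auto simp: cylinder_def)
  finally show ?thesis by (simp add: i_uniform ev)
qed (simp add: cylinder_def prob_space)

lemma cylinder_pos: "0 < prob (cylinder k h)"
  by (simp add: prob_cylinder)

lemma cylinder_nonempty: "cylinder k h \<noteq> {}"
  using cylinder_pos[of k h] by (metis less_irrefl measure_empty)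

text \<open>
  A set that depends on finitely many choices and is not empty contains a cylinder, so it is not null.
\<close>

lemma determined_AE:
  assumes X: "determined k X" and Q: "AE \<omega> in M. Q (X \<omega>)" and \<omega>: "\<omega> \<in> space M"
  shows "Q (X \<omega>)"
proof (rule ccontr)
  assume n: "\<not> Q (X \<omega>)"
  obtain A where A: "{\<omega> \<in> space M. \<not> Q (X \<omega>)} \<subseteq> A" "emeasure M A = 0" "A \<in> events"
    using AE_E[OF Q] by blast
  have "X \<omega>' = X \<omega>" if "\<omega>' \<in> cylinder k (\<lambda>n. i n \<omega>)" for \<omega>'
    using X \<omega> that unfolding determined_def cylinder_def by blast
  then have "cylinder k (\<lambda>n. i n \<omega>) \<subseteq> A"
    using n A(1) by (auto simp: cylinder_def)
  then have "prob (cylinder k (\<lambda>n. i n \<omega>)) \<le> prob A"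
    using A(3) by (intro finite_measure_mono)
  then show False using A(2) cylinder_pos[of k "\<lambda>n. i n \<omega>"] by (simp add: measure_def)
qed

text \<open>
  An outcome with the same first \<open>k\<close> choices and \<open>j\<close> as the next one; it realizes the steps not taken.
\<close>

definition branch :: "nat \<Rightarrow> 'b \<Rightarrow> 'w \<Rightarrow> 'w" where
  "branch k j \<omega> = (SOME \<omega>'. \<omega>' \<in> cylinder (Suc k) ((\<lambda>n. i n \<omega>)(k := j)))"

lemma branch:
  shows "branch k j \<omega> \<in> space M" "i k (branch k j \<omega>) = j" "n < k \<Longrightarrow> i n (branch k j \<omega>) = i n \<omega>"
proof -
  have *: "branch k j \<omega> \<in> cylinder (Suc k) ((\<lambda>n. i n \<omega>)(k := j))"
    unfolding branch_def by (rule someI_ex) (use cylinder_nonempty in blast)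
  show "branch k j \<omega> \<in> space M" "i k (branch k j \<omega>) = j" "n < k \<Longrightarrow> i n (branch k j \<omega>) = i n \<omega>"
    using * by (simp_all add: cylinder_def)
qed

lemma determined_branches:
  assumes "determined (Suc k) X"
  shows "determined k (\<lambda>\<omega>. X (branch k j \<omega>))"
  unfolding determined_def
proof (intro ballI impI)
  fix \<omega> \<omega>' assume "\<omega> \<in> space M" "\<omega>' \<in> space M" and a: "\<forall>n<k. i n \<omega> = i n \<omega>'"
  have "i n (branch k j \<omega>) = i n (branch k j \<omega>')" if "n < Suc k" for n
    using that a branch(2)[of k j] branch(3)[of n k j] by (cases "n = k") auto
  then show "X (branch k j \<omega>) = X (branch k j \<omega>')"
    using assms branch(1)[of k j] unfolding determined_def by blast
qed

lemma determined_branch_average: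
  fixes X :: "'w \<Rightarrow> real"
  assumes "determined (Suc k) X"
  shows "determined k (\<lambda>\<omega>. (\<Sum>j\<in>UNIV. X (branch k j \<omega>)) / real CARD('b))"
  unfolding determined_def
proof (intro ballI impI)
  fix \<omega> \<omega>' assume "\<omega> \<in> space M" "\<omega>' \<in> space M" "\<forall>n<k. i n \<omega> = i n \<omega>'"
  then have "X (branch k j \<omega>) = X (branch k j \<omega>')" for j
    using determined_branches[OF assms, of j] unfolding determined_def by blast
  then show "(\<Sum>j\<in>UNIV. X (branch k j \<omega>)) / real CARD('b) = (\<Sum>j\<in>UNIV. X (branch k j \<omega>')) / real CARD('b)"
    by simp
qed

definition histories :: "nat \<Rightarrow> (nat \<Rightarrow> 'b) set" where
  "histories k = PiE {..<k} (\<lambda>_. UNIV)"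

definition witness :: "nat \<Rightarrow> (nat \<Rightarrow> 'b) \<Rightarrow> 'w" where
  "witness k h = (SOME \<omega>. \<omega> \<in> cylinder k h)"

lemma witness: "witness k h \<in> cylinder k h"
  unfolding witness_def by (rule someI_ex) (use cylinder_nonempty in blast)

lemma finite_histories: "finite (histories k)"
  by (auto simp: histories_def intro!: finite_PiE)

lemma sum_histories:
  fixes X :: "'w \<Rightarrow> real"
  assumes "determined k X" "\<omega> \<in> space M"
  shows "(\<Sum>h\<in>histories k. X (witness k h) * indicator (cylinder k h) \<omega>) = X \<omega>"
proof -
  define h0 where "h0 = restrict (\<lambda>n. i n \<omega>) {..<k}"
  have h0: "h0 \<in> histories k" by (auto simp: h0_def histories_def)
  have "h = h0" if "h \<in> histories k" "\<omega> \<in> cylinder k h" for h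
    using that by (auto simp: h0_def histories_def cylinder_def PiE_def extensional_def fun_eq_iff)
  then have "(\<Sum>h\<in>histories k. X (witness k h) * indicator (cylinder k h) \<omega>)
      = (\<Sum>h\<in>histories k. if h = h0 then X (witness k h0) * indicator (cylinder k h0) \<omega> else 0)"
    by (intro sum.cong) (auto simp: indicator_def)
  also have "\<dots> = X (witness k h0) * indicator (cylinder k h0) \<omega>"
    using h0 finite_histories by simp
  also have "\<dots> = X \<omega>"
  proof -
    have "\<omega> \<in> cylinder k h0" using assms(2) by (simp add: cylinder_def h0_def)
    moreover have "X (witness k h0) = X \<omega>"
      using witness[of k h0] by (intro determinedD[OF assms(1)]) (simp_all add: cylinder_def h0_def assms(2))
    ultimately show ?thesis by simp
  qed
  finally show ?thesis .
qed

lemma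
  fixes X :: "'w \<Rightarrow> real"
  assumes X: "determined k X"
  shows determined_integrable: "integrable M X"
    and determined_expectation:
      "expectation X = (\<Sum>h\<in>histories k. X (witness k h)) * (1 / real CARD('b)) ^ k"
proof -
  let ?Y = "\<lambda>\<omega>. \<Sum>h\<in>histories k. X (witness k h) * indicator (cylinder k h) \<omega>"
  have int: "integrable M (\<lambda>\<omega>. X (witness k h) * indicator (cylinder k h) \<omega>)" for h
    by (intro integrable_mult_right integrable_real_indicator) (auto simp: emeasure_eq_measure)
  have "integrable M ?Y" by (rule Bochner_Integration.integrable_sum) (rule int)
  moreover have eq: "integrable M X = integrable M ?Y"
    by (rule Bochner_Integration.integrable_cong) (auto simp: sum_histories[OF X])
  ultimately show "integrable M X" by simp
  have "expectation X = expectation ?Y"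
    by (rule Bochner_Integration.integral_cong) (auto simp: sum_histories[OF X])
  also have "\<dots> = (\<Sum>h\<in>histories k. expectation (\<lambda>\<omega>. X (witness k h) * indicator (cylinder k h) \<omega>))"
    by (rule Bochner_Integration.integral_sum) (rule int)
  also have "\<dots> = (\<Sum>h\<in>histories k. X (witness k h) * (1 / real CARD('b)) ^ k)"
    by (intro sum.cong refl) (simp add: prob_cylinder cylinder_event)
  finally show "expectation X = (\<Sum>h\<in>histories k. X (witness k h)) * (1 / real CARD('b)) ^ k"
    by (simp add: sum_distrib_right)
qed

text \<open>
  The tower property for the next, uniformly distributed choice.
\<close>

lemma expectation_branch:
  fixes X :: "'w \<Rightarrow> real"
  assumes X: "determined (Suc k) X"
  shows "expectation X = expectation (\<lambda>\<omega>. (\<Sum>j\<in>UNIV. X (branch k j \<omega>)) / real CARD('b))"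
proof -
  let ?c = "\<lambda>h j. cylinder (Suc k) (h(k := j))"
  let ?Y = "\<lambda>\<omega>. \<Sum>j\<in>UNIV. \<Sum>h\<in>histories k. X (branch k j (witness k h)) * indicator (?c h j) \<omega>"
  have int: "integrable M (\<lambda>\<omega>. X (branch k j (witness k h)) * indicator (?c h j) \<omega>)" for h j
    by (intro integrable_mult_right integrable_real_indicator) (auto simp: emeasure_eq_measure)
  have "X \<omega> = ?Y \<omega>" if \<omega>: "\<omega> \<in> space M" for \<omega>
  proof -
    have "(indicator (?c h j) \<omega> :: real) = indicator (cylinder k h) \<omega> * (if i k \<omega> = j then 1 else 0)" for h j
      by (auto simp: indicator_def cylinder_def less_Suc_eq)
    then have "?Y \<omega> = (\<Sum>j\<in>UNIV. (\<Sum>h\<in>histories k. X (branch k j (witness k h)) * indicator (cylinder k h) \<omega>)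
        * (if i k \<omega> = j then 1 else 0))"
      by (simp add: sum_distrib_right mult.assoc)
    also have "\<dots> = (\<Sum>j\<in>UNIV. X (branch k j \<omega>) * (if i k \<omega> = j then 1 else 0))"
      using sum_histories[OF determined_branches[OF X] \<omega>] by simp
    also have "\<dots> = (\<Sum>j\<in>UNIV. if j = i k \<omega> then X (branch k (i k \<omega>) \<omega>) else 0)"
      by (rule sum.cong) auto
    also have "\<dots> = X (branch k (i k \<omega>) \<omega>)" by simp
    also have "\<dots> = X \<omega>"
    proof -
      have "i n (branch k (i k \<omega>) \<omega>) = i n \<omega>" if "n < Suc k" for n
        using that by (cases "n = k") (simp_all add: branch)
      then show ?thesis using X \<omega> branch(1)[of k "i k \<omega>" \<omega>] unfolding determined_def by blast
    qed
    finally show ?thesis by simp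
  qed
  then have "expectation X = expectation ?Y"
    by (intro Bochner_Integration.integral_cong) auto
  also have "\<dots> = (\<Sum>j\<in>UNIV. \<Sum>h\<in>histories k.
      expectation (\<lambda>\<omega>. X (branch k j (witness k h)) * indicator (?c h j) \<omega>))"
    by (simp only: Bochner_Integration.integral_sum Bochner_Integration.integrable_sum int)
  also have "\<dots> = (\<Sum>j\<in>UNIV. \<Sum>h\<in>histories k. X (branch k j (witness k h)) * (1 / real CARD('b)) ^ Suc k)"
    by (intro sum.cong refl) (simp add: prob_cylinder cylinder_event)
  also have "\<dots> = (\<Sum>h\<in>histories k. \<Sum>j\<in>UNIV. X (branch k j (witness k h)) * (1 / real CARD('b)) ^ Suc k)"
    by (rule sum.swap)
  also have "\<dots> = (\<Sum>h\<in>histories k. (\<Sum>j\<in>UNIV. X (branch k j (witness k h))) / real CARD('b))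
      * (1 / real CARD('b)) ^ k"
    by (simp add: sum_distrib_right sum_divide_distrib)
  also have "\<dots> = expectation (\<lambda>\<omega>. (\<Sum>j\<in>UNIV. X (branch k j \<omega>)) / real CARD('b))"
  proof (rule determined_expectation[symmetric])
    show "determined k (\<lambda>\<omega>. (\<Sum>j\<in>UNIV. X (branch k j \<omega>)) / real CARD('b))"
      by (rule determined_branch_average[OF X])
  qed
  finally show ?thesis .
qed

lemma expectation_nonpos:
  fixes X :: "'w \<Rightarrow> real"
  assumes X: "determined (Suc k) X" and le: "\<And>\<omega>. \<omega> \<in> space M \<Longrightarrow> (\<Sum>j\<in>UNIV. X (branch k j \<omega>)) \<le> 0"
  shows "expectation X \<le> 0"
proof -
  have "expectation (\<lambda>\<omega>. (\<Sum>j\<in>UNIV. X (branch k j \<omega>)) / real CARD('b)) \<le> expectation (\<lambda>\<omega>. 0)"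
  proof (rule integral_mono)
    have "determined k (\<lambda>\<omega>. (\<Sum>j\<in>UNIV. X (branch k j \<omega>)) / real CARD('b))"
      by (rule determined_branch_average[OF X])
    then show "integrable M (\<lambda>\<omega>. (\<Sum>j\<in>UNIV. X (branch k j \<omega>)) / real CARD('b))"
      by (rule determined_integrable)
  qed (use le in \<open>auto simp: divide_nonpos_pos\<close>)
  then show ?thesis using expectation_branch[OF X] by simp
qed

end

section \<open>Expected decrease\<close>

locale spdcl_run =
  spdcl_problem b Us U C G K gradG gradK Jb \<Omega> dOm Phs T B\<^sub>G \<tau> \<beta> \<gamma> N F \<Theta> us ps \<mu> + uniform_choices M i
  for b :: "'n::finite \<Rightarrow> 'b::finite" and Us U and C :: "(real^'m::finite) set"
    and G K gradG gradK Jb \<Omega> dOm Phs T B\<^sub>G \<tau> \<beta> \<gamma> N F \<Theta> us ps \<mu>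
    and M :: "'w measure" and i :: "nat \<Rightarrow> 'w \<Rightarrow> 'b" +
  fixes u :: "nat \<Rightarrow> 'w \<Rightarrow> real^'n" and p :: "nat \<Rightarrow> 'w \<Rightarrow> real^'m" and e :: "nat \<Rightarrow> 'w \<Rightarrow> real"
    and u\<^sub>0 p\<^sub>0 and e\<^sub>0 low :: real
  assumes start: "u\<^sub>0 \<in> U" "\<And>\<omega>. \<omega> \<in> space M \<Longrightarrow> u 0 \<omega> = u\<^sub>0" "\<And>\<omega>. \<omega> \<in> space M \<Longrightarrow> p 0 \<omega> = p\<^sub>0"
      "\<And>\<omega>. \<omega> \<in> space M \<Longrightarrow> e 0 \<omega> = e\<^sub>0" "e\<^sub>0 \<le> spdcl_bound \<beta> B\<^sub>G \<gamma> \<tau> T (proj (p\<^sub>0 + \<gamma> *\<^sub>R \<Theta> u\<^sub>0))"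
    and e_Suc: "\<And>k \<omega>. \<omega> \<in> space M \<Longrightarrow> e (Suc k) \<omega> = min (e k \<omega>)
        (spdcl_bound \<beta> B\<^sub>G \<gamma> \<tau> T (proj (p (Suc k) \<omega> + \<gamma> *\<^sub>R \<Theta> (u (Suc k) \<omega>))))"
    and u_Suc: "\<And>k \<omega>. \<omega> \<in> space M \<Longrightarrow>
        primal_step (i k \<omega>) (u k \<omega>) (proj (p k \<omega> + \<gamma> *\<^sub>R \<Theta> (u k \<omega>))) (e k \<omega>) (u (Suc k) \<omega>)"
    and p_Suc: "\<And>k \<omega>. \<omega> \<in> space M \<Longrightarrow> p (Suc k) \<omega> = upd (\<gamma> *\<^sub>R \<Theta> (u (Suc k) \<omega>)) (p k \<omega>)"
    and low: "0 < low" "AE \<omega> in M. \<forall>k. low \<le> e k \<omega>"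
begin

text \<open>
  The induction is simultaneous with positivity of the stepsize: the minimizer is unique only if the current stepsize is
  positive, the lower bound is assumed almost surely, and it extends to all outcomes because the current state is
  already known to be determined.
\<close>

lemma determined_state: "determined k (\<lambda>\<omega>. (u k \<omega>, p k \<omega>, e k \<omega>))"
proof (induction k)
  case 0
  show ?case by (rule determinedI) (simp add: start)
next
  case (Suc k)
  have "determined k (e k)" by (rule determinedI) (use determinedD[OF Suc] in blast)
  moreover have "AE \<omega> in M. low \<le> e k \<omega>" using low(2) by eventually_elim auto
  ultimately have ek: "low \<le> e k \<omega>" if "\<omega> \<in> space M" for \<omega>
    using determined_AE[of k "e k" "\<lambda>x. low \<le> x"] that by blast
  show ?case
  proof (rule determinedI)
    fix \<omega> \<omega>' assume \<omega>: "\<omega> \<in> space M" "\<omega>' \<in> space M" and a: "\<And>n. n < Suc k \<Longrightarrow> i n \<omega> = i n \<omega>'"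
    have s: "u k \<omega> = u k \<omega>'" "p k \<omega> = p k \<omega>'" "e k \<omega> = e k \<omega>'"
      using determinedD[OF Suc \<omega> a] by simp_all
    have "u (Suc k) \<omega> = u (Suc k) \<omega>'"
    proof (rule primal_step_unique[OF u_Suc[OF \<omega>(1), of k]])
      show "primal_step (i k \<omega>) (u k \<omega>) (proj (p k \<omega> + \<gamma> *\<^sub>R \<Theta> (u k \<omega>))) (e k \<omega>) (u (Suc k) \<omega>')"
        using u_Suc[OF \<omega>(2), of k] unfolding s a[OF lessI] .
      show "0 < e k \<omega>" using ek[OF \<omega>(1)] low(1) by simp
      show "proj (p k \<omega> + \<gamma> *\<^sub>R \<Theta> (u k \<omega>)) \<in> dual_cone C" by (rule proj_in)
    qed
    then show "(u (Suc k) \<omega>, p (Suc k) \<omega>, e (Suc k) \<omega>) = (u (Suc k) \<omega>', p (Suc k) \<omega>', e (Suc k) \<omega>')"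
      by (simp add: p_Suc[OF \<omega>(1)] p_Suc[OF \<omega>(2)] e_Suc[OF \<omega>(1)] e_Suc[OF \<omega>(2)] s)
  qed
qed

lemma state_eq:
  assumes "\<omega> \<in> space M" "\<omega>' \<in> space M" "\<And>n. n < k \<Longrightarrow> i n \<omega> = i n \<omega>'" "l \<le> k"
  shows "u l \<omega> = u l \<omega>'" "p l \<omega> = p l \<omega>'" "e l \<omega> = e l \<omega>'"
  using determinedD[OF determined_mono[OF determined_state[of l] assms(4)] assms(1-3)] by simp_all

lemma low_le: "\<omega> \<in> space M \<Longrightarrow> low \<le> e k \<omega>"
proof -
  assume \<omega>: "\<omega> \<in> space M"
  have "determined k (e k)" by (rule determinedI) (rule state_eq(3)[OF _ _ _ order_refl])
  moreover have "AE \<omega> in M. low \<le> e k \<omega>" using low(2) by eventually_elim auto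
  ultimately show "low \<le> e k \<omega>"
    using determined_AE[of k "e k" "\<lambda>x. low \<le> x"] \<omega> by blast
qed

lemma u_in: "\<omega> \<in> space M \<Longrightarrow> u k \<omega> \<in> U"
  using start u_Suc by (cases k) (auto simp: primal_step_def)

lemma e_pos: "\<omega> \<in> space M \<Longrightarrow> 0 < e k \<omega>"
  using low_le[of \<omega> k] low(1) by simp

lemma e_small:
  assumes \<omega>: "\<omega> \<in> space M"
  shows "e k \<omega> * (2 * (B\<^sub>G + norm (proj (p k \<omega> + \<gamma> *\<^sub>R \<Theta> (u k \<omega>))) * norm T + \<gamma> * \<tau>\<^sup>2)) \<le> \<beta>"
proof -
  define z where "z = B\<^sub>G + norm (proj (p k \<omega> + \<gamma> *\<^sub>R \<Theta> (u k \<omega>))) * norm T + \<gamma> * \<tau>\<^sup>2"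
  have "0 \<le> B\<^sub>G" using G(3) by (simp add: lipschitz_on_def)
  then have z: "0 \<le> z" using \<gamma> by (simp add: z_def)
  have "e k \<omega> \<le> spdcl_bound \<beta> B\<^sub>G \<gamma> \<tau> T (proj (p k \<omega> + \<gamma> *\<^sub>R \<Theta> (u k \<omega>)))"
    using start(5) e_Suc[OF \<omega>] by (cases k) (auto simp: start(2-4)[OF \<omega>])
  then have le: "e k \<omega> \<le> \<beta> / (2 * z)" by (simp add: spdcl_bound_def z_def)
  then have "z \<noteq> 0" using e_pos[OF \<omega>, of k] by auto
  then show ?thesis using le z unfolding z_def[symmetric] by (simp add: field_simps)
qed

definition step_surplus :: "nat \<Rightarrow> 'w \<Rightarrow> real" where
  "step_surplus k \<omega> = surplus (e k \<omega>) (u k \<omega>) (p k \<omega>) (u (Suc k) \<omega>)"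

text \<open>
  The terms by which a path can exceed the bound; each has nonpositive mean, since the weight is determined by the first
  choice and therefore constant over the continuations.
\<close>

definition noise :: "nat \<Rightarrow> 'w \<Rightarrow> real" where
  "noise k \<omega> = (if k = 0
     then (2 * N - 1) * (step_surplus 0 \<omega> + e 0 \<omega> / (2 * \<gamma>) * slack (u 0 \<omega>) (p 0 \<omega>) (u 1 \<omega>))
     else weight (use_moving_offset (\<gamma> *\<^sub>R \<Theta> (u 1 \<omega>)) (p 0 \<omega>)) * step_surplus k \<omega>)"

lemma determined_noise: "determined (Suc k) (noise k)"
proof (rule determinedI)
  fix \<omega> \<omega>' assume \<omega>: "\<omega> \<in> space M" "\<omega>' \<in> space M" and a: "\<And>n. n < Suc k \<Longrightarrow> i n \<omega> = i n \<omega>'"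
  have "u l \<omega> = u l \<omega>'" "p l \<omega> = p l \<omega>'" "e l \<omega> = e l \<omega>'" if "l \<le> Suc k" for l
    using state_eq[OF \<omega>, of "Suc k" l] a that by blast+
  then show "noise k \<omega> = noise k \<omega>'"
    by (simp add: noise_def step_surplus_def)
qed

lemma expectation_noise: "expectation (noise k) \<le> 0"
proof (rule expectation_nonpos[OF determined_noise])
  fix \<omega> assume \<omega>: "\<omega> \<in> space M"
  have s: "u l (branch k j \<omega>) = u l \<omega>" "p l (branch k j \<omega>) = p l \<omega>" "e l (branch k j \<omega>) = e l \<omega>"
    if "l \<le> k" for l j
    using state_eq[OF branch(1) \<omega> branch(3) that] by simp_all
  define w where "w j = u (Suc k) (branch k j \<omega>)" for j
  have "primal_step j (u k \<omega>) (proj (p k \<omega> + \<gamma> *\<^sub>R \<Theta> (u k \<omega>))) (e k \<omega>) (w j)" for j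
    using u_Suc[OF branch(1)[of k j \<omega>], of k] unfolding branch(2) by (simp add: s w_def)
  note avg = surplus_average[OF u_in[OF \<omega>] refl e_pos[OF \<omega>] e_small[OF \<omega>] this]
  show "(\<Sum>j\<in>UNIV. noise k (branch k j \<omega>)) \<le> 0"
  proof (cases "k = 0")
    case True
    have "(\<Sum>j\<in>UNIV. noise k (branch k j \<omega>))
        = (2 * N - 1) * (\<Sum>j\<in>UNIV. surplus (e k \<omega>) (u k \<omega>) (p k \<omega>) (w j)
            + e k \<omega> / (2 * \<gamma>) * slack (u k \<omega>) (p k \<omega>) (w j))"
      using True s[of 0] by (simp add: noise_def step_surplus_def w_def sum_distrib_left)
    then show ?thesis using avg(1) N by (simp add: mult_nonneg_nonpos)
  next
    case False
    let ?z = "use_moving_offset (\<gamma> *\<^sub>R \<Theta> (u 1 \<omega>)) (p 0 \<omega>)"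
    have "(\<Sum>j\<in>UNIV. noise k (branch k j \<omega>))
        = weight ?z * (\<Sum>j\<in>UNIV. surplus (e k \<omega>) (u k \<omega>) (p k \<omega>) (w j))"
      using False s[of 0] s[of 1] s[of k] by (simp add: noise_def step_surplus_def w_def sum_distrib_left)
    then show ?thesis using avg(2) weight_pos[of ?z] by (simp add: mult_nonneg_nonpos)
  qed
qed

definition gap :: "real^'n \<Rightarrow> real" where
  "gap x = \<bar>F x - F us\<bar> + norm (proj (\<Theta> x))"

definition average :: "nat \<Rightarrow> 'w \<Rightarrow> real^'n" where
  "average t \<omega> = (1 / (\<Sum>k\<le>t. e k \<omega>)) *\<^sub>R (\<Sum>k\<le>t. e k \<omega> *\<^sub>R u (Suc k) \<omega>)"

definition initial_energy :: real where
  "initial_energy = (2 * N - 1) * D us u\<^sub>0 + e\<^sub>0 / (2 * \<gamma>) * ((2 * N - 1) * (N - 1) / N *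
     (2 * \<gamma> * (aug u\<^sub>0 p\<^sub>0 - F us) + (norm (ps - p\<^sub>0))\<^sup>2) + 2 * N * (norm p\<^sub>0 + \<mu>)\<^sup>2)"

lemma gap_average_path:
  assumes \<omega>: "\<omega> \<in> space M"
  shows "(\<mu> - norm ps) * low * (real t + 1) * gap (average t \<omega>)
    \<le> (\<mu> + 1) * (initial_energy + (\<Sum>k\<le>t. noise k \<omega>))"
proof -
  define E where "E = initial_energy + (\<Sum>k\<le>t. noise k \<omega>)"
  define s where "s = (\<Sum>k\<le>t. e k \<omega>)"
  define x where "x = average t \<omega>"
  have "(\<Sum>k\<le>t. low) \<le> s" unfolding s_def by (rule sum_mono) (rule low_le[OF \<omega>])
  then have s_low: "low * (real t + 1) \<le> s" by (simp add: algebra_simps)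
  moreover have "0 < low * (real t + 1)" using low(1) by simp
  ultimately have s: "0 < s" by linarith
  have split: "(\<Sum>k\<le>t. f k) = f 0 + (\<Sum>k\<in>{1..t}. f k)" for f :: "nat \<Rightarrow> real"
    by (simp add: atMost_atLeast0 sum.atLeast_Suc_atMost)
  have sum: "(\<Sum>k\<le>t. e k \<omega> * (F (u (Suc k) \<omega>) + y \<bullet> \<Theta> (u (Suc k) \<omega>) - F us)) \<le> E"
    if "y \<in> dual_cone C" "norm y \<le> \<mu>" for y
  proof -
    have "e (Suc k) \<omega> \<le> e k \<omega>" for k by (simp add: e_Suc[OF \<omega>])
    then show ?thesis
      using path_bound[of "\<lambda>k. u k \<omega>" "\<lambda>k. p k \<omega>" "\<lambda>k. e k \<omega>" y t] that
        u_in[OF \<omega>] p_Suc[OF \<omega>] less_imp_le[OF e_pos[OF \<omega>]]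
      unfolding E_def split[of "\<lambda>k. noise k \<omega>"]
      by (simp add: noise_def step_surplus_def initial_energy_def start(2-4)[OF \<omega>])
  qed
  have e0: "0 < (\<Sum>k\<le>t. e k \<omega>)" using s by (simp add: s_def)
  have avg: "x \<in> U" "s * (F x + y \<bullet> \<Theta> x - F us) \<le> E" if y: "y \<in> dual_cone C" "norm y \<le> \<mu>" for y
  proof -
    note * = average_bound[OF y(1), of "\<lambda>k. u k \<omega>" "\<lambda>k. e k \<omega>" t,
        OF u_in[OF \<omega>] less_imp_le[OF e_pos[OF \<omega>]] e0, folded average_def s_def, folded x_def]
    show "x \<in> U" by (rule *(1))
    show "s * (F x + y \<bullet> \<Theta> x - F us) \<le> E" using *(2) sum[OF y] by linarith
  qed
  have xU: "x \<in> U" using avg(1)[OF ps] .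
  have "(\<mu> - norm ps) * gap x \<le> (\<mu> + 1) * (E / s)"
    unfolding gap_def by (rule gap_bound[OF xU]) (use avg(2) s in \<open>simp add: field_simps\<close>)
  then have "s * ((\<mu> - norm ps) * gap x) \<le> s * ((\<mu> + 1) * (E / s))" by (rule mult_left_mono) (use s in simp)
  then have "s * ((\<mu> - norm ps) * gap x) \<le> (\<mu> + 1) * E" using s by simp
  moreover have "low * (real t + 1) * ((\<mu> - norm ps) * gap x) \<le> s * ((\<mu> - norm ps) * gap x)"
    using ps_bound by (intro mult_right_mono[OF s_low]) (auto simp: gap_def)
  ultimately show ?thesis by (simp add: E_def x_def mult_ac)
qed

lemma average_in: "\<omega> \<in> space M \<Longrightarrow> average t \<omega> \<in> U"
proof -
  assume \<omega>: "\<omega> \<in> space M"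
  have "0 < (\<Sum>k\<le>t. e k \<omega>)" by (rule sum_pos) (use e_pos[OF \<omega>] in auto)
  from average_bound(1)[OF ps_cone, of "\<lambda>k. u k \<omega>" "\<lambda>k. e k \<omega>" t,
      OF u_in[OF \<omega>] less_imp_le[OF e_pos[OF \<omega>]] this]
  show "average t \<omega> \<in> U" by (simp add: average_def)
qed

lemma determined_gap: "determined (Suc t) (\<lambda>\<omega>. gap (average t \<omega>))"
proof (rule determinedI)
  fix \<omega> \<omega>' assume \<omega>: "\<omega> \<in> space M" "\<omega>' \<in> space M" and a: "\<And>n. n < Suc t \<Longrightarrow> i n \<omega> = i n \<omega>'"
  have "u l \<omega> = u l \<omega>'" "e l \<omega> = e l \<omega>'" if "l \<le> Suc t" for l
    using state_eq[OF \<omega>, of "Suc t" l] a that by blast+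
  then have "average t \<omega> = average t \<omega>'" by (simp add: average_def)
  then show "gap (average t \<omega>) = gap (average t \<omega>')" by simp
qed

lemma expected_gap:
  "(\<mu> - norm ps) * low * (real t + 1) * expectation (\<lambda>\<omega>. gap (average t \<omega>)) \<le> (\<mu> + 1) * initial_energy"
proof -
  have int: "integrable M (noise k)" for k by (rule determined_integrable[OF determined_noise])
  have "(\<mu> - norm ps) * low * (real t + 1) * expectation (\<lambda>\<omega>. gap (average t \<omega>))
      = expectation (\<lambda>\<omega>. (\<mu> - norm ps) * low * (real t + 1) * gap (average t \<omega>))"
    by simp
  also have "\<dots> \<le> expectation (\<lambda>\<omega>. (\<mu> + 1) * (initial_energy + (\<Sum>k\<le>t. noise k \<omega>)))"
    by (rule integral_mono)
      (use int determined_integrable[OF determined_gap] gap_average_path in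
        \<open>auto intro!: integrable_mult_right Bochner_Integration.integrable_add Bochner_Integration.integrable_sum\<close>)
  also have "\<dots> = (\<mu> + 1) * (initial_energy + (\<Sum>k\<le>t. expectation (noise k)))"
    using int by (simp add: prob_space)
  also have "\<dots> \<le> (\<mu> + 1) * (initial_energy + 0)"
    using expectation_noise mu_pos by (intro mult_left_mono add_left_mono sum_nonpos) auto
  finally show ?thesis by simp
qed

lemma gap_tail:
  assumes "0 < \<epsilon>" "0 < \<eta>" "(\<mu> + 1) * initial_energy \<le> \<epsilon> * \<eta> * low * (\<mu> - norm ps) * (real t + 1)"
  shows "1 - \<eta> \<le> prob {\<omega> \<in> space M. gap (average t \<omega>) \<le> \<epsilon>}"
proof -
  let ?X = "\<lambda>\<omega>. gap (average t \<omega>)"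
  define c where "c = (\<mu> - norm ps) * low * (real t + 1)"
  have c: "0 < c" using ps_bound low(1) by (simp add: c_def)
  have int: "integrable M ?X" by (rule determined_integrable[OF determined_gap])
  have "c * expectation ?X \<le> c * (\<epsilon> * \<eta>)"
    using expected_gap[of t] assms(3) by (simp add: c_def mult_ac)
  then have "expectation ?X \<le> \<epsilon> * \<eta>" using c by simp
  then have 1: "expectation ?X / \<epsilon> \<le> \<eta>" using assms(1) by (simp add: field_simps)
  have meas [measurable]: "?X \<in> borel_measurable M" using int by simp
  have "prob {\<omega> \<in> space M. \<epsilon> \<le> ?X \<omega>} \<le> expectation ?X / \<epsilon>"
    by (rule integral_Markov_inequality_measure[OF int, of "{}"]) (use assms(1) in \<open>auto simp: gap_def\<close>)
  moreover have "prob {\<omega> \<in> space M. \<not> ?X \<omega> \<le> \<epsilon>} \<le> prob {\<omega> \<in> space M. \<epsilon> \<le> ?X \<omega>}"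
    by (rule finite_measure_mono) auto
  moreover have "prob {\<omega> \<in> space M. \<not> ?X \<omega> \<le> \<epsilon>} = 1 - prob {\<omega> \<in> space M. ?X \<omega> \<le> \<epsilon>}"
    by (rule prob_neg) simp
  ultimately show ?thesis using 1 by linarith
qed

end

section \<open>Extended-real data and the convergence rate\<close>

lemma convex_on_finite_ext:
  assumes J: "ext_convex J" and U: "convex U" and f: "\<And>x. x \<in> U \<Longrightarrow> J x = ereal (f x)"
  shows "convex_on U f"
  unfolding convex_on_def
proof (intro conjI ballI allI impI)
  fix x y and s t :: real assume xy: "x \<in> U" "y \<in> U" and st: "0 \<le> s" "0 \<le> t" "s + t = 1"
  have "(x, f x) \<in> {(x, r). J x \<le> ereal r}" "(y, f y) \<in> {(x, r). J x \<le> ereal r}"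
    using f xy by auto
  from convexD[OF J[unfolded ext_convex_def] this st]
  have "J (s *\<^sub>R x + t *\<^sub>R y) \<le> ereal (s * f x + t * f y)" by simp
  moreover have "s *\<^sub>R x + t *\<^sub>R y \<in> U" by (rule convexD[OF U xy st])
  ultimately show "f (s *\<^sub>R x + t *\<^sub>R y) \<le> s * f x + t * f y" using f by simp
qed (rule U)

lemma saddle_point_dual_solution:
  fixes L :: "'a \<Rightarrow> 'c \<Rightarrow> ereal"
  assumes "saddle_point L U P us ps"
  shows "ps \<in> dual_solutions L U P"
  unfolding dual_solutions_def
proof (intro CollectI conjI ballI)
  show "ps \<in> P" using assms by (simp add: saddle_point_def)
  fix y assume y: "y \<in> P"
  have "(INF x\<in>U. L x y) \<le> L us y" using assms by (intro INF_lower) (simp add: saddle_point_def)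
  also have "\<dots> \<le> L us ps" using assms y by (auto simp: saddle_point_def)
  also have "\<dots> \<le> (INF x\<in>U. L x ps)" using assms by (intro INF_greatest) (auto simp: saddle_point_def)
  finally show "(INF x\<in>U. L x y) \<le> (INF x\<in>U. L x ps)" .
qed

lemma saddle_point_real:
  fixes \<Theta> :: "'a \<Rightarrow> 'c::euclidean_space"
  assumes sp: "saddle_point (lagrangian F \<Theta>) U (dual_cone C) us ps"
    and F: "\<And>x. x \<in> U \<Longrightarrow> F x = ereal (f x)"
  shows "us \<in> U" "ps \<in> dual_cone C" "y \<in> dual_cone C \<Longrightarrow> y \<bullet> \<Theta> us \<le> 0" "ps \<bullet> \<Theta> us = 0"
    "x \<in> U \<Longrightarrow> f us \<le> f x + ps \<bullet> \<Theta> x"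
proof -
  interpret closed_cone "dual_cone C" by (rule dual_cone_closed_cone)
  show us: "us \<in> U" and ps: "ps \<in> dual_cone C" using sp by (auto simp: saddle_point_def)
  have up: "y \<bullet> \<Theta> us \<le> ps \<bullet> \<Theta> us" if "y \<in> dual_cone C" for y
    using sp us that F[OF us] by (auto simp: saddle_point_def lagrangian_def)
  have dn: "f us + ps \<bullet> \<Theta> us \<le> f x + ps \<bullet> \<Theta> x" if "x \<in> U" for x
    using sp us ps that F[OF us] F[OF that] by (auto simp: saddle_point_def lagrangian_def)
  have "2 *\<^sub>R ps \<in> dual_cone C" using set_conic ps by (simp add: conic_def)
  then show 0: "ps \<bullet> \<Theta> us = 0" using up[OF zero_in] up[of "2 *\<^sub>R ps"] by simp
  show "y \<in> dual_cone C \<Longrightarrow> y \<bullet> \<Theta> us \<le> 0" using up[of y] 0 by simp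
  show "x \<in> U \<Longrightarrow> f us \<le> f x + ps \<bullet> \<Theta> x" using dn[of x] 0 by simp
qed

text \<open>
  The supremum over the open ball is approached in the direction opposite to \<open>p\<close>.
\<close>

lemma le_SUP_ball:
  fixes p :: "'a::euclidean_space"
  assumes c: "0 \<le> c" and \<mu>: "0 < \<mu>"
  shows "a + c * (norm p + \<mu>)\<^sup>2 \<le> (SUP y\<in>{y::'a. norm y < \<mu>}. a + c * (norm (y - p))\<^sup>2)"
proof -
  let ?S = "SUP y\<in>{y::'a. norm y < \<mu>}. a + c * (norm (y - p))\<^sup>2"
  have bdd: "bdd_above ((\<lambda>y. a + c * (norm (y - p))\<^sup>2) ` {y::'a. norm y < \<mu>})"
  proof (rule bdd_aboveI2)
    fix y :: 'a assume "y \<in> {y. norm y < \<mu>}"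
    then have "norm (y - p) \<le> norm p + \<mu>" using norm_triangle_ineq4[of y p] by simp
    then have "(norm (y - p))\<^sup>2 \<le> (norm p + \<mu>)\<^sup>2" by (intro power_mono) auto
    then show "a + c * (norm (y - p))\<^sup>2 \<le> a + c * (norm p + \<mu>)\<^sup>2" using c by (simp add: mult_left_mono)
  qed
  obtain v :: 'a where v: "norm v = 1" "p = norm p *\<^sub>R v"
  proof (cases "p = 0")
    case True
    then show ?thesis using that[of "SOME b. b \<in> Basis"] by (simp add: some_in_eq norm_Basis)
  next
    case False
    then show ?thesis using that[of "(1 / norm p) *\<^sub>R p"] by simp
  qed
  have below: "a + c * (norm p + s)\<^sup>2 \<le> ?S" if s: "0 \<le> s" "s < \<mu>" for s
  proof -
    have "- s *\<^sub>R v - p = - (norm p + s) *\<^sub>R v" by (subst (1) v(2)) (simp add: algebra_simps)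
    then have "norm (- s *\<^sub>R v - p) = \<bar>- (norm p + s)\<bar> * norm v" by (simp only: norm_scaleR)
    then have "norm (- s *\<^sub>R v - p) = norm p + s" unfolding v(1) abs_minus_cancel using s by simp
    then show ?thesis
      using cSUP_upper[OF _ bdd, of "- s *\<^sub>R v"] v(1) s by simp
  qed
  have "((\<lambda>s. a + c * (norm p + s)\<^sup>2) \<longlongrightarrow> a + c * (norm p + \<mu>)\<^sup>2) (at_left \<mu>)"
    by (intro tendsto_intros)
  then show ?thesis
  proof (rule tendsto_upperbound)
    show "\<forall>\<^sub>F s in at_left \<mu>. a + c * (norm p + s)\<^sup>2 \<le> ?S"
      using eventually_at_left_real[OF \<mu>] by eventually_elim (simp add: below)
  qed simp
qed

theorem mainTheorem3:
  fixes b :: "'n::finite \<Rightarrow> 'b::finite"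
    and Us :: "'b \<Rightarrow> (real^'n) set" and U :: "(real^'n) set"
    and C :: "(real^'m::finite) set"
    and G K :: "real^'n \<Rightarrow> real" and gradG gradK :: "real^'n \<Rightarrow> real^'n"
    and Js :: "'b \<Rightarrow> real^'n \<Rightarrow> ereal" and J F :: "real^'n \<Rightarrow> ereal"
    and \<Omega> :: "real^'n \<Rightarrow> real^'m" and dOm :: "real^'n \<Rightarrow> real^'n \<Rightarrow> real^'m"
    and Phs :: "'b \<Rightarrow> real^'n \<Rightarrow> real^'m" and \<Phi> \<Theta> :: "real^'n \<Rightarrow> real^'m"
    and T :: "real^'m" and Os :: "(real^'n) set"
    and c\<^sub>1 c\<^sub>2 B\<^sub>G \<tau> \<beta> B \<gamma> \<rho> N \<mu>\<^sub>0 \<mu> eps_init eps\<^sub>0 eps_low d\<^sub>3 :: real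
    and L L\<^sub>\<gamma> :: "real^'n \<Rightarrow> real^'m \<Rightarrow> ereal"
    and D :: "real^'n \<Rightarrow> real^'n \<Rightarrow> real"
    and proj :: "real^'m \<Rightarrow> real^'m"
    and u\<^sub>0 us :: "real^'n" and p\<^sub>0 ps :: "real^'m"
    and h\<^sub>3 :: "real^'n \<Rightarrow> real^'m \<Rightarrow> real"
    and gap :: "real^'n \<Rightarrow> real"
    and M :: "'w measure" and i :: "nat \<Rightarrow> 'w \<Rightarrow> 'b"
    and u :: "nat \<Rightarrow> 'w \<Rightarrow> real^'n" and p q :: "nat \<Rightarrow> 'w \<Rightarrow> real^'m"
    and eps :: "nat \<Rightarrow> 'w \<Rightarrow> real" and ubar :: "nat \<Rightarrow> 'w \<Rightarrow> real^'n"
  \<comment> \<open>problem data\<close>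
  assumes N_def: "N = real CARD('b)"
    and blocks_nonempty: "surj b"
    and Us_blocks: "\<And>j. Us j \<subseteq> range (block b j)"
    and U_def: "U = block_product b Us"
    and U: "closed U" "convex U"
    and C: "closed C" "convex_cone C"
    and J_def: "J = (\<lambda>x. \<Sum>j\<in>UNIV. Js j (block b j x))"
    and Js_proper: "\<And>j x. Js j (block b j x) \<noteq> - \<infinity>"
    and F_def: "F = (\<lambda>x. ereal (G x) + J x)"
    and \<Phi>_def: "\<Phi> = (\<lambda>x. \<Sum>j\<in>UNIV. Phs j (block b j x))"
    and \<Theta>_def: "\<Theta> = (\<lambda>x. \<Omega> x + \<Phi> x)"
    and proj_def: "proj = closest_point (dual_cone C)"
    and L_def: "L = lagrangian F \<Theta>"
    and L\<gamma>_def: "L\<^sub>\<gamma> = aug_lagrangian F \<Theta> C \<gamma>"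
    and D_def: "D = bregman K gradK"
    and gap_def: "gap = (\<lambda>x. \<bar>real_of_ereal (F x) - real_of_ereal (F us)\<bar> + norm (proj (\<Theta> x)))"
  \<comment> \<open>standing assumptions; (A7) is the existence of \<open>(us, ps)\<close> below\<close>
    and A1: "ext_convex J" "lower_semicontinuous J" "{x. J x < \<infinity>} \<inter> U \<noteq> {}"
      "\<And>x. x \<in> U \<Longrightarrow> subdifferential J x \<noteq> {}"
      "0 < c\<^sub>1" "0 < c\<^sub>2"
      "\<And>x r. x \<in> U \<Longrightarrow> r \<in> subdifferential J x \<Longrightarrow> norm r \<le> c\<^sub>1 * norm x + c\<^sub>2"
    and A2: "convex_on UNIV G" "\<And>x. GDERIV G x :> gradG x" "B\<^sub>G-lipschitz_on UNIV gradG"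
    and A3: "cone_convex_on U C \<Omega>" "\<And>x. (\<Omega> has_derivative dOm x) (at x)" "T \<in> C"
      "\<And>x y. x \<in> U \<Longrightarrow> y \<in> U \<Longrightarrow>
         dOm x (x - y) - dOm y (x - y) - (norm (x - y))\<^sup>2 *\<^sub>R T \<in> uminus ` C"
    and A4: "cone_convex_on U C \<Phi>"
    and A5: "open Os" "U \<subseteq> Os" "\<tau>-lipschitz_on Os \<Theta>"
    and A6: "interior C \<noteq> {} \<Longrightarrow> \<Theta> ` U \<inter> uminus ` interior C \<noteq> {}"
      "C = {0} \<Longrightarrow> 0 \<in> interior (\<Theta> ` U)"
    and K: "0 < \<beta>" "strongly_convex_on \<beta> U K" "\<And>x. x \<in> U \<Longrightarrow> GDERIV K x :> gradK x"
      "B-lipschitz_on U gradK"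
  \<comment> \<open>saddle point and parameters\<close>
    and saddle: "saddle_point L U (dual_cone C) us ps"
    and \<gamma>: "0 < \<gamma>"
    and \<rho>_def: "\<rho> = \<gamma> / (2 * N - 1)"
    and \<mu>\<^sub>0: "\<And>y. y \<in> dual_solutions L U (dual_cone C) \<Longrightarrow> norm y \<le> \<mu>\<^sub>0"
    and \<mu>_def: "\<mu> = \<mu>\<^sub>0 + 1"
  \<comment> \<open>the algorithm, driven by independent uniformly distributed block indices\<close>
    and M: "prob_space M"
    and i_indep: "prob_space.indep_vars M (\<lambda>_. count_space UNIV) i UNIV"
    and i_uniform: "\<And>k j. measure M {\<omega> \<in> space M. i k \<omega> = j} = 1 / N"
    and init: "u\<^sub>0 \<in> U" "0 < eps_init"
      "\<And>\<omega>. \<omega> \<in> space M \<Longrightarrow> u 0 \<omega> = u\<^sub>0" "\<And>\<omega>. \<omega> \<in> space M \<Longrightarrow> p 0 \<omega> = p\<^sub>0"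
    and q_def: "\<And>k \<omega>. \<omega> \<in> space M \<Longrightarrow> q k \<omega> = proj (p k \<omega> + \<gamma> *\<^sub>R \<Theta> (u k \<omega>))"
    and eps\<^sub>0_def: "eps\<^sub>0 = min eps_init (spdcl_bound \<beta> B\<^sub>G \<gamma> \<tau> T (proj (p\<^sub>0 + \<gamma> *\<^sub>R \<Theta> u\<^sub>0)))"
    and eps_0: "\<And>\<omega>. \<omega> \<in> space M \<Longrightarrow> eps 0 \<omega> = eps\<^sub>0"
    and eps_Suc: "\<And>k \<omega>. \<omega> \<in> space M \<Longrightarrow>
      eps (Suc k) \<omega> = min (eps k \<omega>) (spdcl_bound \<beta> B\<^sub>G \<gamma> \<tau> T (q (Suc k) \<omega>))"
    and u_Suc: "\<And>k \<omega>. \<omega> \<in> space M \<Longrightarrow>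
      spdcl_primal_step b U
        (spdcl_objective b gradG Js dOm Phs K gradK (i k \<omega>) (u k \<omega>) (q k \<omega>) (eps k \<omega>))
        (i k \<omega>) (u k \<omega>) (u (Suc k) \<omega>)"
    and p_Suc: "\<And>k \<omega>. \<omega> \<in> space M \<Longrightarrow>
      p (Suc k) \<omega> = closest_point (cball 0 \<mu>)
        (p k \<omega> + (\<rho> / \<gamma>) *\<^sub>R (proj (p k \<omega> + \<gamma> *\<^sub>R \<Theta> (u (Suc k) \<omega>)) - p k \<omega>))"
    and eps_low: "0 < eps_low" "AE \<omega> in M. \<forall>k. eps_low \<le> eps k \<omega>"
    and ubar_def: "\<And>t \<omega>. ubar t \<omega> =
      (1 / (\<Sum>k\<le>t. eps k \<omega>)) *\<^sub>R (\<Sum>k\<le>t. eps k \<omega> *\<^sub>R u (Suc k) \<omega>)"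
    and h\<^sub>3_def: "\<And>x y. h\<^sub>3 x y =
      D x u\<^sub>0 + (N - 1) / N * D us u\<^sub>0 + eps\<^sub>0 / \<gamma> * (norm (y - p\<^sub>0))\<^sup>2
      + (2 * N - 1) * (N - 1) * eps\<^sub>0 / N\<^sup>2
        * ((norm (ps - p\<^sub>0))\<^sup>2 / (2 * \<gamma>) + real_of_ereal (L\<^sub>\<gamma> u\<^sub>0 p\<^sub>0 - L us ps))"
    and d\<^sub>3_def: "d\<^sub>3 = (SUP y\<in>{y. norm y < \<mu>}. h\<^sub>3 us y)"
  shows "(\<forall>t>0. prob_space.expectation M (\<lambda>\<omega>. gap (ubar t \<omega>))
            \<le> (\<mu> + 1) * N * d\<^sub>3 / ((\<mu> - norm ps) * eps_low * (real t + 1)))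
    \<and> (\<forall>\<epsilon> \<eta>. 0 < \<epsilon> \<longrightarrow> \<epsilon> < gap u\<^sub>0 \<longrightarrow> 0 < \<eta> \<longrightarrow> \<eta> < 1 \<longrightarrow>
          (\<forall>t>0. real t \<ge> (\<mu> + 1) * N * d\<^sub>3 / (\<epsilon> * \<eta> * eps_low * (\<mu> - norm ps)) - 1 \<longrightarrow>
             measure M {\<omega> \<in> space M. gap (ubar t \<omega>) \<le> \<epsilon>} \<ge> 1 - \<eta>))"
proof -
  define Jb where "Jb j x = real_of_ereal (Js j x)" for j x
  define Fr where "Fr x = G x + (\<Sum>j\<in>UNIV. Jb j (block b j x))" for x
  have Js_fin: "Js j (block b j x) = ereal (Jb j (block b j x))" if x: "x \<in> U" for j x
  proof -
    have "\<bar>J x\<bar> \<noteq> \<infinity>" using A1(4)[OF x] by (auto simp: subdifferential_def)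
    then have "(\<Sum>j\<in>UNIV. Js j (block b j x)) \<noteq> \<infinity>" by (auto simp: J_def)
    then have "Js j (block b j x) \<noteq> \<infinity>" by (simp add: sum_Pinfty)
    then show ?thesis using Js_proper[of j x] by (cases "Js j (block b j x)") (auto simp: Jb_def)
  qed
  have J_fin: "J x = ereal (\<Sum>j\<in>UNIV. Jb j (block b j x))" if "x \<in> U" for x
    using Js_fin[OF that] by (simp add: J_def)
  have F_fin: "F x = ereal (Fr x)" if "x \<in> U" for x
    using J_fin[OF that] by (simp add: F_def Fr_def)
  note real_saddle = saddle_point_real[OF saddle[unfolded L_def] F_fin]
  have us: "us \<in> U" and ps: "ps \<in> dual_cone C" and comp: "ps \<bullet> \<Theta> us = 0"
    by (rule real_saddle; assumption)+
  have feasible: "y \<bullet> \<Theta> us \<le> 0" if "y \<in> dual_cone C" for y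
    using that by (intro real_saddle(3))
  have optimal: "Fr us \<le> Fr x + ps \<bullet> \<Theta> x" if "x \<in> U" for x
    using that by (intro real_saddle(5))
  have "norm ps \<le> \<mu>\<^sub>0" by (rule \<mu>\<^sub>0) (rule saddle_point_dual_solution[OF saddle])
  then have ps_mu: "norm ps + 1 \<le> \<mu>" by (simp add: \<mu>_def)
  interpret P: spdcl_problem b Us U C G K gradG gradK Jb \<Omega> dOm Phs T B\<^sub>G \<tau> \<beta> \<gamma> N Fr \<Theta> us ps \<mu>
  proof
    show "convex_on U (\<lambda>x. \<Sum>j\<in>UNIV. Jb j (block b j x))"
      by (rule convex_on_finite_ext[OF A1(1) U(2) J_fin])
    show "cone_convex_on U C (\<lambda>x. \<Sum>j\<in>UNIV. Phs j (block b j x))"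
      using A4 unfolding \<Phi>_def .
    show "\<tau>-lipschitz_on U \<Theta>"
      by (rule lipschitz_on_subset[OF A5(3,2)])
    show "Fr x = G x + (\<Sum>j\<in>UNIV. Jb j (block b j x))" for x by (rule Fr_def)
    show "\<Theta> x = \<Omega> x + (\<Sum>j\<in>UNIV. Phs j (block b j x))" for x by (simp add: \<Theta>_def \<Phi>_def)
  qed (fact U_def U(2) A2 A3 K(1-3) \<gamma> N_def us feasible optimal ps ps_mu)+
  have proj_P: "proj = P.proj" by (simp add: proj_def P.proj_def)
  have choices: "uniform_choices M i"
    using M i_indep i_uniform by (simp add: uniform_choices_def uniform_choices_axioms_def N_def)
  interpret C: uniform_choices M i by (rule choices)
  interpret R: spdcl_run b Us U C G K gradG gradK Jb \<Omega> dOm Phs T B\<^sub>G \<tau> \<beta> \<gamma> N Fr \<Theta> us ps \<mu>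
    M i u p eps u\<^sub>0 p\<^sub>0 eps\<^sub>0 eps_low
  proof
    show "u\<^sub>0 \<in> U" by (rule init(1))
    show "0 < eps_low" "AE \<omega> in M. \<forall>k. eps_low \<le> eps k \<omega>" by (rule eps_low)+
    show "eps\<^sub>0 \<le> spdcl_bound \<beta> B\<^sub>G \<gamma> \<tau> T (P.proj (p\<^sub>0 + \<gamma> *\<^sub>R \<Theta> u\<^sub>0))"
      by (simp add: eps\<^sub>0_def proj_P)
    fix k \<omega> assume \<omega>: "\<omega> \<in> space M"
    show "u 0 \<omega> = u\<^sub>0" "p 0 \<omega> = p\<^sub>0" "eps 0 \<omega> = eps\<^sub>0" using init(3,4) eps_0 \<omega> by auto
    show "eps (Suc k) \<omega> = min (eps k \<omega>)
        (spdcl_bound \<beta> B\<^sub>G \<gamma> \<tau> T (P.proj (p (Suc k) \<omega> + \<gamma> *\<^sub>R \<Theta> (u (Suc k) \<omega>))))"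
      by (simp add: eps_Suc[OF \<omega>] q_def[OF \<omega>] proj_P)
    have "\<rho> / \<gamma> = 1 / (2 * N - 1)" using \<gamma> by (simp add: \<rho>_def)
    then show "p (Suc k) \<omega> = P.upd (\<gamma> *\<^sub>R \<Theta> (u (Suc k) \<omega>)) (p k \<omega>)"
      by (simp add: p_Suc[OF \<omega>] P.upd_def proj_P)
    have obj: "spdcl_objective b gradG Js dOm Phs K gradK j v y s x
        = ereal (P.block_cost j v y x + 1 / s * bregman K gradK x v)" if "x \<in> U" for j v y s x
      using Js_fin[OF that] by (simp add: spdcl_objective_def P.block_cost_def block_inner)
    show "P.primal_step (i k \<omega>) (u k \<omega>) (P.proj (p k \<omega> + \<gamma> *\<^sub>R \<Theta> (u k \<omega>))) (eps k \<omega>) (u (Suc k) \<omega>)"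
      using u_Suc[OF \<omega>, of k] unfolding spdcl_primal_step_def is_arg_min_def P.primal_step_def
        q_def[OF \<omega>] proj_P
      by (auto simp: obj not_less)
  qed
  have avg: "ubar t \<omega> = R.average t \<omega>" for t \<omega>
    by (simp add: ubar_def R.average_def)
  have gap_eq: "gap (ubar t \<omega>) = R.gap (R.average t \<omega>)" if "\<omega> \<in> space M" for t \<omega>
    using F_fin[OF R.average_in[OF that]] F_fin[OF us] by (simp add: gap_def R.gap_def avg proj_P)
  have energy: "R.initial_energy \<le> N * d\<^sub>3"
  proof -
    obtain \<omega> where "\<omega> \<in> space M" using C.not_empty by auto
    then have e0: "0 < eps\<^sub>0" using R.e_pos[of \<omega> 0] eps_0 by simp
    define D0 where "D0 = D us u\<^sub>0"
    define A where "A = P.aug u\<^sub>0 p\<^sub>0 - Fr us"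
    define r where "r = (norm (ps - p\<^sub>0))\<^sup>2"
    define a where "a = D0 + (N - 1) / N * D0
        + (2 * N - 1) * (N - 1) * eps\<^sub>0 / N\<^sup>2 * (r / (2 * \<gamma>) + A)"
    have "L us ps = ereal (Fr us)" using F_fin[OF us] comp by (simp add: L_def lagrangian_def)
    moreover have "L\<^sub>\<gamma> u\<^sub>0 p\<^sub>0 = ereal (P.aug u\<^sub>0 p\<^sub>0)"
      using F_fin[OF init(1)]
      by (simp add: L\<gamma>_def aug_lagrangian_def P.aug_def P.aug_term_def P.proj_def)
    ultimately have h: "h\<^sub>3 us y = a + eps\<^sub>0 / \<gamma> * (norm (y - p\<^sub>0))\<^sup>2" for y
      by (simp add: h\<^sub>3_def a_def A_def r_def D0_def)
    have "a + eps\<^sub>0 / \<gamma> * (norm p\<^sub>0 + \<mu>)\<^sup>2 \<le> d\<^sub>3"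
      unfolding d\<^sub>3_def h by (rule le_SUP_ball) (use e0 \<gamma> P.mu_pos in auto)
    then have "N * (a + eps\<^sub>0 / \<gamma> * (norm p\<^sub>0 + \<mu>)\<^sup>2) \<le> N * d\<^sub>3"
      using P.N by (intro mult_left_mono) auto
    moreover have "R.initial_energy = N * (a + eps\<^sub>0 / \<gamma> * (norm p\<^sub>0 + \<mu>)\<^sup>2)"
      unfolding R.initial_energy_def a_def A_def[symmetric] r_def[symmetric] D_def[symmetric] D0_def[symmetric]
      using \<gamma> P.N by (simp add: field_simps power2_eq_square)
    ultimately show ?thesis by simp
  qed
  have energy': "(\<mu> + 1) * R.initial_energy \<le> (\<mu> + 1) * N * d\<^sub>3"
    using mult_left_mono[OF energy, of "\<mu> + 1"] P.mu_pos by (simp add: mult.assoc)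
  have pos: "0 < \<mu> - norm ps" using ps_mu by simp
  show ?thesis
  proof (intro conjI allI impI)
    fix t :: nat
    have "C.expectation (\<lambda>\<omega>. gap (ubar t \<omega>)) = C.expectation (\<lambda>\<omega>. R.gap (R.average t \<omega>))"
      by (rule Bochner_Integration.integral_cong) (simp_all add: gap_eq)
    moreover have "(\<mu> - norm ps) * eps_low * (real t + 1) * C.expectation (\<lambda>\<omega>. R.gap (R.average t \<omega>))
        \<le> (\<mu> + 1) * N * d\<^sub>3"
      using R.expected_gap[of t] energy' by linarith
    ultimately show "C.expectation (\<lambda>\<omega>. gap (ubar t \<omega>))
        \<le> (\<mu> + 1) * N * d\<^sub>3 / ((\<mu> - norm ps) * eps_low * (real t + 1))"
      using pos eps_low(1) by (simp add: pos_le_divide_eq mult.commute)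
  next
    fix \<epsilon> \<eta> :: real and t :: nat
    assume *: "0 < \<epsilon>" "0 < \<eta>"
      and t: "(\<mu> + 1) * N * d\<^sub>3 / (\<epsilon> * \<eta> * eps_low * (\<mu> - norm ps)) - 1 \<le> real t"
    have "(\<mu> + 1) * N * d\<^sub>3 / (\<epsilon> * \<eta> * eps_low * (\<mu> - norm ps)) \<le> real t + 1" using t by simp
    then have "(\<mu> + 1) * N * d\<^sub>3 \<le> (real t + 1) * (\<epsilon> * \<eta> * eps_low * (\<mu> - norm ps))"
      using * pos eps_low(1) by (subst (asm) pos_divide_le_eq) auto
    then have "(\<mu> + 1) * R.initial_energy \<le> \<epsilon> * \<eta> * eps_low * (\<mu> - norm ps) * (real t + 1)"
      using energy' by (simp add: mult_ac)
    from R.gap_tail[OF * this]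
    have "1 - \<eta> \<le> C.prob {\<omega> \<in> space M. R.gap (R.average t \<omega>) \<le> \<epsilon>}" .
    also have "{\<omega> \<in> space M. R.gap (R.average t \<omega>) \<le> \<epsilon>} = {\<omega> \<in> space M. gap (ubar t \<omega>) \<le> \<epsilon>}"
      by (auto simp: gap_eq)
    finally show "1 - \<eta> \<le> C.prob {\<omega> \<in> space M. gap (ubar t \<omega>) \<le> \<epsilon>}" .
  qed
qed

end
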